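(* Let $d\in\{2,3\}$, let $\Omega\subset\mathbb{R}^d$ be a bounded simply connected open set with Lipschitz boundary and unit outward normal $\nu$, and let $D=\bigcup_{j=1}^J D_j\subset\Omega$, $D_j=x_j+\epsilon B_j$, be a union of small volume regions as described in the context. For $f\in H^{1/2}(\partial\Omega)$ let $u(\cdot,f)\in H^1(\Omega)$ be the unique solution of $-\Delta u+\rho\chi_Du=0$ in $\Omega$, $u|_{\partial\Omega}=f$, and for $h\in H^{1/2}(\partial\Omega)$ let $u_0(\cdot,h)\in H^1(\Omega)$ be the harmonic function in $\Omega$ with $u_0(\cdot,h)|_{\partial\Omega}=h$. Then for all $f,g\in H^{1/2}(\partial\Omega)$ the reciprocity gap functional $$R_f\big[u_0(\cdot,g)\big]=\int_{\partial\Omega}u_0(\cdot,g)\,\partial_\nu u(\cdot,f)-u(\cdot,f)\,\partial_\nu u_0(\cdot,g)\,ds$$ satisfies $$R_f\big[u_0(\cdot,g)\big]=\epsilon^d\sum_{j=1}^J|B_j|\,\mathrm{Avg}(\rho_j)\,u_0(x_j,f)\,u_0(x_j,g)+\mathcal{O}(\epsilon^{d+1})\quad\text{as }\epsilon\to0.$$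
   Context: Geometry: $J\in\mathbb{N}$; $x_1,\dots,x_J\in\Omega$ are fixed points with $|x_i-x_j|\ge c_0>0$ for $i\ne j$; each $B_j$ is a fixed bounded domain with Lipschitz boundary, centered at the origin, $|B_j|=\mathcal{O}(1)$; $0<\epsilon\ll1$ is a small parameter; $D_j=x_j+\epsilon B_j$, the $D_j$ are pairwise disjoint, $D=\bigcup_{j=1}^JD_j$, and $\mathrm{dist}(D,\partial\Omega)>0$. Coefficient: $\rho\in L^\infty(D)$ is real valued with $0<\rho_{\min}\le\rho\le\rho_{\max}$ a.e. in $D$, the constants $\rho_{\min},\rho_{\max}$ being independent of $\epsilon$. $\chi_D$ is the indicator function of $D$. $\mathrm{Avg}(\rho_j)=|D_j|^{-1}\int_{D_j}\rho\,dx$. The boundary integrals are understood as bilinear dual pairings between $H^{1/2}(\partial\Omega)$ and $H^{-1/2}(\partial\Omega)$ (normal derivatives lie in $H^{-1/2}(\partial\Omega)$). The constant in $\mathcal{O}(\epsilon^{d+1})$ is independent of $\epsilon$ (it may depend on $f$ and $g$). *)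

theory Defs
  imports "HOL-Analysis.Analysis" "HOL-Library.Landau_Symbols"
begin

section \<open>Geometry\<close>

text \<open>Near each boundary point \<open>p\<close> the set is, in the coordinates
  (orthogonal part, \<open>e\<close>-component) relative to a unit vector \<open>e\<close>, the strict epigraph of a
  Lipschitz function inside an open cylinder centred at \<open>p\<close>; the set lies on one side of its
  boundary.\<close>

definition lipschitz_boundary :: "'a::euclidean_space set \<Rightarrow> bool" where
  "lipschitz_boundary S \<longleftrightarrow>
     (\<forall>p\<in>frontier S. \<exists>e r h L. \<exists>\<gamma> :: 'a \<Rightarrow> real.
        norm e = 1 \<and> 0 < r \<and> 0 < h \<and> L-lipschitz_on {y. y \<bullet> e = 0} \<gamma> \<and>
        (\<forall>x. norm ((x - p) - ((x - p) \<bullet> e) *\<^sub>R e) < r \<and> \<bar>(x - p) \<bullet> e\<bar> < h \<longrightarrow>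
             (x \<in> S \<longleftrightarrow> \<gamma> ((x - p) - ((x - p) \<bullet> e) *\<^sub>R e) < (x - p) \<bullet> e)))"

definition barycentre :: "'a::euclidean_space set \<Rightarrow> 'a" where
  "barycentre S = (1 / measure lebesgue S) *\<^sub>R (LINT y|lebesgue_on S. y)"

text \<open>``Centered at the origin'' is used in the literature on small inclusions both for
  ``contains the origin'' and for ``has its centre of mass at the origin''; either is admitted.\<close>

definition centered_at_origin :: "'a::euclidean_space set \<Rightarrow> bool" where
  "centered_at_origin S \<longleftrightarrow> 0 \<in> S \<or> barycentre S = 0"

definition inclusion :: "'a::euclidean_space \<Rightarrow> real \<Rightarrow> 'a set \<Rightarrow> 'a set" where
  "inclusion z \<epsilon> B = (\<lambda>y. z + \<epsilon> *\<^sub>R y) ` B"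

definition Avg :: "('a::euclidean_space \<Rightarrow> real) \<Rightarrow> 'a set \<Rightarrow> real" where
  "Avg \<rho> S = (LINT y|lebesgue_on S. \<rho> y) / measure lebesgue S"


section \<open>Smooth, test and harmonic functions\<close>

text \<open>Functions are complex valued; real-valued ones are included as a special case. All pairings
  below are bilinear (no conjugation).\<close>

definition dderiv :: "'a::euclidean_space \<Rightarrow> ('a \<Rightarrow> complex) \<Rightarrow> 'a \<Rightarrow> complex" where
  "dderiv b f x = frechet_derivative f (at x) b"

primrec iter_dderiv :: "'a::euclidean_space list \<Rightarrow> ('a \<Rightarrow> complex) \<Rightarrow> 'a \<Rightarrow> complex" where
  "iter_dderiv [] f = f"
| "iter_dderiv (b # bs) f = dderiv b (iter_dderiv bs f)"

definition smooth :: "('a::euclidean_space \<Rightarrow> complex) \<Rightarrow> bool" where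
  "smooth f \<longleftrightarrow> (\<forall>bs. set bs \<subseteq> Basis \<longrightarrow> (\<forall>x. iter_dderiv bs f differentiable (at x)))"

definition test_functions :: "'a::euclidean_space set \<Rightarrow> ('a \<Rightarrow> complex) set" where
  "test_functions \<Omega> =
     {\<phi>. smooth \<phi> \<and> compact (closure {x. \<phi> x \<noteq> 0}) \<and> closure {x. \<phi> x \<noteq> 0} \<subseteq> \<Omega>}"

definition harmonic_on :: "'a::euclidean_space set \<Rightarrow> ('a \<Rightarrow> complex) \<Rightarrow> bool" where
  "harmonic_on \<Omega> u \<longleftrightarrow>
     (\<forall>x\<in>\<Omega>. u differentiable (at x)) \<and>
     (\<forall>b\<in>Basis. \<forall>x\<in>\<Omega>. dderiv b u differentiable (at x)) \<and>
     (\<forall>b\<in>Basis. \<forall>c\<in>Basis. continuous_on \<Omega> (dderiv c (dderiv b u))) \<and>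
     (\<forall>x\<in>\<Omega>. (\<Sum>b\<in>Basis. dderiv b (dderiv b u) x) = 0)"


section \<open>Square-integrable functions and the space \<open>H\<^sup>1(\<Omega>)\<close>\<close>

text \<open>Elements of these spaces are genuine functions, i.e. representatives of their classes modulo
  null sets.\<close>

definition L2_sq :: "'a measure \<Rightarrow> ('a \<Rightarrow> complex) \<Rightarrow> ennreal" where
  "L2_sq M u = (\<integral>\<^sup>+x. ennreal ((cmod (u x))\<^sup>2) \<partial>M)"

definition L2 :: "'a measure \<Rightarrow> ('a \<Rightarrow> complex) set" where
  "L2 M = {u \<in> borel_measurable M. L2_sq M u < \<infinity>}"

definition has_weak_dderiv ::
    "'a::euclidean_space set \<Rightarrow> 'a \<Rightarrow> ('a \<Rightarrow> complex) \<Rightarrow> ('a \<Rightarrow> complex) \<Rightarrow> bool" where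
  "has_weak_dderiv \<Omega> b u w \<longleftrightarrow>
     (\<forall>\<phi>\<in>test_functions \<Omega>.
        (LINT x|lebesgue_on \<Omega>. u x * dderiv b \<phi> x) = - (LINT x|lebesgue_on \<Omega>. w x * \<phi> x))"

definition H1 :: "'a::euclidean_space set \<Rightarrow> ('a \<Rightarrow> complex) set" where
  "H1 \<Omega> = {u \<in> L2 (lebesgue_on \<Omega>). \<forall>b\<in>Basis. \<exists>w\<in>L2 (lebesgue_on \<Omega>). has_weak_dderiv \<Omega> b u w}"

text \<open>The weak derivative is unique up to a null set; an arbitrary representative is chosen.\<close>

definition wderiv :: "'a::euclidean_space set \<Rightarrow> 'a \<Rightarrow> ('a \<Rightarrow> complex) \<Rightarrow> 'a \<Rightarrow> complex" where
  "wderiv \<Omega> b u = (SOME w. w \<in> L2 (lebesgue_on \<Omega>) \<and> has_weak_dderiv \<Omega> b u w)"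

definition H1_sq :: "'a::euclidean_space set \<Rightarrow> ('a \<Rightarrow> complex) \<Rightarrow> ennreal" where
  "H1_sq \<Omega> u = L2_sq (lebesgue_on \<Omega>) u + (\<Sum>b\<in>Basis. L2_sq (lebesgue_on \<Omega>) (wderiv \<Omega> b u))"

definition grad_dot ::
    "'a::euclidean_space set \<Rightarrow> ('a \<Rightarrow> complex) \<Rightarrow> ('a \<Rightarrow> complex) \<Rightarrow> complex" where
  "grad_dot \<Omega> u v = (LINT x|lebesgue_on \<Omega>. (\<Sum>b\<in>Basis. wderiv \<Omega> b u x * wderiv \<Omega> b v x))"


section \<open>Surface measure\<close>

text \<open>Hausdorff measure of dimension \<open>DIM('a) - 1\<close>, normalised to agree with Lebesgue measure on
  hyperplanes. It is used for \<open>DIM('a) \<ge> 2\<close> only, where \<open>0 ^ (DIM('a) - 1) = 0\<close>, so that empty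
  covering sets do not contribute.\<close>

definition hausdorff_pre :: "real \<Rightarrow> 'a::euclidean_space set \<Rightarrow> ennreal" where
  "hausdorff_pre \<delta> A =
     (INF U\<in>{U :: nat \<Rightarrow> 'a set. A \<subseteq> (\<Union>i. U i) \<and> (\<forall>i. bounded (U i) \<and> diameter (U i) \<le> \<delta>)}.
        \<Sum>i. ennreal (unit_ball_vol (DIM('a) - 1) * (diameter (U i) / 2) ^ (DIM('a) - 1)))"

definition hausdorff_outer :: "'a::euclidean_space set \<Rightarrow> ennreal" where
  "hausdorff_outer A = (SUP \<delta>\<in>{0<..}. hausdorff_pre \<delta> A)"

definition hausdorff_measure :: "'a::euclidean_space measure" where
  "hausdorff_measure = measure_of UNIV (sets borel) hausdorff_outer"

text \<open>\<open>measure_of\<close> returns the null measure unless the set function is countably additive, so the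
  following Caratheodory argument is what makes \<open>hausdorff_measure\<close> the Hausdorff measure.\<close>

lemma hausdorff_pre_antimono: "\<delta> \<le> \<delta>' \<Longrightarrow> hausdorff_pre \<delta>' A \<le> hausdorff_pre \<delta> A"
  unfolding hausdorff_pre_def by (rule INF_superset_mono) (auto intro: order_trans)

lemma hausdorff_pre_mono: "A \<subseteq> A' \<Longrightarrow> hausdorff_pre \<delta> A \<le> hausdorff_pre \<delta> A'"
  unfolding hausdorff_pre_def by (rule INF_superset_mono) force+

lemma hausdorff_outer_mono: "A \<subseteq> A' \<Longrightarrow> hausdorff_outer A \<le> hausdorff_outer A'"
  unfolding hausdorff_outer_def by (rule SUP_mono') (rule hausdorff_pre_mono)

lemma hausdorff_pre_le_outer: "0 < \<delta> \<Longrightarrow> hausdorff_pre \<delta> A \<le> hausdorff_outer A"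
  unfolding hausdorff_outer_def by (rule SUP_upper) auto

lemma hausdorff_pre_le:
  fixes A :: "'a::euclidean_space set" and U :: "nat \<Rightarrow> 'a set"
  assumes "A \<subseteq> (\<Union>i. U i)" "\<And>i. bounded (U i)" "\<And>i. diameter (U i) \<le> \<delta>"
  shows "hausdorff_pre \<delta> A
    \<le> (\<Sum>i. ennreal (unit_ball_vol (DIM('a) - 1) * (diameter (U i) / 2) ^ (DIM('a) - 1)))"
  unfolding hausdorff_pre_def using assms by (intro INF_lower) auto

lemma hausdorff_outer_empty:
  assumes "2 \<le> DIM('a::euclidean_space)"
  shows "hausdorff_outer ({} :: 'a set) = 0"
proof -
  have "hausdorff_pre \<delta> ({} :: 'a set) = 0" if "\<delta> > 0" for \<delta>
    using hausdorff_pre_le[of "{} :: 'a set" "\<lambda>_. {}" \<delta>] that assms by (simp add: zero_power)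
  then show ?thesis
    unfolding hausdorff_outer_def by (simp add: SUP_eq_const)
qed

lemma hausdorff_pre_subadditive:
  fixes A :: "nat \<Rightarrow> 'a::euclidean_space set"
  shows "hausdorff_pre \<delta> (\<Union>n. A n) \<le> (\<Sum>n. hausdorff_pre \<delta> (A n))"
proof (rule ennreal_le_epsilon)
  define w where "w = (\<lambda>S :: 'a set.
    ennreal (unit_ball_vol (DIM('a) - 1) * (diameter S / 2) ^ (DIM('a) - 1)))"
  fix e :: real assume e: "0 < e" and fin: "(\<Sum>n. hausdorff_pre \<delta> (A n)) < top"
  have *: "hausdorff_pre \<delta> (A n) < hausdorff_pre \<delta> (A n) + e * (1/2) ^ Suc n" for n
    using fin e by (auto simp add: less_top dest!: ennreal_suminf_lessD)
  have "\<exists>U :: nat \<Rightarrow> 'a set. A n \<subseteq> (\<Union>i. U i) \<and> (\<forall>i. bounded (U i) \<and> diameter (U i) \<le> \<delta>) \<and>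
      (\<Sum>i. w (U i)) \<le> hausdorff_pre \<delta> (A n) + e * (1/2) ^ Suc n" for n
    using *[of n] unfolding hausdorff_pre_def[of \<delta> "A n"] INF_less_iff w_def
    by (auto intro: less_imp_le)
  then obtain U :: "nat \<Rightarrow> nat \<Rightarrow> 'a set" where U: "\<And>n. A n \<subseteq> (\<Union>i. U n i)"
      "\<And>n i. bounded (U n i)" "\<And>n i. diameter (U n i) \<le> \<delta>"
      "\<And>n. (\<Sum>i. w (U n i)) \<le> hausdorff_pre \<delta> (A n) + e * (1/2) ^ Suc n"
    by metis
  define C where "C = case_prod U o prod_decode"
  have "(\<Union>n. A n) \<subseteq> (\<Union>i. C i)"
    using U(1) by (auto simp add: C_def subset_eq) (metis prod.case prod_encode_inverse)
  then have "hausdorff_pre \<delta> (\<Union>n. A n) \<le> (\<Sum>i. w (C i))"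
    unfolding w_def by (rule hausdorff_pre_le) (auto simp: C_def U split: prod.split)
  also have "\<dots> = (\<Sum>n. \<Sum>i. w (U n i))"
    unfolding C_def comp_def by (intro suminf_ennreal_2dimen) auto
  also have "\<dots> \<le> (\<Sum>n. hausdorff_pre \<delta> (A n) + e * (1/2) ^ Suc n)"
    by (intro suminf_le U) auto
  also have "\<dots> = (\<Sum>n. hausdorff_pre \<delta> (A n)) + (\<Sum>n. ennreal e * ennreal ((1/2) ^ Suc n))"
    using e by (subst suminf_add[symmetric])
      (auto simp del: ennreal_suminf_cmult simp add: ennreal_mult[symmetric])
  also have "\<dots> = (\<Sum>n. hausdorff_pre \<delta> (A n)) + e"
    unfolding ennreal_suminf_cmult
    by (subst suminf_ennreal_eq[OF zero_le_power power_half_series]) auto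
  finally show "hausdorff_pre \<delta> (\<Union>n. A n) \<le> (\<Sum>n. hausdorff_pre \<delta> (A n)) + ennreal e" .
qed

lemma hausdorff_outer_subadditive:
  fixes A :: "nat \<Rightarrow> 'a::euclidean_space set"
  shows "hausdorff_outer (\<Union>n. A n) \<le> (\<Sum>n. hausdorff_outer (A n))"
  unfolding hausdorff_outer_def[of "\<Union>n. A n"]
proof (rule SUP_least)
  fix \<delta> :: real assume "\<delta> \<in> {0<..}"
  then have "(\<Sum>n. hausdorff_pre \<delta> (A n)) \<le> (\<Sum>n. hausdorff_outer (A n))"
    by (intro suminf_le hausdorff_pre_le_outer) auto
  then show "hausdorff_pre \<delta> (\<Union>n. A n) \<le> (\<Sum>n. hausdorff_outer (A n))"
    using hausdorff_pre_subadditive order_trans by blast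
qed

lemma hausdorff_outer_Un_le:
  fixes A C :: "'a::euclidean_space set"
  assumes "2 \<le> DIM('a)"
  shows "hausdorff_outer (A \<union> C) \<le> hausdorff_outer A + hausdorff_outer C"
proof -
  have "A \<union> C = (\<Union>n::nat. if n = 0 then A else if n = 1 then C else {})"
    by (auto split: if_splits)
  then have "hausdorff_outer (A \<union> C)
      \<le> (\<Sum>n::nat. hausdorff_outer (if n = 0 then A else if n = 1 then C else {}))"
    using hausdorff_outer_subadditive[of "\<lambda>n::nat. if n = 0 then A else if n = 1 then C else {}"]
    by simp
  also have "\<dots> = (\<Sum>n\<in>{0, 1::nat}. hausdorff_outer (if n = 0 then A else if n = 1 then C else {}))"
    by (rule suminf_finite) (auto simp: hausdorff_outer_empty[OF assms])
  finally show ?thesis by simp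
qed

lemma hausdorff_pre_separated:
  fixes A C :: "'a::euclidean_space set"
  assumes d: "2 \<le> DIM('a)" and "\<delta> < \<eta>" and "0 < \<delta>"
    and sep: "\<And>a c. a \<in> A \<Longrightarrow> c \<in> C \<Longrightarrow> \<eta> \<le> dist a c"
  shows "hausdorff_pre \<delta> A + hausdorff_pre \<delta> C \<le> hausdorff_pre \<delta> (A \<union> C)"
  unfolding hausdorff_pre_def[of \<delta> "A \<union> C"]
proof (rule INF_greatest)
  define w where "w = (\<lambda>S :: 'a set.
    ennreal (unit_ball_vol (DIM('a) - 1) * (diameter S / 2) ^ (DIM('a) - 1)))"
  have w0: "w {} = 0" using d by (simp add: w_def zero_power)
  fix U :: "nat \<Rightarrow> 'a set"
  assume "U \<in> {U. A \<union> C \<subseteq> (\<Union>i. U i) \<and> (\<forall>i. bounded (U i) \<and> diameter (U i) \<le> \<delta>)}"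
  then have U: "A \<union> C \<subseteq> (\<Union>i. U i)" "\<And>i. bounded (U i)" "\<And>i. diameter (U i) \<le> \<delta>" by auto
  define V where "V = (\<lambda>S i. if U i \<inter> S = {} then {} else U i)"
  have V: "hausdorff_pre \<delta> S \<le> (\<Sum>i. w (V S i))" if S: "S \<subseteq> A \<union> C" for S
  proof -
    have "S \<subseteq> (\<Union>i. V S i)"
    proof
      fix y assume y: "y \<in> S"
      then obtain i where "y \<in> U i" using U(1) S by blast
      then have "y \<in> V S i" using y by (auto simp: V_def)
      then show "y \<in> (\<Union>i. V S i)" by blast
    qed
    then show ?thesis
      unfolding w_def by (rule hausdorff_pre_le) (use U(2,3) \<open>0 < \<delta>\<close> in \<open>simp_all add: V_def\<close>)
  qed
  have "U i \<inter> A = {} \<or> U i \<inter> C = {}" for i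
  proof (rule ccontr)
    assume "\<not> (U i \<inter> A = {} \<or> U i \<inter> C = {})"
    then obtain a c where "a \<in> U i" "a \<in> A" "c \<in> U i" "c \<in> C" by blast
    then show False
      using sep[of a c] diameter_bounded_bound[OF U(2), of a i c] U(3)[of i] \<open>\<delta> < \<eta>\<close> by auto
  qed
  then have "w (V A i) + w (V C i) \<le> w (U i)" for i
    using w0 by (auto simp: V_def)
  then have "(\<Sum>i. w (V A i) + w (V C i)) \<le> (\<Sum>i. w (U i))"
    by (intro suminf_le) auto
  then have "(\<Sum>i. w (V A i)) + (\<Sum>i. w (V C i)) \<le> (\<Sum>i. w (U i))"
    by (simp add: suminf_add)
  with add_mono[OF V[of A] V[of C]]
  have "hausdorff_pre \<delta> A + hausdorff_pre \<delta> C \<le> (\<Sum>i. w (U i))" by auto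
  then show "hausdorff_pre \<delta> A + hausdorff_pre \<delta> C
    \<le> (\<Sum>i. ennreal (unit_ball_vol (DIM('a) - 1) * (diameter (U i) / 2) ^ (DIM('a) - 1)))"
    by (simp add: w_def)
qed

lemma hausdorff_outer_separated:
  fixes A C :: "'a::euclidean_space set"
  assumes d: "2 \<le> DIM('a)" and "0 < \<eta>"
    and sep: "\<And>a c. a \<in> A \<Longrightarrow> c \<in> C \<Longrightarrow> \<eta> \<le> dist a c"
  shows "hausdorff_outer A + hausdorff_outer C \<le> hausdorff_outer (A \<union> C)"
proof -
  have *: "hausdorff_pre \<delta>1 A + hausdorff_pre \<delta>2 C \<le> hausdorff_outer (A \<union> C)"
    if "0 < \<delta>1" "0 < \<delta>2" for \<delta>1 \<delta>2
  proof -
    define \<delta> where "\<delta> = min (min \<delta>1 \<delta>2) (\<eta> / 2)"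
    have \<delta>: "0 < \<delta>" "\<delta> \<le> \<delta>1" "\<delta> \<le> \<delta>2" "\<delta> < \<eta>" using that \<open>0 < \<eta>\<close> by (auto simp: \<delta>_def)
    have "hausdorff_pre \<delta>1 A + hausdorff_pre \<delta>2 C \<le> hausdorff_pre \<delta> A + hausdorff_pre \<delta> C"
      by (intro add_mono hausdorff_pre_antimono \<delta>)
    also have "\<dots> \<le> hausdorff_pre \<delta> (A \<union> C)"
      using hausdorff_pre_separated[OF d \<delta>(4,1) sep] by blast
    also have "\<dots> \<le> hausdorff_outer (A \<union> C)" by (rule hausdorff_pre_le_outer[OF \<delta>(1)])
    finally show ?thesis .
  qed
  have "hausdorff_pre \<delta>1 A + hausdorff_outer C \<le> hausdorff_outer (A \<union> C)" if "0 < \<delta>1" for \<delta>1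
    unfolding hausdorff_outer_def[of C]
    by (subst ennreal_SUP_add_right) (auto intro!: SUP_least * that)
  then show ?thesis
    unfolding hausdorff_outer_def[of A]
    by (subst ennreal_SUP_add_left[symmetric]) (auto intro!: SUP_least)
qed

lemma hausdorff_outer_closed_split:
  fixes A F :: "'a::euclidean_space set"
  assumes d: "2 \<le> DIM('a)" and F: "closed F"
  shows "hausdorff_outer (A \<inter> F) + hausdorff_outer (A - F) \<le> hausdorff_outer A"
proof (cases "F = {} \<or> hausdorff_outer A = \<infinity>")
  case True
  then show ?thesis by (auto simp: hausdorff_outer_empty[OF d])
next
  case False
  then have ne: "F \<noteq> {}" and fin: "hausdorff_outer A < \<infinity>" by (auto simp: less_top)
  let ?\<mu> = "hausdorff_outer :: 'a set \<Rightarrow> ennreal"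
  define P where "P = (\<lambda>n::nat. {y\<in>A. inverse (Suc n) \<le> infdist y F})"
  define R where "R = (\<lambda>n. P (Suc n) - P n)"
  have R: "y \<in> A" "inverse (Suc (Suc n)) \<le> infdist y F" "infdist y F < inverse (Suc n)"
    if "y \<in> R n" for y n
    using that by (auto simp: R_def P_def)
  have close: "infdist y F \<le> infdist z F + dist y z" for y z
    by (rule infdist_triangle)
  have evens: "(\<Sum>k<N. ?\<mu> (R (2 * k + i))) \<le> ?\<mu> (\<Union>k<N. R (2 * k + i))" for N i
  proof (induction N)
    case 0
    then show ?case by simp
  next
    case (Suc N)
    define \<eta> :: real where "\<eta> = inverse (2 * N + i) - inverse (Suc (2 * N + i))"
    show ?case
    proof (cases "N = 0")
      case True
      then show ?thesis by (simp add: lessThan_Suc)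
    next
      case False
      then have \<eta>: "0 < \<eta>" by (simp add: \<eta>_def)
      have sep: "\<eta> \<le> dist a c" if a: "a \<in> (\<Union>k<N. R (2 * k + i))" and c: "c \<in> R (2 * N + i)" for a c
      proof -
        obtain k where k: "k < N" "a \<in> R (2 * k + i)" using a by blast
        have "inverse (real (2 * N + i)) \<le> inverse (Suc (Suc (2 * k + i)))"
          using k(1) by (intro le_imp_inverse_le) auto
        also have "\<dots> \<le> infdist a F" using R(2)[OF k(2)] .
        finally show ?thesis
          using R(3)[OF c] close[of a c] by (simp add: \<eta>_def)
      qed
      have "(\<Sum>k<Suc N. ?\<mu> (R (2 * k + i))) \<le> ?\<mu> (\<Union>k<N. R (2 * k + i)) + ?\<mu> (R (2 * N + i))"
        using Suc.IH by (simp add: add_right_mono)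
      also have "\<dots> \<le> ?\<mu> ((\<Union>k<N. R (2 * k + i)) \<union> R (2 * N + i))"
        by (rule hausdorff_outer_separated[OF d \<eta> sep])
      also have "(\<Union>k<N. R (2 * k + i)) \<union> R (2 * N + i) = (\<Union>k<Suc N. R (2 * k + i))"
        by (auto simp: lessThan_Suc)
      finally show ?thesis .
    qed
  qed
  have half: "(\<Sum>k. ?\<mu> (R (2 * k + i))) < \<infinity>" for i
  proof -
    have "(\<Sum>k. ?\<mu> (R (2 * k + i))) \<le> ?\<mu> A"
    proof (rule suminf_le_const[OF summableI])
      fix N
      have "?\<mu> (\<Union>k<N. R (2 * k + i)) \<le> ?\<mu> A"
        by (rule hausdorff_outer_mono) (auto dest: R(1))
      then show "(\<Sum>k<N. ?\<mu> (R (2 * k + i))) \<le> ?\<mu> A" using evens order_trans by blast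
    qed
    then show ?thesis using fin by (rule le_less_trans)
  qed
  have total: "(\<Sum>n. ?\<mu> (R n)) < \<infinity>"
  proof -
    have "(\<Sum>n. ?\<mu> (R n)) \<le> (\<Sum>k. ?\<mu> (R (2 * k + 0))) + (\<Sum>k. ?\<mu> (R (2 * k + 1)))"
    proof (rule suminf_le_const[OF summableI])
      fix N
      have "(\<Sum>n<N. ?\<mu> (R n)) \<le> (\<Sum>n<2 * N. ?\<mu> (R n))"
        by (rule sum_mono2) auto
      also have "\<dots> = (\<Sum>k<N. ?\<mu> (R (2 * k + 0))) + (\<Sum>k<N. ?\<mu> (R (2 * k + 1)))"
        by (induction N) (auto simp: algebra_simps)
      also have "\<dots> \<le> (\<Sum>k. ?\<mu> (R (2 * k + 0))) + (\<Sum>k. ?\<mu> (R (2 * k + 1)))"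
        by (intro add_mono sum_le_suminf) auto
      finally show "(\<Sum>n<N. ?\<mu> (R n))
        \<le> (\<Sum>k. ?\<mu> (R (2 * k + 0))) + (\<Sum>k. ?\<mu> (R (2 * k + 1)))" .
    qed
    also have "\<dots> < \<infinity>" using half[of 0] half[of 1] by (simp add: less_top)
    finally show ?thesis .
  qed
  have diff: "A - F \<subseteq> P n \<union> (\<Union>k. R (k + n))" for n
  proof
    fix y assume y: "y \<in> A - F"
    then have "0 < infdist y F"
      using F ne by (simp add: infdist_pos_not_in_closed)
    then obtain m where m: "inverse (real (Suc m)) < infdist y F"
      using reals_Archimedean by blast
    define q where "q = (LEAST m. y \<in> P m)"
    have "y \<in> P m" using m y by (simp add: P_def)
    then have q: "y \<in> P q" "\<And>k. k < q \<Longrightarrow> y \<notin> P k"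
      unfolding q_def by (rule LeastI, metis not_less_Least)
    show "y \<in> P n \<union> (\<Union>k. R (k + n))"
    proof (cases "q \<le> n")
      case True
      have "inverse (real (Suc n)) \<le> inverse (real (Suc q))"
        using True by (intro le_imp_inverse_le) auto
      then have "y \<in> P n" using q(1) unfolding P_def by (blast intro: order_trans)
      then show ?thesis by blast
    next
      case False
      then obtain k where k: "q = Suc (k + n)" by (metis add.commute less_imp_Suc_add not_le)
      then have "y \<in> R (k + n)" using q by (auto simp: R_def)
      then show ?thesis by blast
    qed
  qed
  have bound: "?\<mu> (A \<inter> F) + ?\<mu> (A - F) \<le> ?\<mu> A + (\<Sum>k. ?\<mu> (R (k + n)))" for n
  proof -
    have "inverse (Suc n) \<le> dist a c" if "a \<in> A \<inter> F" "c \<in> P n" for a c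
      using that infdist_le[of a F c] by (auto simp: P_def dist_commute)
    then have "?\<mu> (A \<inter> F) + ?\<mu> (P n) \<le> ?\<mu> ((A \<inter> F) \<union> P n)"
      using hausdorff_outer_separated[OF d, of "inverse (Suc n)" "A \<inter> F" "P n"] by simp
    also have "\<dots> \<le> ?\<mu> A" by (rule hausdorff_outer_mono) (auto simp: P_def)
    finally have 1: "?\<mu> (A \<inter> F) + ?\<mu> (P n) \<le> ?\<mu> A" .
    have "?\<mu> (A - F) \<le> ?\<mu> (P n \<union> (\<Union>k. R (k + n)))" by (rule hausdorff_outer_mono[OF diff])
    also have "\<dots> \<le> ?\<mu> (P n) + ?\<mu> (\<Union>k. R (k + n))" by (rule hausdorff_outer_Un_le[OF d])
    also have "\<dots> \<le> ?\<mu> (P n) + (\<Sum>k. ?\<mu> (R (k + n)))"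
      by (intro add_left_mono hausdorff_outer_subadditive)
    finally have "?\<mu> (A \<inter> F) + ?\<mu> (A - F) \<le> (?\<mu> (A \<inter> F) + ?\<mu> (P n)) + (\<Sum>k. ?\<mu> (R (k + n)))"
      by (simp add: add.assoc add_left_mono)
    also have "\<dots> \<le> ?\<mu> A + (\<Sum>k. ?\<mu> (R (k + n)))" using 1 by (rule add_right_mono)
    finally show ?thesis .
  qed
  have tail: "(\<lambda>n. \<Sum>k. ?\<mu> (R (k + n))) \<longlonglongrightarrow> 0"
  proof -
    define r where "r = (\<lambda>n. enn2real (?\<mu> (R n)))"
    have Rr: "?\<mu> (R n) = ennreal (r n)" for n
      using ennreal_suminf_lessD[of "\<lambda>n. ?\<mu> (R n)" \<infinity> n] total by (simp add: r_def)
    have r0: "0 \<le> r n" for n by (simp add: r_def)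
    have sr: "summable r"
      using total by (intro summable_suminf_not_top) (auto simp: Rr r0 less_top)
    have "(\<lambda>n. \<Sum>k. r (k + n)) \<longlonglongrightarrow> 0" by (rule suminf_exist_split2[OF sr])
    moreover have "(\<Sum>k. ?\<mu> (R (k + n))) = ennreal (\<Sum>k. r (k + n))" for n
      unfolding Rr by (rule suminf_ennreal2) (auto simp: r0 sr summable_ignore_initial_segment)
    ultimately show ?thesis
      using tendsto_ennrealI[of "\<lambda>n. \<Sum>k. r (k + n)" 0 sequentially] by simp
  qed
  have "(\<lambda>n. ?\<mu> A + (\<Sum>k. ?\<mu> (R (k + n)))) \<longlonglongrightarrow> ?\<mu> A + 0"
    by (intro tendsto_add tendsto_const tail)
  then show ?thesis
    using bound by (intro LIMSEQ_le_const[of _ "?\<mu> A"]) auto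
qed

lemma measure_space_hausdorff:
  assumes d: "2 \<le> DIM('a::euclidean_space)"
  shows "measure_space (UNIV :: 'a set) (sets borel) hausdorff_outer"
proof -
  interpret P: sigma_algebra "UNIV :: 'a set" "Pow UNIV" by (rule sigma_algebra_Pow)
  have "outer_measure_space (Pow (UNIV :: 'a set)) hausdorff_outer"
    unfolding outer_measure_space_def
    by (auto simp: positive_def increasing_def countably_subadditive_def hausdorff_outer_empty[OF d]
        hausdorff_outer_mono hausdorff_outer_subadditive)
  then have L: "measure_space UNIV (lambda_system UNIV (Pow (UNIV :: 'a set)) hausdorff_outer)
      hausdorff_outer"
    by (rule P.caratheodory_lemma)
  have "F \<in> lambda_system UNIV (Pow UNIV) hausdorff_outer" if "closed F" for F :: "'a set"
  proof -
    have "hausdorff_outer (A \<inter> F) + hausdorff_outer (A - F) = hausdorff_outer A" for A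
      using hausdorff_outer_closed_split[OF d that, of A]
        hausdorff_outer_Un_le[OF d, of "A \<inter> F" "A - F"]
      by (intro antisym) (auto simp: Int_Diff_Un)
    then show ?thesis
      by (simp add: lambda_system_def Int_commute Diff_eq)
  qed
  then have "Collect closed \<subseteq> lambda_system UNIV (Pow (UNIV :: 'a set)) hausdorff_outer" by auto
  then have "sets (borel :: 'a measure) \<subseteq> lambda_system UNIV (Pow UNIV) hausdorff_outer"
    unfolding borel_eq_closed using L
    by (simp add: measure_space_def sigma_algebra.sigma_sets_subset)
  then show ?thesis
    using measure_down[OF L, of "sets borel"] by (metis sets.sigma_algebra_axioms space_borel)
qed

lemma emeasure_hausdorff_measure:
  fixes A :: "'a::euclidean_space set"
  assumes "2 \<le> DIM('a)" "A \<in> sets borel"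
  shows "emeasure hausdorff_measure A = hausdorff_outer A"
  unfolding hausdorff_measure_def using measure_space_hausdorff[OF assms(1)] assms(2)
  by (intro emeasure_measure_of_sigma) (auto simp: measure_space_def)

definition surface :: "'a::euclidean_space set \<Rightarrow> 'a measure" where
  "surface \<Omega> = restrict_space hausdorff_measure (frontier \<Omega>)"


section \<open>Traces and normal derivatives\<close>

text \<open>Gagliardo (Sobolev--Slobodeckij) description: on a boundary of dimension \<open>DIM('a) - 1\<close> the
  exponent is \<open>(DIM('a) - 1) + 2 * (1/2) = DIM('a)\<close>.\<close>

definition H_half :: "'a::euclidean_space set \<Rightarrow> ('a \<Rightarrow> complex) set" where
  "H_half \<Omega> =
     {f \<in> L2 (surface \<Omega>).
        (\<integral>\<^sup>+x. (\<integral>\<^sup>+y. ennreal ((cmod (f x - f y))\<^sup>2 / dist x y ^ DIM('a)) \<partial>surface \<Omega>) \<partial>surface \<Omega>)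
          < \<infinity>}"

text \<open>The trace is the continuous extension to \<open>H\<^sup>1(\<Omega>)\<close> of the restriction of functions smooth up to
  the boundary; it is determined up to a surface null set.\<close>

definition has_trace ::
    "'a::euclidean_space set \<Rightarrow> ('a \<Rightarrow> complex) \<Rightarrow> ('a \<Rightarrow> complex) \<Rightarrow> bool" where
  "has_trace \<Omega> u f \<longleftrightarrow>
     u \<in> H1 \<Omega> \<and> f \<in> L2 (surface \<Omega>) \<and>
     (\<exists>\<phi> :: nat \<Rightarrow> 'a \<Rightarrow> complex.
        (\<forall>n. smooth (\<phi> n)) \<and>
        (\<lambda>n. H1_sq \<Omega> (\<lambda>x. \<phi> n x - u x)) \<longlonglongrightarrow> 0 \<and>
        (\<lambda>n. L2_sq (surface \<Omega>) (\<lambda>x. \<phi> n x - f x)) \<longlonglongrightarrow> 0)"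

definition bdry_trace :: "'a::euclidean_space set \<Rightarrow> ('a \<Rightarrow> complex) \<Rightarrow> 'a \<Rightarrow> complex" where
  "bdry_trace \<Omega> u = (SOME f. has_trace \<Omega> u f)"

text \<open>\<open>\<Delta>u = k\<close> in the sense of distributions.\<close>

definition has_weak_laplacian ::
    "'a::euclidean_space set \<Rightarrow> ('a \<Rightarrow> complex) \<Rightarrow> ('a \<Rightarrow> complex) \<Rightarrow> bool" where
  "has_weak_laplacian \<Omega> u k \<longleftrightarrow>
     (\<forall>\<phi>\<in>test_functions \<Omega>. grad_dot \<Omega> u \<phi> = - (LINT x|lebesgue_on \<Omega>. k x * \<phi> x))"

definition wlaplacian :: "'a::euclidean_space set \<Rightarrow> ('a \<Rightarrow> complex) \<Rightarrow> 'a \<Rightarrow> complex" where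
  "wlaplacian \<Omega> u = (SOME k. k \<in> L2 (lebesgue_on \<Omega>) \<and> has_weak_laplacian \<Omega> u k)"

text \<open>For \<open>u \<in> H\<^sup>1(\<Omega>)\<close> with \<open>\<Delta>u \<in> L\<^sup>2(\<Omega>)\<close>, the normal derivative with respect to the outward normal as
  an element of \<open>H\<^bsup>-1/2\<^esup>(\<partial>\<Omega>)\<close>, i.e. as a functional on \<open>H\<^bsup>1/2\<^esup>(\<partial>\<Omega>)\<close>: Green's first identity
  \<open>\<langle>\<partial>\<^sub>\<nu>u, \<phi>\<rangle> = \<integral>\<^sub>\<Omega> \<nabla>u \<cdot> \<nabla>v + (\<Delta>u) v\<close> for a lifting \<open>v \<in> H\<^sup>1(\<Omega>)\<close> of \<open>\<phi>\<close>. On a bounded Lipschitz domain the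
  value does not depend on the lifting.\<close>

definition normal_deriv ::
    "'a::euclidean_space set \<Rightarrow> ('a \<Rightarrow> complex) \<Rightarrow> ('a \<Rightarrow> complex) \<Rightarrow> complex" where
  "normal_deriv \<Omega> u \<phi> =
     (let v = (SOME v. has_trace \<Omega> v \<phi>)
      in grad_dot \<Omega> u v + (LINT x|lebesgue_on \<Omega>. wlaplacian \<Omega> u x * v x))"


section \<open>The boundary value problems and the reciprocity gap functional\<close>

text \<open>\<open>u \<in> H\<^sup>1(\<Omega>)\<close> is a (weak) solution of \<open>-\<Delta>u + q u = 0\<close> in \<open>\<Omega>\<close>, \<open>u = f\<close> on \<open>\<partial>\<Omega>\<close>.\<close>

definition dirichlet_solution ::
    "'a::euclidean_space set \<Rightarrow> ('a \<Rightarrow> real) \<Rightarrow> ('a \<Rightarrow> complex) \<Rightarrow> ('a \<Rightarrow> complex) \<Rightarrow> bool" where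
  "dirichlet_solution \<Omega> q f u \<longleftrightarrow>
     u \<in> H1 \<Omega> \<and> has_weak_laplacian \<Omega> u (\<lambda>x. of_real (q x) * u x) \<and> has_trace \<Omega> u f"

text \<open>Being harmonic in the classical sense fixes the representative, so that point values are
  meaningful.\<close>

definition harmonic_extension ::
    "'a::euclidean_space set \<Rightarrow> ('a \<Rightarrow> complex) \<Rightarrow> ('a \<Rightarrow> complex) \<Rightarrow> bool" where
  "harmonic_extension \<Omega> h u \<longleftrightarrow> u \<in> H1 \<Omega> \<and> harmonic_on \<Omega> u \<and> has_trace \<Omega> u h"

text \<open>\<open>R[v] = \<integral>\<^bsub>\<partial>\<Omega>\<^esub> v \<partial>\<^sub>\<nu>u - u \<partial>\<^sub>\<nu>v ds\<close>\<close>

definition reciprocity_gap ::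
    "'a::euclidean_space set \<Rightarrow> ('a \<Rightarrow> complex) \<Rightarrow> ('a \<Rightarrow> complex) \<Rightarrow> complex" where
  "reciprocity_gap \<Omega> u v =
     normal_deriv \<Omega> u (bdry_trace \<Omega> v) - normal_deriv \<Omega> v (bdry_trace \<Omega> u)"

end

(* The reciprocity gap equals the integral of rho chi_D u u_0(.,g) (Green's identity), and replacing
   u by u_0(.,f) and the harmonic functions by their values at x_j gives the leading term. It remains
   to see that the integral of |u - u_0(.,f)| over D is O(eps^(d+1)). The energy identity bounds
   |grad w|^2, w = u - u_0(.,f), by a multiple of the integral of |w| over D; and since D lies in finitely
   many strips of width O(eps), a one-dimensional Poincare inequality bounds the L^2 norm of w on D by
   C eps^(1/2) |grad w|.

   Both Green's identity and the energy identity need that a function of zero trace is a limit of test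
   functions in H^1. If smooth phi_n approximate w in H^1 and tend to 0 in L^2 of the boundary, then
   phi_n eta_t does it, with a cutoff eta_t vanishing near the boundary and with gradient O(1/t), letting first
   n tend to infinity and then t to 0: moving along the transversal direction of a Lipschitz chart,
   the integral of |phi|^2 over the boundary layer of width t is at most C t times that over the boundary
   plus C t^2 times the integral of |grad phi|^2 over a comparable layer. *)

theory Submission
  imports Defs
begin

section \<open>Smooth functions\<close>

text \<open>Traces and normal derivatives are defined through arbitrary choices (an approximating
  sequence, a lifting, representatives of derivatives), so each use of Green's identity rests on
  independence of these choices; this is what the approximation by test functions provides. The
  surface measure is a Hausdorff measure: instead of parametrising the boundary, the proof bounds
  the volume swept out by a boundary set moving a distance T by a constant times T times its
  Hausdorff measure, straight from coverings. This one-sided bound is all that the layer estimate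
  requires.

  The exponent needs no regularity theory for u. Let N be the squared L2 norm of grad w and Y the
  integral of |w| over D. The sign of the potential gives N <= C Y, while Cauchy-Schwarz and the
  strips give Y^2 <= C eps |D| N. Hence Y^2 <= C eps |D| Y, that is Y = O(eps |D|) = O(eps^(d+1)):
  the gain eps^(1/2) is collected twice, once through w and once through its gradient.\<close>

lemma iter_dderiv_append: "iter_dderiv (bs @ [b]) f = iter_dderiv bs (dderiv b f)"
  by (induction bs) auto

lemma smooth_differentiable: "smooth f \<Longrightarrow> f differentiable (at x)"
  unfolding smooth_def by (metis empty_set empty_subsetI iter_dderiv.simps(1))

lemma smooth_dderiv:
  assumes "smooth f" "b \<in> Basis"
  shows "smooth (dderiv b f)"
  unfolding smooth_def
proof (intro allI impI)
  fix bs x assume "set bs \<subseteq> (Basis :: 'a set)"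
  then have "set (bs @ [b]) \<subseteq> Basis" using assms(2) by auto
  then show "iter_dderiv bs (dderiv b f) differentiable (at x)"
    using assms(1) unfolding smooth_def iter_dderiv_append[symmetric] by blast
qed

text \<open>By induction on the list of directions every iterated derivative of \<open>f\<close>
  stays in \<open>X\<close>. A class closed under differentiation thus replaces Leibniz and chain
  rules for \<open>iter_dderiv\<close>.\<close>

lemma smooth_coinduct:
  assumes "f \<in> X"
    and "\<And>f x. f \<in> X \<Longrightarrow> f differentiable (at x)"
    and "\<And>f b. f \<in> X \<Longrightarrow> b \<in> Basis \<Longrightarrow> dderiv b f \<in> X"
  shows "smooth f"
proof -
  have "iter_dderiv bs f \<in> X" if "set bs \<subseteq> Basis" for bs
    using that by (induction bs) (auto intro: assms)
  then show ?thesis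
    unfolding smooth_def using assms(2) by blast
qed

lemma differentiable_has_derivative:
  "f differentiable (at x) \<Longrightarrow> (f has_derivative (\<lambda>b. dderiv b f x)) (at x)"
  unfolding dderiv_def using frechet_derivative_works by auto

lemma dderiv_eq:
  assumes "(f has_derivative f') (at x)"
  shows "dderiv b f x = f' b"
  unfolding dderiv_def using frechet_derivative_at[OF assms] by simp

text \<open>The powers are included so that the family around exp(-1/x), extended by 0, has
  derivatives in its own span: differentiation only raises the index.\<close>

definition expo :: "nat \<Rightarrow> real \<Rightarrow> real" where
  "expo k x = (if x > 0 then (1 / x) ^ k * exp (- (1 / x)) else 0)"

lemma tendsto_expo: "(expo k \<longlongrightarrow> 0) (at_right 0)"
proof -
  have "((\<lambda>y::real. y ^ k / exp y) \<longlongrightarrow> 0) at_top"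
    by (rule tendsto_power_div_exp_0)
  then have "((\<lambda>x::real. (inverse x) ^ k / exp (inverse x)) \<longlongrightarrow> 0) (at_right 0)"
    by (rule filterlim_compose[OF _ filterlim_inverse_at_top_right])
  then show ?thesis
    by (rule Lim_transform_eventually)
      (auto simp: eventually_at_filter expo_def field_simps exp_minus intro!: always_eventually)
qed

lemma DERIV_expo: "(expo k has_field_derivative (expo (k + 2) x - of_nat k * expo (k + 1) x)) (at x)"
proof -
  consider "x < 0" | "x > 0" | "x = 0" by linarith
  then show ?thesis
  proof cases
    case 1
    have "((\<lambda>_. 0) has_field_derivative 0) (at x)" by simp
    then have "(expo k has_field_derivative 0) (at x)"
      by (rule has_field_derivative_transform_within_open[where S="{..<0}"]) (use 1 in \<open>auto simp: expo_def\<close>)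
    then show ?thesis using 1 by (simp add: expo_def)
  next
    case 2
    have p: "((\<lambda>x. (1 / x) ^ k) has_field_derivative (- of_nat k * (1 / x) ^ (k + 1))) (at x)"
    proof (induction k)
      case (Suc k)
      have "((\<lambda>x. (1 / x) * (1 / x) ^ k) has_field_derivative
          (1 / x) * (- of_nat k * (1 / x) ^ (k + 1)) + (- ((1 / x) ^ 2)) * (1 / x) ^ k) (at x)"
        by (rule DERIV_mult'[OF _ Suc])
          (use 2 in \<open>auto intro!: derivative_eq_intros simp: power2_eq_square field_simps\<close>)
      then show ?case
        by (auto elim!: DERIV_cong simp: algebra_simps power2_eq_square add_divide_distrib diff_divide_distrib)
    qed simp
    have e: "((\<lambda>x. exp (- (1 / x))) has_field_derivative exp (- (1 / x)) * (1 / x) ^ 2) (at x)"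
      using 2 by (auto intro!: derivative_eq_intros simp: power2_eq_square field_simps)
    have "((\<lambda>x. (1 / x) ^ k * exp (- (1 / x))) has_field_derivative
       (expo (k + 2) x - of_nat k * expo (k + 1) x)) (at x)"
      using DERIV_mult'[OF p e] 2 by (simp add: expo_def algebra_simps power2_eq_square)
    then show ?thesis
      by (rule has_field_derivative_transform_within_open[where S="{0<..}"]) (use 2 in \<open>auto simp: expo_def\<close>)
  next
    case 3
    \<comment> \<open>For h > 0 the difference quotient at 0 is
      \<open>expo (k + 1) h\<close>.\<close>
    have "((\<lambda>h. expo k h / h) \<longlongrightarrow> 0) (at_right 0)"
      using tendsto_expo[of "k + 1"]
      by (rule Lim_transform_eventually) (auto simp: eventually_at_filter expo_def)
    moreover have "((\<lambda>h. expo k h / h) \<longlongrightarrow> 0) (at_left 0)"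
      by (rule tendsto_eventually) (auto simp: eventually_at_filter expo_def)
    ultimately have "((\<lambda>h. expo k h / h) \<longlongrightarrow> 0) (at 0)"
      by (simp add: filterlim_split_at)
    then show ?thesis using 3 by (simp add: DERIV_def expo_def)
  qed
qed

lemma expo_nonneg: "0 \<le> expo k x" by (simp add: expo_def)

lemma expo_pos_iff: "0 < expo k x \<longleftrightarrow> 0 < x" by (simp add: expo_def)

text \<open>Both this class and the span of the functions \<open>expo k\<close> are closed under differentiation, so that
  smoothness follows by coinduction.\<close>

inductive_set salg :: "('a::euclidean_space \<Rightarrow> complex) set" where
  sm: "smooth f \<Longrightarrow> f \<in> salg"
| const: "(\<lambda>_. c) \<in> salg"
| coord: "(\<lambda>x. of_real (x \<bullet> a)) \<in> salg"
| add: "f \<in> salg \<Longrightarrow> g \<in> salg \<Longrightarrow> (\<lambda>x. f x + g x) \<in> salg"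
| mult: "f \<in> salg \<Longrightarrow> g \<in> salg \<Longrightarrow> (\<lambda>x. f x * g x) \<in> salg"
| inv: "f \<in> salg \<Longrightarrow> (\<And>x. f x \<noteq> 0) \<Longrightarrow> (\<lambda>x. inverse (f x)) \<in> salg"
| cnj: "f \<in> salg \<Longrightarrow> (\<lambda>x. cnj (f x)) \<in> salg"
| expo: "(\<lambda>x. complex_of_real (q x)) \<in> salg \<Longrightarrow> (\<lambda>x. complex_of_real (expo k (q x))) \<in> salg"

lemma salg_stepI:
  assumes "\<And>x. (h has_derivative (\<lambda>b. D b x)) (at x)" "\<And>b. b \<in> Basis \<Longrightarrow> D b \<in> salg"
  shows "(\<forall>x. h differentiable (at x)) \<and> (\<forall>b\<in>Basis. dderiv b h \<in> salg)"
proof -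
  have "dderiv b h = D b" for b
    using dderiv_eq[OF assms(1)] by blast
  then show ?thesis using assms by (auto simp: differentiable_def)
qed

text \<open>These are the hypotheses of \<open>smooth_coinduct\<close> for \<open>X = salg\<close>.
  Each derivative is again built from the constructors: inverses reproduce themselves, and
  \<open>expo\<close> raises its index, which is why \<open>salg\<close> admits every
  \<open>k\<close>.\<close>

lemma salg_step:
  assumes "f \<in> salg"
  shows "(\<forall>x. f differentiable (at x)) \<and> (\<forall>b\<in>Basis. dderiv b f \<in> salg)"
  using assms
proof induction
  case (sm f)
  then show ?case using smooth_dderiv smooth_differentiable salg.sm by blast
next
  case (const c)
  show ?case
    by (rule salg_stepI[where D="\<lambda>b x. 0"]) (auto intro: salg.const)
next
  case (coord a)
  show ?case
    by (rule salg_stepI[where D="\<lambda>b x. of_real (b \<bullet> a)"])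
      (auto intro!: derivative_eq_intros salg.const)
next
  case (add f g)
  show ?case
    by (rule salg_stepI[where D="\<lambda>b x. dderiv b f x + dderiv b g x"])
      (use add differentiable_has_derivative in \<open>auto intro!: has_derivative_add salg.add\<close>)
next
  case (mult f g)
  show ?case
    by (rule salg_stepI[where D="\<lambda>b x. f x * dderiv b g x + dderiv b f x * g x"])
      (use mult differentiable_has_derivative in \<open>auto intro!: has_derivative_mult salg.add salg.mult\<close>)
next
  case (inv f)
  have *: "((\<lambda>x. inverse (f x)) has_derivative
      (\<lambda>b. (-1) * (inverse (f x) * (dderiv b f x * inverse (f x))))) (at x)" for x
    using Deriv.has_derivative_inverse[of f x, OF inv(2) differentiable_has_derivative] inv
    by (auto simp: mult.assoc)
  have "(\<lambda>x. inverse (f x)) \<in> salg" using inv salg.inv by blast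
  with inv show ?case
    by (intro salg_stepI[OF *] salg.mult salg.const) auto
next
  case (cnj f)
  show ?case
    by (rule salg_stepI[where D="\<lambda>b x. cnj (dderiv b f x)"])
      (use cnj differentiable_has_derivative in \<open>auto intro!: has_derivative_cnj salg.cnj\<close>)
next
  case (expo q k)
  let ?Q = "\<lambda>x. complex_of_real (q x)"
  \<comment> \<open>\<open>q\<close> is real, but only its complexification is known to lie in
    \<open>salg\<close>: its derivative is taken as a real part, and \<open>re\<close> identifies
    that with a member of \<open>salg\<close>.\<close>
  have q: "(q has_derivative (\<lambda>b. Re (dderiv b ?Q x))) (at x)" for x
    using has_derivative_Re[OF differentiable_has_derivative[of ?Q x]] expo.IH by simp
  have re: "of_real (Re (dderiv b ?Q x)) = dderiv b ?Q x" for b x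
    by (rule dderiv_eq[OF has_derivative_of_real[OF q], symmetric])
  have "((\<lambda>x. complex_of_real (expo k (q x))) has_derivative (\<lambda>b. complex_of_real
     (Re (dderiv b ?Q x) * (expo (k + 2) (q x) - of_nat k * expo (k + 1) (q x))))) (at x)" for x
    by (rule has_derivative_of_real[OF DERIV_compose_FDERIV[OF DERIV_expo q]])
  then have "((\<lambda>x. complex_of_real (expo k (q x))) has_derivative
     (\<lambda>b. dderiv b ?Q x * (complex_of_real (expo (k + 2) (q x))
         + (- of_nat k) * complex_of_real (expo (k + 1) (q x))))) (at x)" for x
    using re by (simp add: algebra_simps)
  then show ?case
  proof (rule salg_stepI)
    fix b :: 'a assume "b \<in> Basis"
    then show "(\<lambda>x. dderiv b ?Q x * (complex_of_real (expo (k + 2) (q x))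
         + (- of_nat k) * complex_of_real (expo (k + 1) (q x)))) \<in> salg"
      using expo by (intro salg.mult salg.add salg.const salg.expo) auto
  qed
qed

lemma salg_smooth: "f \<in> salg \<Longrightarrow> smooth f"
  using smooth_coinduct[of f salg] salg_step by blast

section \<open>Closure properties of smooth functions and rules for directional derivatives\<close>

lemma smooth_const: "smooth (\<lambda>_. c)"
  by (rule salg_smooth[OF salg.const])

lemma smooth_coord: "smooth (\<lambda>x. of_real (x \<bullet> a))"
  by (rule salg_smooth[OF salg.coord])

lemma smooth_add: "smooth f \<Longrightarrow> smooth g \<Longrightarrow> smooth (\<lambda>x. f x + g x)"
  by (rule salg_smooth[OF salg.add[OF salg.sm salg.sm]])

lemma smooth_mult: "smooth f \<Longrightarrow> smooth g \<Longrightarrow> smooth (\<lambda>x. f x * g x)"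
  by (rule salg_smooth[OF salg.mult[OF salg.sm salg.sm]])

lemma smooth_cnj: "smooth f \<Longrightarrow> smooth (\<lambda>x. cnj (f x))"
  by (rule salg_smooth[OF salg.cnj[OF salg.sm]])

lemma smooth_diff: "smooth f \<Longrightarrow> smooth g \<Longrightarrow> smooth (\<lambda>x. f x - g x)"
  using smooth_add[OF _ smooth_mult[OF smooth_const[of "-1"]], of f g] by simp

lemma smooth_prod: "finite S \<Longrightarrow> (\<And>p. p \<in> S \<Longrightarrow> smooth (f p)) \<Longrightarrow> smooth (\<lambda>x. \<Prod>p\<in>S. f p x)"
  by (induction S rule: finite_induct) (auto intro: smooth_mult smooth_const)

lemma smooth_continuous: "smooth f \<Longrightarrow> continuous_on S f"
  by (meson differentiable_imp_continuous_within continuous_at_imp_continuous_on smooth_differentiable)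

lemma dderiv_diff:
  assumes "f differentiable (at x)" "g differentiable (at x)"
  shows "dderiv b (\<lambda>x. f x - g x) x = dderiv b f x - dderiv b g x"
  using assms[THEN differentiable_has_derivative] by (auto intro!: dderiv_eq has_derivative_diff)

lemma dderiv_mult:
  assumes "f differentiable (at x)" "g differentiable (at x)"
  shows "dderiv b (\<lambda>x. f x * g x) x = f x * dderiv b g x + dderiv b f x * g x"
  using assms[THEN differentiable_has_derivative] by (auto intro!: dderiv_eq has_derivative_mult)

lemma dderiv_const: "dderiv b (\<lambda>_. c) x = 0"
  by (rule dderiv_eq) (auto intro!: derivative_eq_intros)

lemma dderiv_cnj:
  assumes "f differentiable (at x)"
  shows "dderiv b (\<lambda>x. cnj (f x)) x = cnj (dderiv b f x)"
  using assms[THEN differentiable_has_derivative] by (auto intro!: dderiv_eq has_derivative_cnj)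

lemma dderiv_cong_open:
  assumes "open S" "x \<in> S" "\<And>y. y \<in> S \<Longrightarrow> f y = g y" 
  shows "dderiv b f x = dderiv b g x"
proof -
  have "(f has_derivative f') (at x) \<longleftrightarrow> (g has_derivative f') (at x)" for f'
    using assms by (intro iffI; elim has_derivative_transform_within_open[where s=S]) auto
  then show ?thesis by (simp add: dderiv_def frechet_derivative_def)
qed

lemma dderiv_affine:
  fixes f :: "'a::euclidean_space \<Rightarrow> complex"
  assumes "f differentiable (at (s *\<^sub>R (x - p)))"
  shows "((\<lambda>x. f (s *\<^sub>R (x - p))) has_derivative (\<lambda>b. of_real s * dderiv b f (s *\<^sub>R (x - p)))) (at x)"
proof -
  have "((\<lambda>x. s *\<^sub>R (x - p)) has_derivative (\<lambda>b. s *\<^sub>R b)) (at x)"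
    by (auto intro!: derivative_eq_intros)
  from has_derivative_compose[OF this, of f "\<lambda>b. dderiv b f (s *\<^sub>R (x - p))"]
  have 1: "((\<lambda>x. f (s *\<^sub>R (x - p))) has_derivative (\<lambda>b. dderiv (s *\<^sub>R b) f (s *\<^sub>R (x - p)))) (at x)"
    using differentiable_has_derivative[OF assms] by simp
  have "dderiv (s *\<^sub>R b) f (s *\<^sub>R (x - p)) = of_real s * dderiv b f (s *\<^sub>R (x - p))" for b
    using linear_scale[OF has_derivative_linear[OF differentiable_has_derivative[OF assms]], of s b]
    by (simp add: scaleR_conv_of_real)
  with 1 show ?thesis by simp
qed

text \<open>Coinduction over multiples of rescaled smooth functions: the chain rule factor
  \<open>s\<close> is absorbed into the scalar \<open>c\<close>.\<close>

lemma smooth_affine: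
  assumes "smooth f"
  shows "smooth (\<lambda>x. f (s *\<^sub>R (x - p)))"
proof (rule smooth_coinduct[where X="{\<lambda>x. c * f (s *\<^sub>R (x - p)) |c f. smooth f}"], goal_cases)
  case 1
  then show ?case using assms by (auto intro!: exI[of _ 1])
next
  case (2 g x)
  then obtain c f where g: "g = (\<lambda>x. c * f (s *\<^sub>R (x - p)))" "smooth f" by blast
  show ?case unfolding g
    by (rule differentiable_mult) (use dderiv_affine[OF smooth_differentiable[OF g(2)]] in \<open>auto simp: differentiable_def\<close>)
next
  case (3 g b)
  then obtain c f where g: "g = (\<lambda>x. c * f (s *\<^sub>R (x - p)))" "smooth f" by blast
  have "dderiv b g = (\<lambda>x. (c * of_real s) * dderiv b f (s *\<^sub>R (x - p)))"
    unfolding g mult.assoc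
    by (rule ext, rule dderiv_eq, rule has_derivative_mult_right[OF dderiv_affine[OF smooth_differentiable[OF g(2)]]])
  then show ?case using smooth_dderiv[OF g(2) 3(2)] by blast
qed

text \<open>The quotient A / (A + B), where A is positive exactly for |x| < 2 and B exactly for |x|
  > 1, so that the denominator never vanishes. The derivatives are bounded because they are
  continuous and vanish outside a compact ball.\<close>

lemma bump_exists:
  obtains \<beta> :: "'a::euclidean_space \<Rightarrow> complex" and C :: real
  where "smooth \<beta>" "\<And>x. \<exists>r\<in>{0..1}. \<beta> x = of_real r" "\<And>x. norm x \<le> 1 \<Longrightarrow> \<beta> x = 1"
    "\<And>x. 2 \<le> norm x \<Longrightarrow> \<beta> x = 0" "0 \<le> C" "\<And>b x. b \<in> Basis \<Longrightarrow> cmod (dderiv b \<beta> x) \<le> C"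
    "\<And>b x. 2 < norm x \<Longrightarrow> dderiv b \<beta> x = 0"
proof -
  define A where "A = (\<lambda>x::'a. expo 0 (4 - x \<bullet> x))"
  define B where "B = (\<lambda>x::'a. expo 0 (x \<bullet> x - 1))"
  define \<beta> where "\<beta> = (\<lambda>x. complex_of_real (A x) * inverse (of_real (A x) + of_real (B x)))"
  have sq: "(\<lambda>x::'a. complex_of_real (x \<bullet> x)) \<in> salg"
  proof -
    have "smooth (\<lambda>x::'a. \<Sum>b\<in>S. complex_of_real (x \<bullet> b) * of_real (x \<bullet> b))" if "finite S" for S
      using that by (induction S rule: finite_induct) (auto intro!: smooth_add smooth_mult smooth_const smooth_coord)
    moreover have "complex_of_real (x \<bullet> x) = (\<Sum>b\<in>Basis. complex_of_real (x \<bullet> b) * of_real (x \<bullet> b))" for x :: 'a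
      by (subst euclidean_inner) simp
    ultimately show ?thesis
      using salg.sm[of "\<lambda>x::'a. \<Sum>b\<in>Basis. complex_of_real (x \<bullet> b) * of_real (x \<bullet> b)"] by simp
  qed
  have A: "(\<lambda>x. complex_of_real (A x)) \<in> salg"
    unfolding A_def
    by (rule salg.expo) (use salg.add[OF salg.const[of 4] salg.mult[OF salg.const[of "-1"] sq]] in simp)
  have B: "(\<lambda>x. complex_of_real (B x)) \<in> salg"
    unfolding B_def
    by (rule salg.expo) (use salg.add[OF salg.const[of "-1"] sq] in simp)
  have pos: "0 < A x + B x" for x
  proof -
    have "0 \<le> A x" "0 \<le> B x" by (auto simp: A_def B_def expo_nonneg)
    moreover have "0 < A x \<or> 0 < B x" unfolding A_def B_def expo_pos_iff by linarith
    ultimately show ?thesis by linarith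
  qed
  then have ne: "complex_of_real (A x) + of_real (B x) \<noteq> 0" for x
    by (metis less_irrefl of_real_0 of_real_add of_real_eq_iff)
  have 1: "smooth \<beta>"
    unfolding \<beta>_def by (intro salg_smooth salg.mult salg.inv salg.add A B ne)
  have 2: "\<exists>r\<in>{0..1}. \<beta> x = of_real r" for x
  proof
    show "\<beta> x = of_real (A x / (A x + B x))" by (simp add: \<beta>_def divide_inverse)
    show "A x / (A x + B x) \<in> {0..1}" using pos[of x] by (auto simp: A_def B_def expo_nonneg)
  qed
  have 3: "\<beta> x = 1" if "norm x \<le> 1" for x
  proof -
    have "x \<bullet> x \<le> 1" using that by (simp add: dot_square_norm power_le_one)
    then have "B x = 0" by (simp add: B_def expo_def)
    then show ?thesis using ne[of x] by (simp add: \<beta>_def)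
  qed
  have 4: "\<beta> x = 0" if "2 \<le> norm x" for x
  proof -
    have "2\<^sup>2 \<le> x \<bullet> x" unfolding dot_square_norm using that by (intro power_mono) auto
    then show ?thesis by (simp add: \<beta>_def A_def expo_def)
  qed
  have 5: "dderiv b \<beta> x = 0" if "2 < norm x" for b x
  proof -
    have "dderiv b \<beta> x = dderiv b (\<lambda>_. 0) x"
      by (rule dderiv_cong_open[where S="{x. 2 < norm x}"]) (use that 4 in \<open>auto intro!: open_Collect_less continuous_intros\<close>)
    then show ?thesis by (simp add: dderiv_const)
  qed
  have "\<exists>C\<ge>0. \<forall>x. cmod (dderiv b \<beta> x) \<le> C" if "b \<in> Basis" for b
  proof -
    have "compact (dderiv b \<beta> ` cball 0 2)"
      by (intro compact_continuous_image smooth_continuous smooth_dderiv 1 that) auto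
    from compact_imp_bounded[OF this] obtain C where C: "\<And>x. x \<in> cball 0 2 \<Longrightarrow> cmod (dderiv b \<beta> x) \<le> C"
      unfolding bounded_iff by blast
    have "0 \<le> C" using order_trans[OF norm_ge_zero C[of 0]] by simp
    moreover have "cmod (dderiv b \<beta> x) \<le> C" for x
      using C[of x] 5[of x b] \<open>0 \<le> C\<close> by (cases "norm x \<le> 2") auto
    ultimately show ?thesis by blast
  qed
  then obtain C where C: "\<And>b. b \<in> Basis \<Longrightarrow> 0 \<le> C b \<and> (\<forall>x. cmod (dderiv b \<beta> x) \<le> C b)" by metis
  have "cmod (dderiv b \<beta> x) \<le> (\<Sum>b\<in>Basis. C b)" if "b \<in> Basis" for b x
    using C that member_le_sum[of b Basis C] by (auto intro: order_trans)
  moreover have "0 \<le> (\<Sum>b\<in>Basis. C b)" using C by (simp add: sum_nonneg)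
  ultimately show ?thesis using that 1 2 3 4 5 by blast
qed

section \<open>Smooth cutoff functions\<close>

definition separated :: "real \<Rightarrow> 'a::metric_space set \<Rightarrow> bool" where
  "separated t S \<longleftrightarrow> (\<forall>p\<in>S. \<forall>q\<in>S. p \<noteq> q \<longrightarrow> t \<le> dist p q)"

text \<open>Pigeonhole: \<open>K\<close> is covered by finitely many balls of radius
  \<open>t / 2\<close>, and each holds at most one point of a \<open>t\<close>-separated
  set.\<close>

lemma separated_card_bound:
  fixes K :: "'a::euclidean_space set"
  assumes "compact K" "0 < t"
  shows "\<exists>n. \<forall>S. S \<subseteq> K \<longrightarrow> separated t S \<longrightarrow> finite S \<and> card S \<le> n"
proof -
  have "K \<subseteq> (\<Union>c\<in>K. ball c (t / 2))" using assms(2) by auto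
  then obtain F where F: "F \<subseteq> K" "finite F" "K \<subseteq> (\<Union>c\<in>F. ball c (t / 2))"
    using compactE_image[OF assms(1), of K "\<lambda>c. ball c (t / 2)"] open_ball by metis
  have "finite S \<and> card S \<le> card F" if S: "S \<subseteq> K" "separated t S" for S
  proof -
    have "\<exists>c. c \<in> F \<and> dist c p < t / 2" if "p \<in> S" for p
      using S(1) F(3) that unfolding mem_ball[symmetric] by blast
    then obtain g where g: "\<And>p. p \<in> S \<Longrightarrow> g p \<in> F \<and> dist (g p) p < t / 2" by metis
    have "inj_on g S"
    proof
      fix p q assume pq: "p \<in> S" "q \<in> S" "g p = g q"
      then have "dist p q < t" using g[of p] g[of q] by metric
      then show "p = q" using S(2) pq unfolding separated_def by fastforce
    qed
    then show ?thesis
      using g F(2) by (meson card_inj_on_le image_subsetI inj_on_finite)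
  qed
  then show ?thesis by blast
qed

text \<open>A separated subset of greatest cardinality is a net, since a point at distance at least
  \<open>t\<close> from all its members could be added.\<close>

lemma separated_net_exists:
  fixes K :: "'a::euclidean_space set"
  assumes "compact K" "0 < t"
  obtains S where "finite S" "S \<subseteq> K" "separated t S" "\<And>x. x \<in> K \<Longrightarrow> \<exists>p\<in>S. dist x p < t"
proof -
  obtain n where n: "\<And>S. S \<subseteq> K \<Longrightarrow> separated t S \<Longrightarrow> finite S \<and> card S \<le> n"
    using separated_card_bound[OF assms] by blast
  have "\<exists>S. (S \<subseteq> K \<and> separated t S) \<and> (\<forall>S'. S' \<subseteq> K \<and> separated t S' \<longrightarrow> card S' \<le> card S)"
    by (rule ex_has_greatest_nat[where k="{}" and b="Suc n"]) (use n in \<open>auto simp: separated_def less_Suc_eq_le\<close>)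
  then obtain S where S: "S \<subseteq> K" "separated t S" "\<And>S'. S' \<subseteq> K \<Longrightarrow> separated t S' \<Longrightarrow> card S' \<le> card S"
    by blast
  have "\<exists>p\<in>S. dist x p < t" if "x \<in> K" for x
  proof (rule ccontr)
    assume c: "\<not> ?thesis"
    then have "x \<notin> S" using assms(2) by fastforce
    moreover have "separated t (insert x S)"
      using S(2) c unfolding separated_def by (auto simp: dist_commute not_less)
    ultimately show False using S(3)[of "insert x S"] S(1) that n[OF S(1,2)] by auto
  qed
  then show ?thesis using that S n by blast
qed

text \<open>Induction with the product rule: in each term the undifferentiated factors have modulus
  at most 1.\<close>

lemma dderiv_prod_bound:
  assumes "finite S" "\<And>p. p \<in> S \<Longrightarrow> smooth (f p)" "\<And>p x. p \<in> S \<Longrightarrow> cmod (f p x) \<le> 1"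
  shows "cmod (dderiv b (\<lambda>x. \<Prod>p\<in>S. f p x) x) \<le> (\<Sum>p\<in>S. cmod (dderiv b (f p) x))"
  using assms
proof (induction S rule: finite_induct)
  case empty
  then show ?case by (simp add: dderiv_const)
next
  case (insert q S)
  have 1: "cmod (\<Prod>p\<in>S. f p x) \<le> 1"
    unfolding prod_norm[symmetric] using insert by (intro prod_le_1) auto
  have 2: "smooth (\<lambda>x. \<Prod>p\<in>S. f p x)" using insert by (intro smooth_prod) auto
  have 3: "dderiv b (\<lambda>x. \<Prod>p\<in>insert q S. f p x) x
      = f q x * dderiv b (\<lambda>x. \<Prod>p\<in>S. f p x) x + dderiv b (f q) x * (\<Prod>p\<in>S. f p x)"
    using insert 2 by (simp add: dderiv_mult smooth_differentiable)
  have 4: "cmod (f q x * dderiv b (\<lambda>x. \<Prod>p\<in>S. f p x) x) \<le> 1 * (\<Sum>p\<in>S. cmod (dderiv b (f p) x))"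
    unfolding norm_mult using insert by (intro mult_mono) auto
  have 5: "cmod (dderiv b (f q) x * (\<Prod>p\<in>S. f p x)) \<le> cmod (dderiv b (f q) x) * 1"
    unfolding norm_mult using 1 by (intro mult_mono) auto
  show ?case
    unfolding 3 using norm_triangle_mono[OF 4 5] insert(1,2) by simp
qed

text \<open>\<open>C\<close> is an explicit parameter because the gradient bound
  \<open>C / t\<close> has to hold with one constant for all compact \<open>K\<close> and all widths
  \<open>t\<close>.\<close>

definition cutoff :: "'a::euclidean_space set \<Rightarrow> real \<Rightarrow> real \<Rightarrow> ('a \<Rightarrow> complex) \<Rightarrow> bool" where
  "cutoff K t C \<eta> \<longleftrightarrow> smooth \<eta> \<and> (\<forall>x. \<exists>r\<in>{0..1}. \<eta> x = complex_of_real r) \<and> (\<forall>x\<in>K. \<eta> x = 1) \<and>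
        (\<forall>x. \<eta> x \<noteq> 0 \<longrightarrow> (\<exists>k\<in>K. dist x k \<le> 2 * t)) \<and>
        (\<forall>b\<in>Basis. \<forall>x. cmod (dderiv b \<eta> x) \<le> C / t)"

text \<open>Instead of mollifying an indicator, take 1 minus the product of 1 - \<beta>((x - p) / t)
  over a \<open>t\<close>-separated net of \<open>K\<close>. On \<open>K\<close> some factor
  vanishes; beyond distance \<open>2 * t\<close> all factors are 1; and the gradient is a sum of at
  most \<open>n\<close> nonzero contributions of size at most \<open>C / t\<close>.\<close>

lemma smooth_cutoff_exists:
  obtains C where "0 \<le> C" "\<And>(K :: 'a::euclidean_space set) t. 0 < t \<Longrightarrow> compact K \<Longrightarrow> \<exists>\<eta>. cutoff K t C \<eta>"
proof -
  obtain \<beta> :: "'a \<Rightarrow> complex" and C where \<beta>: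
    "smooth \<beta>" "\<And>x. \<exists>r\<in>{0..1}. \<beta> x = of_real r" "\<And>x. norm x \<le> 1 \<Longrightarrow> \<beta> x = 1"
    "\<And>x. 2 \<le> norm x \<Longrightarrow> \<beta> x = 0" "0 \<le> C" "\<And>b x. b \<in> Basis \<Longrightarrow> cmod (dderiv b \<beta> x) \<le> C"
    "\<And>b x. 2 < norm x \<Longrightarrow> dderiv b \<beta> x = 0"
    by (rule bump_exists) blast
  \<comment> \<open>A packing number at unit scale: dilation by 1 / t about a point turns the net
    points within \<open>2 * t\<close> of it into such a set, so \<open>n\<close> depends neither on
    \<open>K\<close> nor on \<open>t\<close>.\<close>
  obtain n where n: "\<And>S. S \<subseteq> cball (0 :: 'a) 2 \<Longrightarrow> separated 1 S \<Longrightarrow> finite S \<and> card S \<le> n"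
    using separated_card_bound[of "cball (0 :: 'a) 2" 1] by auto
  have main: "\<exists>\<eta>. cutoff K t (n * C) \<eta>"
    if t: "0 < t" and K: "compact K" for K :: "'a set" and t
  proof -
    obtain S where S: "finite S" "S \<subseteq> K" "separated t S" "\<And>x. x \<in> K \<Longrightarrow> \<exists>p\<in>S. dist x p < t"
      using separated_net_exists[OF K t] by metis
    define f where "f = (\<lambda>p x. 1 - \<beta> ((1 / t) *\<^sub>R (x - p)))"
    define \<eta> where "\<eta> = (\<lambda>x. 1 - (\<Prod>p\<in>S. f p x))"
    have nrm: "norm ((1 / t) *\<^sub>R (x - p)) = dist x p / t" for x p :: 'a
      using t by (simp add: dist_norm)
    have sb: "smooth (\<lambda>x. \<beta> ((1 / t) *\<^sub>R (x - p)))" for p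
      by (rule smooth_affine[OF \<beta>(1)])
    have sf: "smooth (f p)" for p
      unfolding f_def by (intro smooth_diff smooth_const sb)
    have sP: "smooth (\<lambda>x. \<Prod>p\<in>S. f p x)" using S(1) sf by (rule smooth_prod)
    have "smooth \<eta>" unfolding \<eta>_def by (intro smooth_diff smooth_const sP)
    moreover have fr: "\<exists>r\<in>{0..1}. f p x = complex_of_real r" for p x
    proof -
      obtain r where "r \<in> {0..1}" "\<beta> ((1 / t) *\<^sub>R (x - p)) = of_real r" using \<beta>(2) by blast
      then show ?thesis unfolding f_def by (intro bexI[of _ "1 - r"]) auto
    qed
    moreover have "\<exists>r\<in>{0..1}. \<eta> x = complex_of_real r" for x
    proof -
      have "\<forall>p. \<exists>r. r \<in> {0..1} \<and> f p x = complex_of_real r" using fr by blast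
      then obtain r where r: "\<And>p. r p \<in> {0..1} \<and> f p x = complex_of_real (r p)" by metis
      then have "\<eta> x = of_real (1 - (\<Prod>p\<in>S. r p))" by (simp add: \<eta>_def)
      moreover have "0 \<le> (\<Prod>p\<in>S. r p)" "(\<Prod>p\<in>S. r p) \<le> 1"
        using r by (auto intro!: prod_nonneg prod_le_1)
      ultimately show ?thesis by (intro bexI[of _ "1 - (\<Prod>p\<in>S. r p)"]) auto
    qed
    moreover have "\<eta> x = 1" if "x \<in> K" for x
    proof -
      obtain p where p: "p \<in> S" "dist x p < t" using S(4)[OF \<open>x \<in> K\<close>] by blast
      then have "norm ((1 / t) *\<^sub>R (x - p)) \<le> 1" unfolding nrm using t by simp
      then have "f p x = 0" by (simp only: f_def \<beta>(3)) simp
      then show ?thesis using p S(1) by (auto simp: \<eta>_def intro!: prod_zero)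
    qed
    moreover have "\<exists>k\<in>K. dist x k \<le> 2 * t" if "\<eta> x \<noteq> 0" for x
    proof (rule ccontr)
      assume c: "\<not> ?thesis"
      have "f p x = 1" if "p \<in> S" for p
      proof -
        have "2 * t < dist x p" using c S(2) that by (meson not_le subsetD)
        then have "2 \<le> norm ((1 / t) *\<^sub>R (x - p))" unfolding nrm using t by (auto simp: field_simps)
        then show ?thesis by (simp only: f_def \<beta>(4)) simp
      qed
      then show False using that by (simp add: \<eta>_def)
    qed
    moreover have "cmod (dderiv b \<eta> x) \<le> (n * C) / t" if b: "b \<in> Basis" for b x
    proof -
      have d: "dderiv b (f p) x = - (of_real (1 / t) * dderiv b \<beta> ((1 / t) *\<^sub>R (x - p)))" for p
        unfolding f_def
        using dderiv_diff[of "\<lambda>_. 1" x "\<lambda>x. \<beta> ((1 / t) *\<^sub>R (x - p))" b] smooth_differentiable[OF sb[of p]]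
          dderiv_eq[OF dderiv_affine[OF smooth_differentiable[OF \<beta>(1)]], of b "1 / t" p x]
        by (simp add: dderiv_const)
      let ?T = "{p \<in> S. dist x p \<le> 2 * t}"
      have "finite ((\<lambda>p. (1 / t) *\<^sub>R (p - x)) ` ?T) \<and> card ((\<lambda>p. (1 / t) *\<^sub>R (p - x)) ` ?T) \<le> n"
      proof (rule n)
        show "(\<lambda>p. (1 / t) *\<^sub>R (p - x)) ` ?T \<subseteq> cball 0 2"
        proof
          fix y assume "y \<in> (\<lambda>p. (1 / t) *\<^sub>R (p - x)) ` ?T"
          then obtain p where p: "y = (1 / t) *\<^sub>R (p - x)" "dist x p \<le> 2 * t" by blast
          show "y \<in> cball 0 2"
            unfolding mem_cball dist_0_norm p(1) nrm using p(2) t by (simp add: dist_commute field_simps)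
        qed
        have ds: "dist ((1 / t) *\<^sub>R (p - x)) ((1 / t) *\<^sub>R (q - x)) = dist p q / t" for p q
        proof -
          have "(1 / t) *\<^sub>R (p - x) - (1 / t) *\<^sub>R (q - x) = (1 / t) *\<^sub>R (p - q)"
            by (simp add: algebra_simps)
          then show ?thesis using t by (simp add: dist_norm)
        qed
        show "separated 1 ((\<lambda>p. (1 / t) *\<^sub>R (p - x)) ` ?T)"
          unfolding separated_def ball_simps ds using S(3) t unfolding separated_def
          by (metis (no_types, lifting) le_divide_eq_1_pos mem_Collect_eq)
      qed
      moreover have "inj_on (\<lambda>p. (1 / t) *\<^sub>R (p - x)) ?T"
        using t by (auto simp: inj_on_def)
      ultimately have card: "card ?T \<le> n" by (simp add: card_image)
      have "cmod (dderiv b \<eta> x) = cmod (dderiv b (\<lambda>x. \<Prod>p\<in>S. f p x) x)"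
        unfolding \<eta>_def
        using dderiv_diff[of "\<lambda>_. 1" x "\<lambda>x. \<Prod>p\<in>S. f p x" b] smooth_differentiable[OF sP]
        by (simp add: dderiv_const)
      also have "\<dots> \<le> (\<Sum>p\<in>S. cmod (dderiv b (f p) x))"
      proof (rule dderiv_prod_bound[OF S(1) sf])
        show "cmod (f p x) \<le> 1" for p x using fr[of p x] by auto
      qed
      also have "\<dots> = (\<Sum>p\<in>?T. cmod (dderiv b (f p) x))"
      proof (rule sum.mono_neutral_right[OF S(1)])
        show "\<forall>p\<in>S - ?T. cmod (dderiv b (f p) x) = 0"
        proof
          fix p assume "p \<in> S - ?T"
          then have "2 < norm ((1 / t) *\<^sub>R (x - p))" unfolding nrm using t by (auto simp: field_simps)
          then show "cmod (dderiv b (f p) x) = 0" by (simp add: d \<beta>(7))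
        qed
      qed auto
      also have "\<dots> \<le> (\<Sum>p\<in>?T. C / t)"
      proof (rule sum_mono)
        fix p
        show "cmod (dderiv b (f p) x) \<le> C / t"
          using \<beta>(6)[OF b, of "(1 / t) *\<^sub>R (x - p)"] t by (simp add: d norm_mult norm_divide field_simps)
      qed
      also have "\<dots> = card ?T * (C / t)" by simp
      also have "\<dots> \<le> n * (C / t)" using card t \<beta>(5) by (intro mult_right_mono) auto
      finally show ?thesis by simp
    qed
    ultimately show ?thesis unfolding cutoff_def by blast
  qed
  show ?thesis
    by (rule that[of "n * C"]) (use main \<beta>(5) in auto)
qed

section \<open>Square-integrable functions\<close>

lemma L2_measurable: "u \<in> L2 M \<Longrightarrow> u \<in> borel_measurable M"
  by (simp add: L2_def)

lemma L2_sq_finite: "u \<in> L2 M \<Longrightarrow> L2_sq M u < top"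
  by (simp add: L2_def)

lemma L2_I: "u \<in> borel_measurable M \<Longrightarrow> L2_sq M u < top \<Longrightarrow> u \<in> L2 M"
  by (simp add: L2_def)

lemma L2_integrable:
  assumes "u \<in> L2 M"
  shows "integrable M (\<lambda>x. (cmod (u x))\<^sup>2)"
  using assms unfolding L2_def L2_sq_def by (intro integrableI_nonneg) auto

lemma L2_sq_eq_integral:
  assumes "u \<in> L2 M"
  shows "L2_sq M u = ennreal (LINT x|M. (cmod (u x))\<^sup>2)"
  unfolding L2_sq_def by (rule nn_integral_eq_integral[OF L2_integrable[OF assms]]) auto

lemma L2_sq_mono_AE:
  assumes "AE x in M. cmod (u x) \<le> cmod (v x)"
  shows "L2_sq M u \<le> L2_sq M v"
  unfolding L2_sq_def
proof (rule nn_integral_mono_AE)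
  show "AE x in M. ennreal ((cmod (u x))\<^sup>2) \<le> ennreal ((cmod (v x))\<^sup>2)"
    using assms by eventually_elim (auto intro!: ennreal_leI power_mono)
qed

lemma L2_sq_cong_AE:
  assumes "AE x in M. u x = v x"
  shows "L2_sq M u = L2_sq M v"
  unfolding L2_sq_def by (rule nn_integral_cong_AE) (use assms in auto)

lemma L2_sq_cmult: 
  assumes "u \<in> borel_measurable M"
  shows "L2_sq M (\<lambda>x. c * u x) = ennreal ((cmod c)\<^sup>2) * L2_sq M u"
  using assms unfolding L2_sq_def
  by (simp add: norm_mult power_mult_distrib ennreal_mult nn_integral_cmult)

lemma cmod_add_sq: "(cmod (a + b))\<^sup>2 \<le> 2 * (cmod a)\<^sup>2 + 2 * (cmod b)\<^sup>2"
proof -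
  have "(cmod (a + b))\<^sup>2 \<le> (cmod a + cmod b)\<^sup>2" by (intro power_mono norm_triangle_ineq) simp
  also have "\<dots> \<le> 2 * (cmod a)\<^sup>2 + 2 * (cmod b)\<^sup>2" using sum_squares_bound[of "cmod a" "cmod b"] by (simp add: power2_sum)
  finally show ?thesis .
qed

text \<open>Working with squared norms in \<open>ennreal\<close> replaces the triangle inequality by
  a pointwise one with factors 2, which holds for infinite values too.\<close>

lemma L2_sq_add_le:
  assumes "u \<in> borel_measurable M" "v \<in> borel_measurable M"
  shows "L2_sq M (\<lambda>x. u x + v x) \<le> 2 * L2_sq M u + 2 * L2_sq M v"
proof -
  have "L2_sq M (\<lambda>x. u x + v x) \<le> (\<integral>\<^sup>+x. 2 * ennreal ((cmod (u x))\<^sup>2) + 2 * ennreal ((cmod (v x))\<^sup>2) \<partial>M)"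
    unfolding L2_sq_def
  proof (rule nn_integral_mono)
    fix x
    have "ennreal ((cmod (u x + v x))\<^sup>2) \<le> ennreal (2 * (cmod (u x))\<^sup>2 + 2 * (cmod (v x))\<^sup>2)"
      by (rule ennreal_leI[OF cmod_add_sq])
    then show "ennreal ((cmod (u x + v x))\<^sup>2) \<le> 2 * ennreal ((cmod (u x))\<^sup>2) + 2 * ennreal ((cmod (v x))\<^sup>2)"
      by (simp add: ennreal_mult)
  qed
  also have "\<dots> = 2 * L2_sq M u + 2 * L2_sq M v"
    using assms unfolding L2_sq_def by (simp add: nn_integral_add nn_integral_cmult)
  finally show ?thesis .
qed

lemma L2_add: 
  assumes "u \<in> L2 M" "v \<in> L2 M"
  shows "(\<lambda>x. u x + v x) \<in> L2 M"
proof (rule L2_I)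
  show "L2_sq M (\<lambda>x. u x + v x) < top"
    using L2_sq_add_le[of u M v] assms[THEN L2_sq_finite] assms[THEN L2_measurable]
    by (auto simp: ennreal_mult_less_top ennreal_add_less_top intro: le_less_trans)
qed (intro borel_measurable_add assms[THEN L2_measurable])

lemma L2_bound:
  assumes "u \<in> L2 M" "w \<in> borel_measurable M" "AE x in M. cmod (w x) \<le> c * cmod (u x)"
  shows "w \<in> L2 M"
proof (rule L2_I[OF assms(2)])
  have "L2_sq M w \<le> L2_sq M (\<lambda>x. of_real c * u x)"
  proof (rule L2_sq_mono_AE)
    show "AE x in M. cmod (w x) \<le> cmod (of_real c * u x)"
      using assms(3)
    proof eventually_elim
      case (elim x)
      have "c * cmod (u x) \<le> \<bar>c\<bar> * cmod (u x)" by (intro mult_right_mono) auto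
      then show ?case using elim by (simp add: norm_mult)
    qed
  qed
  also have "\<dots> < top"
    using assms(1) by (simp add: L2_sq_cmult L2_measurable L2_sq_finite ennreal_mult_less_top)
  finally show "L2_sq M w < top" .
qed

lemma L2_cmult: "u \<in> L2 M \<Longrightarrow> (\<lambda>x. c * u x) \<in> L2 M"
proof (rule L2_bound[of u _ _ "cmod c"])
  assume "u \<in> L2 M"
  then show "(\<lambda>x. c * u x) \<in> borel_measurable M"
    by (intro borel_measurable_times borel_measurable_const L2_measurable)
qed (auto simp: norm_mult)

lemma L2_diff: "u \<in> L2 M \<Longrightarrow> v \<in> L2 M \<Longrightarrow> (\<lambda>x. u x - v x) \<in> L2 M"
  using L2_add[OF _ L2_cmult[of v M "-1"], of u] by simp

lemma L2_cnj:
  assumes "u \<in> L2 M"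
  shows "(\<lambda>x. cnj (u x)) \<in> L2 M"
proof (rule L2_bound[OF assms, of _ 1])
  have "cnj \<in> borel_measurable borel"
    by (intro borel_measurable_continuous_onI continuous_intros)
  from measurable_compose[OF L2_measurable[OF assms] this]
  show "(\<lambda>x. cnj (u x)) \<in> borel_measurable M" .
qed auto

lemma L2_zero: "(\<lambda>x. 0) \<in> L2 M"
  by (rule L2_I) (auto simp: L2_sq_def)

lemma L2_bounded:
  assumes "finite_measure M" "w \<in> borel_measurable M" "AE x in M. cmod (w x) \<le> c"
  shows "w \<in> L2 M"
proof -
  interpret finite_measure M by fact
  have "(\<lambda>x. 1) \<in> L2 M"
    by (rule L2_I) (auto simp: L2_sq_def less_top[symmetric] emeasure_finite)
  then show ?thesis by (rule L2_bound[where c=c]) (use assms in auto)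
qed

lemma L2_sq_diff_le:
  assumes "u \<in> borel_measurable M" "v \<in> borel_measurable M"
  shows "L2_sq M (\<lambda>x. u x - v x) \<le> 2 * L2_sq M u + 2 * L2_sq M v"
  using L2_sq_add_le[of u M "\<lambda>x. -1 * v x"] assms L2_sq_cmult[of v M "-1"] by simp

lemma cauchy_schwarz_L2_nn:
  assumes "u \<in> borel_measurable M" "v \<in> borel_measurable M"
  shows "(\<integral>\<^sup>+x. ennreal (cmod (u x * v x)) \<partial>M)\<^sup>2 \<le> L2_sq M u * L2_sq M v"
  using Cauchy_Schwarz_nn_integral[of "\<lambda>x. ennreal (cmod (u x))" M "\<lambda>x. ennreal (cmod (v x))"] assms
  by (simp add: L2_sq_def norm_mult ennreal_mult ennreal_power)

lemma L2_mult_integrable: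
  assumes "u \<in> L2 M" "v \<in> L2 M"
  shows "integrable M (\<lambda>x. u x * v x)"
proof (rule integrableI_bounded)
  have "(\<integral>\<^sup>+x. ennreal (cmod (u x * v x)) \<partial>M)\<^sup>2 < top"
    using cauchy_schwarz_L2_nn[of u M v] assms[THEN L2_measurable] assms[THEN L2_sq_finite]
    by (auto intro: le_less_trans simp: ennreal_mult_less_top)
  then show "(\<integral>\<^sup>+x. ennreal (cmod (u x * v x)) \<partial>M) < \<infinity>"
    by (simp add: power_less_top_ennreal)
qed (intro borel_measurable_times assms[THEN L2_measurable])

lemma cauchy_schwarz_L2:
  assumes "u \<in> L2 M" "v \<in> L2 M"
  shows "(LINT x|M. cmod (u x * v x))\<^sup>2 \<le> (LINT x|M. (cmod (u x))\<^sup>2) * (LINT x|M. (cmod (v x))\<^sup>2)"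
proof -
  have "(\<integral>\<^sup>+x. ennreal (cmod (u x * v x)) \<partial>M) = ennreal (LINT x|M. cmod (u x * v x))"
    by (rule nn_integral_eq_integral) (use L2_mult_integrable[OF assms] in auto)
  then have "ennreal ((LINT x|M. cmod (u x * v x))\<^sup>2)
      \<le> ennreal ((LINT x|M. (cmod (u x))\<^sup>2) * (LINT x|M. (cmod (v x))\<^sup>2))"
    using cauchy_schwarz_L2_nn[of u M v] assms
    by (simp add: L2_measurable L2_sq_eq_integral ennreal_power ennreal_mult)
  then show ?thesis
    by (subst (asm) ennreal_le_iff) auto
qed

lemma cauchy_schwarz_L2_integral:
  assumes "u \<in> L2 M" "v \<in> L2 M"
  shows "(cmod (LINT x|M. u x * v x))\<^sup>2 \<le> (LINT x|M. (cmod (u x))\<^sup>2) * (LINT x|M. (cmod (v x))\<^sup>2)"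
proof -
  have "(cmod (LINT x|M. u x * v x))\<^sup>2 \<le> (LINT x|M. cmod (u x * v x))\<^sup>2"
    by (intro power_mono integral_norm_bound) auto
  then show ?thesis using cauchy_schwarz_L2[OF assms] by linarith
qed

lemma tendsto_integral_L2:
  assumes "u \<in> L2 M" "v \<in> L2 M" "\<And>n. w n \<in> L2 M" "(\<lambda>n. L2_sq M (\<lambda>x. w n x - v x)) \<longlonglongrightarrow> 0"
  shows "(\<lambda>n. LINT x|M. u x * w n x) \<longlonglongrightarrow> (LINT x|M. u x * v x)"
proof -
  let ?I = "\<lambda>f. LINT x|M. (cmod (f x))\<^sup>2"
  have d: "(\<lambda>x. w n x - v x) \<in> L2 M" for n using assms by (auto intro: L2_diff)
  have "(\<lambda>n. ennreal (?I (\<lambda>x. w n x - v x))) \<longlonglongrightarrow> ennreal 0"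
    using assms(4) by (simp add: L2_sq_eq_integral[OF d])
  then have 1: "(\<lambda>n. ?I (\<lambda>x. w n x - v x)) \<longlonglongrightarrow> 0"
    by (rule tendsto_ennrealD) (auto intro!: always_eventually)
  have 2: "cmod ((LINT x|M. u x * w n x) - (LINT x|M. u x * v x)) \<le> sqrt (?I u * ?I (\<lambda>x. w n x - v x))" for n
  proof -
    have "(LINT x|M. u x * w n x) - (LINT x|M. u x * v x) = (LINT x|M. u x * (w n x - v x))"
      using assms by (simp add: right_diff_distrib L2_mult_integrable)
    then show ?thesis
      using cauchy_schwarz_L2_integral[OF assms(1) d[of n]] by (auto intro: real_le_rsqrt)
  qed
  have "(\<lambda>n. sqrt (?I u * ?I (\<lambda>x. w n x - v x))) \<longlonglongrightarrow> sqrt (?I u * 0)"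
    by (intro tendsto_intros 1)
  then have "(\<lambda>n. (LINT x|M. u x * w n x) - (LINT x|M. u x * v x)) \<longlonglongrightarrow> 0"
    by (intro Lim_null_comparison[OF always_eventually[OF allI[OF 2]]]) simp
  then show ?thesis by (simp add: LIM_zero_iff)
qed

lemma L2_integrable_finite:
  assumes "finite_measure M" "u \<in> L2 M"
  shows "integrable M u"
proof -
  have "(\<lambda>x. 1) \<in> L2 M" by (rule L2_bounded[OF assms(1), of _ 1]) auto
  from L2_mult_integrable[OF assms(2) this] show ?thesis unfolding mult_1_right .
qed

lemma borel_in_lebesgue: "S \<in> sets borel \<Longrightarrow> S \<in> sets lebesgue"
  using sets_completionI_sets[of S lborel] by simp

lemma nn_integral_lebesgue_on:
  fixes f :: "'a::euclidean_space \<Rightarrow> ennreal"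
  assumes "S \<in> sets borel"
  shows "(\<integral>\<^sup>+x. f x \<partial>lebesgue_on S) = (\<integral>\<^sup>+x. f x * indicator S x \<partial>lborel)"
proof -
  have "S \<inter> space lebesgue \<in> sets lebesgue" using borel_in_lebesgue[OF assms] by simp
  then show ?thesis by (simp only: nn_integral_restrict_space nn_integral_completion)
qed

lemma borel_measurable_lebesgue_on: "f \<in> borel_measurable borel \<Longrightarrow> f \<in> borel_measurable (lebesgue_on S)"
  by (intro measurable_restrict_space1 measurable_completion) simp

section \<open>Integration by parts and weak derivatives\<close>

lemma has_vector_derivative_line:
  assumes "F differentiable (at (x + s *\<^sub>R b))"
  shows "((\<lambda>s. F (x + s *\<^sub>R b)) has_vector_derivative dderiv b F (x + s *\<^sub>R b)) (at s within T)"
proof -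
  let ?y = "x + s *\<^sub>R b"
  have "((\<lambda>s. x + s *\<^sub>R b) has_derivative (\<lambda>h. h *\<^sub>R b)) (at s within T)"
    by (auto intro!: derivative_eq_intros)
  from has_derivative_compose[OF this differentiable_has_derivative[OF assms]]
  have "((\<lambda>s. F (x + s *\<^sub>R b)) has_derivative (\<lambda>h. dderiv (h *\<^sub>R b) F ?y)) (at s within T)" .
  moreover have "dderiv (h *\<^sub>R b) F ?y = h *\<^sub>R dderiv b F ?y" for h
    by (rule linear_scale[OF has_derivative_linear[OF differentiable_has_derivative[OF assms]]])
  ultimately show ?thesis by (simp add: has_vector_derivative_def)
qed

lemma line_increment_bound:
  assumes "\<And>y. F differentiable (at y)" "\<And>y. cmod (dderiv b F y) \<le> C"
  shows "cmod (F (x + h *\<^sub>R b) - F x) \<le> C * \<bar>h\<bar>"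
proof -
  have "norm ((\<lambda>s. F (x + s *\<^sub>R b)) h - (\<lambda>s. F (x + s *\<^sub>R b)) 0) \<le> C * norm (h - 0)"
  proof (rule differentiable_bound[where S=UNIV and f'="\<lambda>s k. k *\<^sub>R dderiv b F (x + s *\<^sub>R b)"])
    show "((\<lambda>s. F (x + s *\<^sub>R b)) has_derivative (\<lambda>k. k *\<^sub>R dderiv b F (x + s *\<^sub>R b))) (at s within UNIV)" for s
      using has_vector_derivative_line[OF assms(1)] by (simp add: has_vector_derivative_def)
    show "onorm (\<lambda>k. k *\<^sub>R dderiv b F (x + s *\<^sub>R b)) \<le> C" for s
      by (rule onorm_le) (use assms(2) in \<open>auto intro: mult_left_mono simp: mult.commute[of C]\<close>)
  qed auto
  then show ?thesis by simp
qed

lemma integrable_compact_support: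
  fixes F :: "'a::euclidean_space \<Rightarrow> complex"
  assumes "continuous_on UNIV F" "compact K" "\<And>x. x \<notin> K \<Longrightarrow> F x = 0"
  shows "integrable lborel F"
proof -
  have "set_integrable lborel K F"
    unfolding set_integrable_def by (rule borel_integrable_compact[OF assms(2)]) (use assms(1) continuous_on_subset in blast)
  moreover have "(\<lambda>x. indicator K x *\<^sub>R F x) = F"
    using assms(3) by (auto simp: indicator_def)
  ultimately show ?thesis by (simp add: set_integrable_def)
qed

section \<open>Translation invariance and integrals of derivatives\<close>

lemma integral_lborel_translation:
  fixes f :: "'a::euclidean_space \<Rightarrow> 'b::{banach, second_countable_topology}"
  assumes "f \<in> borel_measurable borel"
  shows "(LINT x|lborel. f (x + c)) = (LINT x|lborel. f x)"
  using integral_distr[of "(+) c" lborel borel f] assms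
  by (simp add: lborel_distr_plus add.commute)

lemma integrable_lborel_translation:
  fixes f :: "'a::euclidean_space \<Rightarrow> 'b::{banach, second_countable_topology}"
  assumes "integrable lborel f"
  shows "integrable lborel (\<lambda>x. f (x + c))"
proof -
  have "integrable (distr lborel borel ((+) c)) f" using assms by (simp add: lborel_distr_plus)
  then show ?thesis by (subst (asm) integrable_distr_eq) (use assms in \<open>auto simp: add.commute\<close>)
qed

lemma nn_integral_lborel_translation:
  fixes f :: "'a::euclidean_space \<Rightarrow> ennreal"
  assumes "f \<in> borel_measurable borel"
  shows "(\<integral>\<^sup>+x. f (x + c) \<partial>lborel) = (\<integral>\<^sup>+x. f x \<partial>lborel)"
  using nn_integral_distr[of "(+) c" lborel borel f] assms
  by (simp add: lborel_distr_plus add.commute)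

text \<open>By translation invariance every difference quotient has integral 0, and dominated
  convergence passes to the derivative.\<close>

lemma integral_dderiv_eq_0:
  fixes F :: "'a::euclidean_space \<Rightarrow> complex"
  assumes diff: "\<And>x. F differentiable (at x)" and cont: "continuous_on UNIV (dderiv b F)"
    and K: "compact K" "\<And>x. x \<notin> K \<Longrightarrow> F x = 0"
  shows "(LINT x|lborel. dderiv b F x) = 0"
proof -
  let ?D = "dderiv b F"
  have F: "continuous_on UNIV F"
    using diff by (meson differentiable_imp_continuous_within continuous_at_imp_continuous_on)
  have D0: "?D x = 0" if "x \<notin> K" for x
  proof -
    have "?D x = dderiv b (\<lambda>_. 0) x"
      by (rule dderiv_cong_open[where S="- K"]) (use K that compact_imp_closed in auto)
    then show ?thesis by (simp add: dderiv_const)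
  qed
  have "compact (?D ` K)" using K(1) cont by (intro compact_continuous_image) (auto intro: continuous_on_subset)
  from compact_imp_bounded[OF this] obtain C where C: "\<And>x. x \<in> K \<Longrightarrow> cmod (?D x) \<le> C" and C0: "0 \<le> C"
    unfolding bounded_pos by (metis image_eqI less_imp_le)
  have DC: "cmod (?D x) \<le> C" for x using C D0 C0 by (cases "x \<in> K") auto
  obtain R where R: "\<And>x. x \<in> K \<Longrightarrow> norm x \<le> R" using compact_imp_bounded[OF K(1)] unfolding bounded_iff by blast
  define h where "h = (\<lambda>n. inverse (real (Suc n)))"
  have h: "0 < h n" "h n \<le> 1" for n by (auto simp: h_def field_simps)
  define q where "q = (\<lambda>n x. (1 / h n) *\<^sub>R (F (x + h n *\<^sub>R b) - F x))"
  have intF: "integrable lborel F" by (rule integrable_compact_support[OF F K])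
  have q0: "(LINT x|lborel. q n x) = 0" for n
    unfolding q_def using intF integrable_lborel_translation[OF intF] borel_measurable_continuous_onI[OF F]
    by (simp add: integral_lborel_translation)
  \<comment> \<open>Contains every point where some quotient \<open>q n\<close> is nonzero, since
    the shifts \<open>h n *\<^sub>R b\<close> are no longer than \<open>b\<close>.\<close>
  define B where "B = cball (0 :: 'a) (R + norm b)"
  have "(\<lambda>n. LINT x|lborel. q n x) \<longlonglongrightarrow> (LINT x|lborel. ?D x)"
  proof (rule integral_dominated_convergence[where w="\<lambda>x. indicator B x * C"])
    show "?D \<in> borel_measurable lborel" using borel_measurable_continuous_onI[OF cont] by simp
    have "continuous_on UNIV (\<lambda>x. F (x + h n *\<^sub>R b))" for n
      by (rule continuous_on_compose2[OF F]) (auto intro!: continuous_intros)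
    then have "continuous_on UNIV (q n)" for n
      unfolding q_def using F by (intro continuous_intros) auto
    then show "q n \<in> borel_measurable lborel" for n
      using borel_measurable_continuous_onI[of "q n"] by simp
    show "integrable lborel (\<lambda>x. indicator B x * C)"
      unfolding B_def by (intro integrable_mult_left integrable_real_indicator emeasure_bounded_finite) auto
    show "AE x in lborel. cmod (q n x) \<le> indicator B x * C" for n
    proof (rule AE_I2)
      fix x
      show "cmod (q n x) \<le> indicator B x * C"
      proof (cases "x \<in> B")
        case True
        have "cmod (F (x + h n *\<^sub>R b) - F x) \<le> C * h n"
          using line_increment_bound[OF diff DC, of x "h n"] h(1)[of n] by simp
        then show ?thesis using True h(1)[of n] by (simp add: q_def divide_le_eq)
      next
        case False
        then have "R + norm b < norm x" by (simp add: B_def)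
        moreover have "norm x \<le> norm (x + h n *\<^sub>R b) + h n * norm b"
          using norm_triangle_ineq4[of "x + h n *\<^sub>R b" "h n *\<^sub>R b"] h(1)[of n] by simp
        moreover have "h n * norm b \<le> 1 * norm b" using h(2) by (intro mult_right_mono) auto
        ultimately have "x \<notin> K" "x + h n *\<^sub>R b \<notin> K" 
          using R norm_ge_zero[of b] by (smt (verit))+
        then show ?thesis using K(2) False by (simp add: q_def)
      qed
    qed
    show "AE x in lborel. (\<lambda>n. q n x) \<longlonglongrightarrow> ?D x"
    proof (rule AE_I2)
      fix x
      have "((\<lambda>s. F (x + s *\<^sub>R b)) has_vector_derivative ?D x) (at 0)"
        using has_vector_derivative_line[OF diff, where s=0 and T=UNIV and x=x] by simp
      then have "((\<lambda>s. norm (F (x + s *\<^sub>R b) - F x - s *\<^sub>R ?D x) / norm s) \<longlongrightarrow> 0) (at 0)"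
        unfolding has_vector_derivative_def has_derivative_at by simp
      moreover have "filterlim h (at 0) sequentially"
        using h LIMSEQ_inverse_real_of_nat by (auto simp: filterlim_at h_def intro!: always_eventually)
      ultimately have "(\<lambda>n. norm (F (x + h n *\<^sub>R b) - F x - h n *\<^sub>R ?D x) / norm (h n)) \<longlonglongrightarrow> 0"
        by (rule filterlim_compose)
      moreover have "norm (F (x + h n *\<^sub>R b) - F x - h n *\<^sub>R ?D x) / norm (h n) = norm (q n x - ?D x)" for n
      proof -
        have "q n x - ?D x = (1 / h n) *\<^sub>R (F (x + h n *\<^sub>R b) - F x - h n *\<^sub>R ?D x)"
          using h(1)[of n] by (simp add: q_def scaleR_diff_right)
        then show ?thesis using h(1)[of n] by simp
      qed
      ultimately have "(\<lambda>n. q n x - ?D x) \<longlonglongrightarrow> 0"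
        by (simp add: tendsto_norm_zero_iff)
      then show "(\<lambda>n. q n x) \<longlonglongrightarrow> ?D x" by (simp add: LIM_zero_iff)
    qed
  qed
  then show ?thesis by (simp add: q0 LIMSEQ_const_iff)
qed

section \<open>Test functions and the fundamental lemma of the calculus of variations\<close>

lemma test_functions_iff:
  "\<phi> \<in> test_functions \<Omega> \<longleftrightarrow> smooth \<phi> \<and> (\<exists>K. compact K \<and> K \<subseteq> \<Omega> \<and> (\<forall>x. x \<notin> K \<longrightarrow> \<phi> x = 0))"
proof
  assume "\<phi> \<in> test_functions \<Omega>"
  then show "smooth \<phi> \<and> (\<exists>K. compact K \<and> K \<subseteq> \<Omega> \<and> (\<forall>x. x \<notin> K \<longrightarrow> \<phi> x = 0))"
    unfolding test_functions_def using closure_subset[of "{x. \<phi> x \<noteq> 0}"] by blast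
next
  assume "smooth \<phi> \<and> (\<exists>K. compact K \<and> K \<subseteq> \<Omega> \<and> (\<forall>x. x \<notin> K \<longrightarrow> \<phi> x = 0))"
  then obtain K where K: "smooth \<phi>" "compact K" "K \<subseteq> \<Omega>" "\<And>x. x \<notin> K \<Longrightarrow> \<phi> x = 0" by blast
  then have c: "closure {x. \<phi> x \<noteq> 0} \<subseteq> K" by (intro closure_minimal compact_imp_closed) auto
  moreover have "compact (closure {x. \<phi> x \<noteq> 0})"
    using K(2) c by (meson closed_closure compact_Int_closed compact_eq_bounded_closed bounded_subset)
  ultimately show "\<phi> \<in> test_functions \<Omega>" using K unfolding test_functions_def by blast
qed

lemma test_smooth: "\<phi> \<in> test_functions \<Omega> \<Longrightarrow> smooth \<phi>"
  by (simp add: test_functions_def)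

lemma test_zero_outside: "\<phi> \<in> test_functions \<Omega> \<Longrightarrow> x \<notin> \<Omega> \<Longrightarrow> \<phi> x = 0"
  unfolding test_functions_iff by blast

lemma test_mult: "\<phi> \<in> test_functions \<Omega> \<Longrightarrow> smooth f \<Longrightarrow> (\<lambda>x. f x * \<phi> x) \<in> test_functions \<Omega>"
  unfolding test_functions_iff by (auto intro: smooth_mult)

lemma test_cnj: "\<phi> \<in> test_functions \<Omega> \<Longrightarrow> (\<lambda>x. cnj (\<phi> x)) \<in> test_functions \<Omega>"
  unfolding test_functions_iff using smooth_cnj by (metis complex_cnj_zero)

lemma dderiv_zero_outside:
  assumes "compact K" "\<And>x. x \<notin> K \<Longrightarrow> \<phi> x = 0" "x \<notin> K"
  shows "dderiv b \<phi> x = 0"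
proof -
  have "dderiv b \<phi> x = dderiv b (\<lambda>_. 0) x"
    by (rule dderiv_cong_open[where S="- K"]) (use assms compact_imp_closed in auto)
  then show ?thesis by (simp add: dderiv_const)
qed

lemma test_dderiv: "\<phi> \<in> test_functions \<Omega> \<Longrightarrow> b \<in> Basis \<Longrightarrow> dderiv b \<phi> \<in> test_functions \<Omega>"
  unfolding test_functions_iff using smooth_dderiv dderiv_zero_outside by metis

lemma integral_lebesgue_on_supported:
  fixes f :: "'a::euclidean_space \<Rightarrow> 'b::{banach, second_countable_topology}"
  assumes "S \<in> sets borel" "f \<in> borel_measurable borel" "\<And>x. x \<notin> S \<Longrightarrow> f x = 0"
  shows "(LINT x|lebesgue_on S. f x) = (LINT x|lborel. f x)"
proof -
  have "(LINT x|lebesgue_on S. f x) = (LINT x|lebesgue. indicator S x *\<^sub>R f x)"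
    using borel_in_lebesgue[OF assms(1)] by (intro integral_restrict_space) simp
  also have "(\<lambda>x. indicator S x *\<^sub>R f x) = f" using assms(3) by (auto simp: indicator_def)
  also have "(LINT x|lebesgue. f x) = (LINT x|lborel. f x)"
    using assms(2) by (intro integral_completion) simp
  finally show ?thesis .
qed

lemma smooth_measurable: "smooth f \<Longrightarrow> f \<in> borel_measurable borel"
  by (intro borel_measurable_continuous_onI smooth_continuous)

lemma smooth_L2:
  fixes \<Omega> :: "'a::euclidean_space set"
  assumes "open \<Omega>" "bounded \<Omega>" "smooth f"
  shows "f \<in> L2 (lebesgue_on \<Omega>)"
proof -
  have \<Omega>: "\<Omega> \<in> sets lebesgue" using assms(1) by (intro borel_in_lebesgue) auto
  have "compact (f ` closure \<Omega>)"
    using assms by (intro compact_continuous_image smooth_continuous) (auto simp: compact_closure)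
  from compact_imp_bounded[OF this] obtain C where C: "\<And>x. x \<in> \<Omega> \<Longrightarrow> cmod (f x) \<le> C"
    unfolding bounded_iff using closure_subset by (metis imageI subsetD)
  show ?thesis
  proof (rule L2_bounded[where c=C])
    show "finite_measure (lebesgue_on \<Omega>)"
      by (intro finite_measure_lebesgue_on bounded_set_imp_lmeasurable assms \<Omega>)
    show "f \<in> borel_measurable (lebesgue_on \<Omega>)"
      by (intro borel_measurable_lebesgue_on smooth_measurable assms)
    show "AE x in lebesgue_on \<Omega>. cmod (f x) \<le> C"
      by (rule AE_I2) (use C in \<open>simp add: space_restrict_space\<close>)
  qed
qed

text \<open>The product of \<open>f\<close> with a test function has compact support, so its
  derivative integrates to 0.\<close>

lemma smooth_has_weak_dderiv:
  fixes \<Omega> :: "'a::euclidean_space set"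
  assumes "open \<Omega>" "bounded \<Omega>" "smooth f" "b \<in> Basis"
  shows "has_weak_dderiv \<Omega> b f (dderiv b f)"
  unfolding has_weak_dderiv_def
proof
  fix \<phi> assume \<phi>: "\<phi> \<in> test_functions \<Omega>"
  have L2: "f \<in> L2 (lebesgue_on \<Omega>)" "\<phi> \<in> L2 (lebesgue_on \<Omega>)"
    "dderiv b f \<in> L2 (lebesgue_on \<Omega>)" "dderiv b \<phi> \<in> L2 (lebesgue_on \<Omega>)"
    by (intro smooth_L2 smooth_dderiv assms test_smooth[OF \<phi>])+
  have T: "(\<lambda>x. f x * \<phi> x) \<in> test_functions \<Omega>" by (rule test_mult[OF \<phi> assms(3)])
  then obtain K where K: "compact K" "\<And>x. x \<notin> K \<Longrightarrow> f x * \<phi> x = 0"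
    unfolding test_functions_iff by blast
  have "(LINT x|lebesgue_on \<Omega>. dderiv b (\<lambda>x. f x * \<phi> x) x) = (LINT x|lborel. dderiv b (\<lambda>x. f x * \<phi> x) x)"
    using assms(1) test_dderiv[OF T assms(4)]
    by (intro integral_lebesgue_on_supported smooth_measurable test_smooth) (auto intro: test_zero_outside)
  also have "\<dots> = 0"
    by (rule integral_dderiv_eq_0[OF smooth_differentiable smooth_continuous K])
      (use T assms(4) in \<open>auto intro: test_smooth smooth_dderiv\<close>)
  finally have "(LINT x|lebesgue_on \<Omega>. f x * dderiv b \<phi> x + dderiv b f x * \<phi> x) = 0"
    using smooth_differentiable[OF assms(3)] smooth_differentiable[OF test_smooth[OF \<phi>]]
    by (simp add: dderiv_mult)
  then show "(LINT x|lebesgue_on \<Omega>. f x * dderiv b \<phi> x) = - (LINT x|lebesgue_on \<Omega>. dderiv b f x * \<phi> x)"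
    by (simp add: L2_mult_integrable[OF L2(1,4)] L2_mult_integrable[OF L2(3,2)] eq_neg_iff_add_eq_0)
qed

text \<open>The support lies in the sum of \<open>K\<close> and a closed ball of radius
  \<open>2 * t\<close>, which is compact and inside \<Omega>.\<close>

lemma cutoff_test_function:
  fixes \<Omega> :: "'a::euclidean_space set"
  assumes "cutoff K t C \<eta>" "compact K" "\<And>x. x \<in> K \<Longrightarrow> cball x (2 * t) \<subseteq> \<Omega>"
  shows "\<eta> \<in> test_functions \<Omega>"
proof -
  let ?S = "{x + y |x y. x \<in> K \<and> y \<in> cball 0 (2 * t)}"
  have "compact ?S" by (intro compact_sums assms) auto
  moreover have "?S \<subseteq> \<Omega>"
  proof
    fix z assume "z \<in> ?S"
    then obtain x y where "z = x + y" "x \<in> K" "norm y \<le> 2 * t" by auto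
    then have "z \<in> cball x (2 * t)" by (simp add: dist_norm)
    then show "z \<in> \<Omega>" using assms(3) \<open>x \<in> K\<close> by blast
  qed
  moreover have "\<eta> x = 0" if "x \<notin> ?S" for x
  proof (rule ccontr)
    assume "\<eta> x \<noteq> 0"
    then obtain k where k: "k \<in> K" "dist x k \<le> 2 * t" using assms(1) unfolding cutoff_def by blast
    then have "x = k + (x - k)" "x - k \<in> cball 0 (2 * t)" by (auto simp: dist_norm norm_minus_commute)
    then show False using that k(1) by blast
  qed
  moreover have "smooth \<eta>" using assms(1) by (simp add: cutoff_def)
  ultimately show ?thesis unfolding test_functions_iff by blast
qed

text \<open>Cutoffs of \<open>F\<close> with widths tending to 0 are test functions and converge
  pointwise to the indicator of \<open>F\<close>; |w| dominates.\<close>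

lemma integral_compact_eq_0:
  fixes \<Omega> :: "'a::euclidean_space set"
  assumes "open \<Omega>" and w: "integrable (lebesgue_on \<Omega>) w"
    and tests: "\<And>\<phi>. \<phi> \<in> test_functions \<Omega> \<Longrightarrow> (LINT x|lebesgue_on \<Omega>. w x * \<phi> x) = 0"
    and F: "compact F" "F \<subseteq> \<Omega>"
  shows "(LINT x|lebesgue_on \<Omega>. w x * indicator F x) = 0"
proof -
  obtain C where C: "\<And>(K :: 'a set) t. 0 < t \<Longrightarrow> compact K \<Longrightarrow> \<exists>\<eta>. cutoff K t C \<eta>"
    by (rule smooth_cutoff_exists[where 'a='a]) blast
  obtain e where e: "0 < e" "(\<Union>x\<in>F. ball x e) \<subseteq> \<Omega>"
    using compact_subset_open_imp_ball_epsilon_subset[OF F(1) assms(1) F(2)] by blast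
  \<comment> \<open>The factor 1/4 keeps the reach \<open>2 * t n\<close> of the cutoff below
    \<open>e\<close>, the room available around \<open>F\<close> in \<Omega>.\<close>
  define t where "t = (\<lambda>n. e / 4 * inverse (real (Suc n)))"
  have t: "0 < t n" for n using e by (simp add: t_def)
  have t2: "2 * t n < e" for n
  proof -
    have "inverse (real (Suc n)) \<le> 1" by (simp add: field_simps)
    then have "e / 4 * inverse (real (Suc n)) \<le> e / 4 * 1" using e by (intro mult_left_mono) auto
    then show ?thesis using e by (simp add: t_def)
  qed
  obtain \<eta> where c: "\<And>n. cutoff F (t n) C (\<eta> n)" using C[OF t F(1)] by metis
  have \<eta>1: "\<eta> n \<in> test_functions \<Omega>" for n
  proof (rule cutoff_test_function[OF c F(1)])
    fix x assume "x \<in> F"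
    then show "cball x (2 * t n) \<subseteq> \<Omega>" using e(2) t2[of n] by force
  qed
  have \<eta>2: "\<exists>r\<in>{0..1}. \<eta> n x = complex_of_real r" and \<eta>3: "x \<in> F \<Longrightarrow> \<eta> n x = 1"
    and \<eta>4: "\<eta> n x \<noteq> 0 \<Longrightarrow> \<exists>k\<in>F. dist x k \<le> 2 * t n" for n x
    using c[of n] unfolding cutoff_def by blast+
  have lim: "(\<lambda>n. \<eta> n x) \<longlonglongrightarrow> indicator F x" for x
  proof (cases "x \<in> F")
    case False
    \<comment> \<open>For empty \<open>F\<close> the value of \<open>infdist\<close> is 0 by
      convention, so the argument by distance is made for nonempty \<open>F\<close> only.\<close>
    show ?thesis
    proof (cases "F = {}")
      case False
      then have "0 < infdist x F"
        using \<open>x \<notin> F\<close> infdist_pos_not_in_closed compact_imp_closed[OF F(1)] by blast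
      moreover have "(\<lambda>n. 2 * t n) \<longlonglongrightarrow> 2 * (e / 4 * 0)"
        unfolding t_def by (intro tendsto_intros LIMSEQ_inverse_real_of_nat)
      ultimately have "\<forall>\<^sub>F n in sequentially. 2 * t n < infdist x F"
        using order_tendstoD(2)[of "\<lambda>n. 2 * t n" 0] by simp
      then have "\<forall>\<^sub>F n in sequentially. \<eta> n x = indicator F x"
      proof eventually_elim
        case (elim n)
        have "\<eta> n x = 0"
        proof (rule ccontr)
          assume "\<eta> n x \<noteq> 0"
          then obtain k where k: "k \<in> F" "dist x k \<le> 2 * t n" using \<eta>4 by blast
          then show False using infdist_le[OF k(1), of x] elim by linarith
        qed
        then show ?case using \<open>x \<notin> F\<close> by simp
      qed
      then show ?thesis by (rule tendsto_eventually)
    next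
      case True
      then have "\<eta> n x = 0" for n using \<eta>4[of n x] by auto
      then show ?thesis using True by simp
    qed
  qed (simp add: \<eta>3)
  have mw: "w \<in> borel_measurable (lebesgue_on \<Omega>)" using w by (rule borel_measurable_integrable)
  have mF: "(indicator F :: 'a \<Rightarrow> complex) \<in> borel_measurable (lebesgue_on \<Omega>)"
    by (intro borel_measurable_lebesgue_on borel_measurable_indicator borel_closed compact_imp_closed F)
  have "(\<lambda>n. LINT x|lebesgue_on \<Omega>. w x * \<eta> n x) \<longlonglongrightarrow> (LINT x|lebesgue_on \<Omega>. w x * indicator F x)"
  proof (rule integral_dominated_convergence[where w="\<lambda>x. cmod (w x)"])
    show "(\<lambda>x. w x * indicator F x) \<in> borel_measurable (lebesgue_on \<Omega>)"
      by (intro borel_measurable_times mw mF)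
    show "(\<lambda>x. w x * \<eta> n x) \<in> borel_measurable (lebesgue_on \<Omega>)" for n
      by (intro borel_measurable_times mw borel_measurable_lebesgue_on smooth_measurable test_smooth[OF \<eta>1])
    show "integrable (lebesgue_on \<Omega>) (\<lambda>x. cmod (w x))" using w by simp
    show "AE x in lebesgue_on \<Omega>. (\<lambda>n. w x * \<eta> n x) \<longlonglongrightarrow> w x * indicator F x"
      by (intro AE_I2 tendsto_mult tendsto_const lim)
    show "AE x in lebesgue_on \<Omega>. cmod (w x * \<eta> n x) \<le> cmod (w x)" for n
    proof (rule AE_I2)
      fix x
      obtain r where "r \<in> {0..1}" "\<eta> n x = complex_of_real r" using \<eta>2 by blast
      then show "cmod (w x * \<eta> n x) \<le> cmod (w x)" by (simp add: norm_mult mult_left_le)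
    qed
  qed
  then show ?thesis by (simp add: tests[OF \<eta>1] LIMSEQ_const_iff)
qed

text \<open>The set where Re w > 0 is, up to a null set, a countable union of compact sets. On each
  of them a positive function has integral 0, so each is a null set.\<close>

lemma AE_Re_le_0_if_tests:
  fixes \<Omega> :: "'a::euclidean_space set"
  assumes "open \<Omega>" and w: "integrable (lebesgue_on \<Omega>) w"
    and tests: "\<And>\<phi>. \<phi> \<in> test_functions \<Omega> \<Longrightarrow> (LINT x|lebesgue_on \<Omega>. w x * \<phi> x) = 0"
  shows "AE x in lebesgue_on \<Omega>. Re (w x) \<le> 0"
proof -
  let ?M = "lebesgue_on \<Omega>"
  have \<Omega>: "\<Omega> \<in> sets lebesgue" using assms(1) by (intro borel_in_lebesgue) auto
  have mw: "(\<lambda>x. Re (w x)) \<in> borel_measurable ?M"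
    using borel_measurable_integrable[OF w] by (rule measurable_compose) (auto intro!: borel_measurable_continuous_onI continuous_intros)
  define A where "A = {x \<in> \<Omega>. 0 < Re (w x)}"
  have "A \<in> sets ?M"
    using measurable_sets[OF mw, of "{0<..}"] by (simp add: A_def vimage_def Int_def conj_commute)
  then have "A \<in> sets lebesgue" using \<Omega> by (simp add: sets_restrict_space_iff)
  then obtain G T where GT: "fsigma G" "T \<in> null_sets lebesgue" "G \<union> T = A" "disjnt G T"
    by (rule lebesgue_set_almost_fsigma)
  from GT(1)[unfolded fsigma_Union_compact] obtain F :: "nat \<Rightarrow> 'a set"
    where F0: "range F \<subseteq> Collect compact" and F2: "G = (\<Union>n. F n)"
    by (elim exE conjE)
  have F1: "compact (F n)" for n using F0 by blast
  have FA: "F n \<subseteq> A" for n using F2 GT(3) by blast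
  have Fs: "F n \<in> sets lebesgue" for n
    using borel_in_lebesgue borel_closed compact_imp_closed F1 by metis
  have "F n \<in> null_sets lebesgue" for n
  proof -
    have F\<Omega>: "F n \<subseteq> \<Omega>" using FA A_def by blast
    have FM: "F n \<in> sets ?M" using Fs F\<Omega> \<Omega> by (simp add: sets_restrict_space_iff)
    have "(\<lambda>x. indicat_real (F n) x *\<^sub>R w x) = (\<lambda>x. w x * indicator (F n) x)"
      by (auto simp: indicator_def)
    with integrable_mult_indicator[OF FM w]
    have int: "integrable ?M (\<lambda>x. w x * indicator (F n) x)" by simp
    have "Re (LINT x|?M. w x * indicator (F n) x) = 0"
      using integral_compact_eq_0[OF assms F1 F\<Omega>] by simp
    then have "(LINT x|?M. Re (w x * indicator (F n) x)) = 0"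
      using integral_Re[OF int] by simp
    moreover have nn: "AE x in ?M. 0 \<le> Re (w x * indicator (F n) x)"
      by (rule AE_I2) (use FA[of n] in \<open>auto simp: indicator_def A_def\<close>)
    ultimately have "AE x in ?M. Re (w x * indicator (F n) x) = 0"
      using integral_nonneg_eq_0_iff_AE[OF integrable_Re[OF int] nn] by simp
    then have "AE x in ?M. x \<notin> F n"
      by eventually_elim (use FA[of n] in \<open>auto simp: A_def indicator_def\<close>)
    then have "AE x in lebesgue. x \<in> \<Omega> \<longrightarrow> x \<notin> F n" using \<Omega> by (subst (asm) AE_restrict_space_iff) auto
    then have "AE x in lebesgue. x \<notin> F n" using F\<Omega> by (auto elim: eventually_mono)
    then show ?thesis using Fs by (simp add: AE_iff_null_sets)
  qed
  then have "(\<Union>n. F n) \<union> T \<in> null_sets lebesgue" using GT(2) by (intro null_sets.Un null_sets_UN) auto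
  then have "A \<in> null_sets lebesgue" using F2 GT(3) by simp
  then have "AE x in lebesgue. x \<notin> A" by (rule AE_not_in)
  then have "AE x in lebesgue. x \<in> \<Omega> \<longrightarrow> Re (w x) \<le> 0" by eventually_elim (auto simp: A_def)
  then show ?thesis using \<Omega> by (subst AE_restrict_space_iff) auto
qed

lemma fundamental_lemma_calculus_of_variations:
  fixes \<Omega> :: "'a::euclidean_space set"
  assumes "open \<Omega>" and w: "integrable (lebesgue_on \<Omega>) w"
    and tests: "\<And>\<phi>. \<phi> \<in> test_functions \<Omega> \<Longrightarrow> (LINT x|lebesgue_on \<Omega>. w x * \<phi> x) = 0"
  shows "AE x in lebesgue_on \<Omega>. w x = 0"
proof -
  have "AE x in lebesgue_on \<Omega>. Re (c * w x) \<le> 0" for c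
  proof (rule AE_Re_le_0_if_tests[OF assms(1)])
    show "integrable (lebesgue_on \<Omega>) (\<lambda>x. c * w x)" using w by simp
    show "(LINT x|lebesgue_on \<Omega>. c * w x * \<phi> x) = 0" if "\<phi> \<in> test_functions \<Omega>" for \<phi>
      using tests[OF that] by (simp add: mult.assoc)
  qed
  \<comment> \<open>The four multiples control both signs of the real and of the imaginary
    part.\<close>
  from this[of 1] this[of "-1"] this[of \<i>] this[of "-\<i>"] show ?thesis
    by eventually_elim (auto simp: complex_eq_iff)
qed

section \<open>Weak derivatives on a bounded open set\<close>

locale bounded_domain =
  fixes \<Omega> :: "'a::euclidean_space set"
  assumes open_domain: "open \<Omega>" and bounded_domain: "bounded \<Omega>"
begin

abbreviation "M \<equiv> lebesgue_on \<Omega>"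

lemma domain_sets: "\<Omega> \<in> sets borel" "\<Omega> \<in> sets lebesgue"
  using open_domain by (auto intro: borel_in_lebesgue)

lemma finite_M: "finite_measure M"
  by (intro finite_measure_lebesgue_on bounded_set_imp_lmeasurable bounded_domain domain_sets)

lemma test_L2: "\<phi> \<in> test_functions \<Omega> \<Longrightarrow> \<phi> \<in> L2 M"
  by (rule smooth_L2[OF open_domain bounded_domain test_smooth])

lemma test_dderiv_L2: "\<phi> \<in> test_functions \<Omega> \<Longrightarrow> b \<in> Basis \<Longrightarrow> dderiv b \<phi> \<in> L2 M"
  by (rule test_L2[OF test_dderiv])

lemma L2_eq_if_tests:
  assumes "v \<in> L2 M" "w \<in> L2 M"
    and "\<And>\<phi>. \<phi> \<in> test_functions \<Omega> \<Longrightarrow> (LINT x|M. v x * \<phi> x) = (LINT x|M. w x * \<phi> x)"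
  shows "AE x in M. v x = w x"
proof -
  have "AE x in M. v x - w x = 0"
  proof (rule fundamental_lemma_calculus_of_variations[OF open_domain])
    show "integrable M (\<lambda>x. v x - w x)"
      by (rule L2_integrable_finite[OF finite_M L2_diff[OF assms(1,2)]])
    show "(LINT x|M. (v x - w x) * \<phi> x) = 0" if "\<phi> \<in> test_functions \<Omega>" for \<phi>
      using assms(3)[OF that] L2_mult_integrable[OF _ test_L2[OF that]] assms(1,2)
      by (simp add: left_diff_distrib)
  qed
  then show ?thesis by simp
qed

lemma wderiv_L2_weak:
  assumes "u \<in> H1 \<Omega>" "b \<in> Basis"
  shows "wderiv \<Omega> b u \<in> L2 M" "has_weak_dderiv \<Omega> b u (wderiv \<Omega> b u)"
proof -
  have "\<exists>w. w \<in> L2 M \<and> has_weak_dderiv \<Omega> b u w" using assms by (auto simp: H1_def)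
  from someI_ex[OF this] show "wderiv \<Omega> b u \<in> L2 M" "has_weak_dderiv \<Omega> b u (wderiv \<Omega> b u)"
    by (auto simp: wderiv_def)
qed

lemma H1_L2: "u \<in> H1 \<Omega> \<Longrightarrow> u \<in> L2 M"
  by (simp add: H1_def)

lemma H1_I:
  assumes "u \<in> L2 M" "\<And>b. b \<in> Basis \<Longrightarrow> w b \<in> L2 M" "\<And>b. b \<in> Basis \<Longrightarrow> has_weak_dderiv \<Omega> b u (w b)"
  shows "u \<in> H1 \<Omega>"
  using assms by (auto simp: H1_def)

text \<open>Ties the arbitrary representative behind \<open>wderiv\<close> to any weak derivative at
  hand. Linearity and agreement with classical derivatives follow, but only almost
  everywhere.\<close>

lemma wderiv_AE_eq:
  assumes "u \<in> H1 \<Omega>" "b \<in> Basis" "w \<in> L2 M" "has_weak_dderiv \<Omega> b u w"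
  shows "AE x in M. wderiv \<Omega> b u x = w x"
proof (rule L2_eq_if_tests)
  show "(LINT x|M. wderiv \<Omega> b u x * \<phi> x) = (LINT x|M. w x * \<phi> x)" if "\<phi> \<in> test_functions \<Omega>" for \<phi>
    using assms(4) wderiv_L2_weak(2)[OF assms(1,2)] that unfolding has_weak_dderiv_def
    by (metis neg_equal_iff_equal)
qed (use assms wderiv_L2_weak in auto)

lemma has_weak_dderiv_diff:
  assumes "u \<in> L2 M" "v \<in> L2 M" "w \<in> L2 M" "z \<in> L2 M" "b \<in> Basis"
    "has_weak_dderiv \<Omega> b u w" "has_weak_dderiv \<Omega> b v z"
  shows "has_weak_dderiv \<Omega> b (\<lambda>x. u x - v x) (\<lambda>x. w x - z x)"
  unfolding has_weak_dderiv_def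
proof
  fix \<phi> assume \<phi>: "\<phi> \<in> test_functions \<Omega>"
  have "(LINT x|M. u x * dderiv b \<phi> x) = - (LINT x|M. w x * \<phi> x)"
    "(LINT x|M. v x * dderiv b \<phi> x) = - (LINT x|M. z x * \<phi> x)"
    using assms(6,7) \<phi> by (auto simp: has_weak_dderiv_def)
  then show "(LINT x|M. (u x - v x) * dderiv b \<phi> x) = - (LINT x|M. (w x - z x) * \<phi> x)"
    using assms(1-4) \<phi> test_L2[OF \<phi>] test_dderiv_L2[OF \<phi> assms(5)]
    by (simp add: left_diff_distrib L2_mult_integrable)
qed

lemma H1_diff:
  assumes "u \<in> H1 \<Omega>" "v \<in> H1 \<Omega>"
  shows "(\<lambda>x. u x - v x) \<in> H1 \<Omega>"
proof (rule H1_I[of _ "\<lambda>b x. wderiv \<Omega> b u x - wderiv \<Omega> b v x"])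
  show "(\<lambda>x. u x - v x) \<in> L2 M" by (rule L2_diff[OF assms[THEN H1_L2]])
  fix b :: 'a assume b: "b \<in> Basis"
  note * = wderiv_L2_weak[OF assms(1) b] wderiv_L2_weak[OF assms(2) b]
  show "(\<lambda>x. wderiv \<Omega> b u x - wderiv \<Omega> b v x) \<in> L2 M" by (rule L2_diff[OF *(1,3)])
  show "has_weak_dderiv \<Omega> b (\<lambda>x. u x - v x) (\<lambda>x. wderiv \<Omega> b u x - wderiv \<Omega> b v x)"
    by (rule has_weak_dderiv_diff[OF assms[THEN H1_L2] *(1,3) b *(2,4)])
qed

lemma wderiv_diff:
  assumes "u \<in> H1 \<Omega>" "v \<in> H1 \<Omega>" "b \<in> Basis"
  shows "AE x in M. wderiv \<Omega> b (\<lambda>x. u x - v x) x = wderiv \<Omega> b u x - wderiv \<Omega> b v x"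
proof -
  note * = wderiv_L2_weak[OF assms(1,3)] wderiv_L2_weak[OF assms(2,3)]
  show ?thesis
    by (rule wderiv_AE_eq[OF H1_diff[OF assms(1,2)] assms(3) L2_diff[OF *(1,3)]
      has_weak_dderiv_diff[OF assms(1,2)[THEN H1_L2] *(1,3) assms(3) *(2,4)]])
qed

lemma smooth_H1:
  assumes "smooth f"
  shows "f \<in> H1 \<Omega>"
  by (rule H1_I[of _ "\<lambda>b. dderiv b f"])
    (intro smooth_L2 smooth_has_weak_dderiv smooth_dderiv open_domain bounded_domain assms; assumption)+

lemma wderiv_smooth:
  assumes "smooth f" "b \<in> Basis"
  shows "AE x in M. wderiv \<Omega> b f x = dderiv b f x"
  by (intro wderiv_AE_eq smooth_H1 smooth_L2 smooth_has_weak_dderiv smooth_dderiv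
      open_domain bounded_domain assms)

lemma grad_dot_test:
  assumes "u \<in> H1 \<Omega>" "\<phi> \<in> test_functions \<Omega>"
  shows "grad_dot \<Omega> u \<phi> = (\<Sum>b\<in>Basis. LINT x|M. wderiv \<Omega> b u x * dderiv b \<phi> x)"
proof -
  have \<phi>: "\<phi> \<in> H1 \<Omega>" by (rule smooth_H1[OF test_smooth[OF assms(2)]])
  have "grad_dot \<Omega> u \<phi> = (\<Sum>b\<in>Basis. LINT x|M. wderiv \<Omega> b u x * wderiv \<Omega> b \<phi> x)"
    unfolding grad_dot_def
    by (intro Bochner_Integration.integral_sum L2_mult_integrable wderiv_L2_weak assms \<phi>)
  also have "\<dots> = (\<Sum>b\<in>Basis. LINT x|M. wderiv \<Omega> b u x * dderiv b \<phi> x)"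
  proof (rule sum.cong[OF refl])
    fix b :: 'a assume b: "b \<in> Basis"
    show "(LINT x|M. wderiv \<Omega> b u x * wderiv \<Omega> b \<phi> x) = (LINT x|M. wderiv \<Omega> b u x * dderiv b \<phi> x)"
    proof (rule integral_cong_AE)
      show "AE x in M. wderiv \<Omega> b u x * wderiv \<Omega> b \<phi> x = wderiv \<Omega> b u x * dderiv b \<phi> x"
        using wderiv_smooth[OF test_smooth[OF assms(2)] b] by eventually_elim simp
    qed (intro borel_measurable_times L2_measurable wderiv_L2_weak test_dderiv_L2 assms \<phi> b)+
  qed
  finally show ?thesis .
qed

lemma grad_dot_sum:
  assumes "u \<in> H1 \<Omega>" "v \<in> H1 \<Omega>"
  shows "grad_dot \<Omega> u v = (\<Sum>b\<in>Basis. LINT x|M. wderiv \<Omega> b u x * wderiv \<Omega> b v x)"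
  unfolding grad_dot_def
  by (intro Bochner_Integration.integral_sum L2_mult_integrable wderiv_L2_weak assms)

lemma L2_sq_le_H1_sq: "L2_sq M u \<le> H1_sq \<Omega> u"
  by (simp add: H1_sq_def)

lemma wderiv_le_H1_sq: "b \<in> Basis \<Longrightarrow> L2_sq M (wderiv \<Omega> b u) \<le> H1_sq \<Omega> u"
  unfolding H1_sq_def
  by (rule order_trans[OF member_le_sum[of b Basis "\<lambda>b. L2_sq M (wderiv \<Omega> b u)"]]) auto

text \<open>\<open>H1_sq\<close> of a difference involves \<open>wderiv\<close> of that difference.
  Here it is traded for the classical derivative of \<open>\<phi> n\<close> minus
  \<open>wderiv \<Omega> b u\<close>, a form that is compatible with multiplying
  \<open>\<phi> n\<close> by cutoffs.\<close>

lemma has_trace_approx: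
  assumes "has_trace \<Omega> u f"
  obtains \<phi> :: "nat \<Rightarrow> 'a \<Rightarrow> complex" where "\<And>n. smooth (\<phi> n)" "(\<lambda>n. L2_sq M (\<lambda>x. \<phi> n x - u x)) \<longlonglongrightarrow> 0"
    "\<And>b. b \<in> Basis \<Longrightarrow> (\<lambda>n. L2_sq M (\<lambda>x. dderiv b (\<phi> n) x - wderiv \<Omega> b u x)) \<longlonglongrightarrow> 0"
    "(\<lambda>n. L2_sq (surface \<Omega>) (\<lambda>x. \<phi> n x - f x)) \<longlonglongrightarrow> 0"
proof -
  obtain \<phi> where u: "u \<in> H1 \<Omega>" and \<phi>: "\<And>n. smooth (\<phi> n)" "(\<lambda>n. H1_sq \<Omega> (\<lambda>x. \<phi> n x - u x)) \<longlonglongrightarrow> 0"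
    "(\<lambda>n. L2_sq (surface \<Omega>) (\<lambda>x. \<phi> n x - f x)) \<longlonglongrightarrow> 0"
    using assms unfolding has_trace_def by blast
  have 1: "(\<lambda>n. L2_sq M (\<lambda>x. \<phi> n x - u x)) \<longlonglongrightarrow> 0"
    by (rule tendsto_sandwich[OF _ _ tendsto_const \<phi>(2)]) (auto intro!: always_eventually L2_sq_le_H1_sq)
  have 2: "(\<lambda>n. L2_sq M (\<lambda>x. dderiv b (\<phi> n) x - wderiv \<Omega> b u x)) \<longlonglongrightarrow> 0" if b: "b \<in> Basis" for b
  proof (rule tendsto_sandwich[OF _ _ tendsto_const \<phi>(2)])
    have "L2_sq M (\<lambda>x. dderiv b (\<phi> n) x - wderiv \<Omega> b u x) \<le> H1_sq \<Omega> (\<lambda>x. \<phi> n x - u x)" for n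
    proof -
      have "AE x in M. dderiv b (\<phi> n) x - wderiv \<Omega> b u x = wderiv \<Omega> b (\<lambda>x. \<phi> n x - u x) x"
        using wderiv_smooth[OF \<phi>(1)[of n] b] wderiv_diff[OF smooth_H1[OF \<phi>(1)[of n]] u b]
        by eventually_elim simp
      from L2_sq_cong_AE[OF this] show ?thesis using wderiv_le_H1_sq[OF b] by simp
    qed
    then show "\<forall>\<^sub>F n in sequentially. L2_sq M (\<lambda>x. dderiv b (\<phi> n) x - wderiv \<Omega> b u x) \<le> H1_sq \<Omega> (\<lambda>x. \<phi> n x - u x)"
      by simp
  qed auto
  show ?thesis by (rule that[OF \<phi>(1) 1 2 \<phi>(3)])
qed

end

section \<open>Boundary layers\<close>

definition sweep :: "'a::euclidean_space \<Rightarrow> real \<Rightarrow> 'a set \<Rightarrow> 'a set" where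
  "sweep e T U = {y + s *\<^sub>R e |y s. y \<in> U \<and> s \<in> {0..T}}"

lemma sweep_mono: "U \<subseteq> V \<Longrightarrow> sweep e T U \<subseteq> sweep e T V"
  by (auto simp: sweep_def)

lemma compact_sweep:
  fixes e :: "'a::euclidean_space"
  assumes "compact U"
  shows "compact (sweep e T U)"
proof -
  have "sweep e T U = (\<lambda>(y, s). y + s *\<^sub>R e) ` (U \<times> {0..T})"
    by (auto simp: sweep_def image_iff) blast
  moreover have "compact \<dots>"
    by (intro compact_continuous_image compact_Times assms) (auto intro!: continuous_intros simp: case_prod_beta)
  ultimately show ?thesis by simp
qed

text \<open>The swept ball is covered by at most \<open>T / d + 1\<close> balls of radius \<open>2 d\<close>.\<close>

lemma emeasure_sweep_cball_pos:
  fixes e :: "'a::euclidean_space"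
  assumes "norm e = 1" "0 < d" "d \<le> T"
  shows "emeasure lborel (sweep e T (cball z d))
     \<le> ennreal (2 ^ (DIM('a) + 1) * unit_ball_vol (DIM('a)) * T * d ^ (DIM('a) - 1))"
proof -
  let ?n = "DIM('a)"
  define N where "N = nat \<lfloor>T / d\<rfloor>"
  have N: "real N \<le> T / d" using assms by (simp add: N_def)
  have sub: "sweep e T (cball z d) \<subseteq> (\<Union>k\<le>N. cball (z + (real k * d) *\<^sub>R e) (2 * d))"
  proof
    fix x assume "x \<in> sweep e T (cball z d)"
    then obtain y s where x: "x = y + s *\<^sub>R e" "dist z y \<le> d" "0 \<le> s" "s \<le> T"
      by (auto simp: sweep_def)
    define k where "k = nat \<lfloor>s / d\<rfloor>"
    have k: "real k * d \<le> s" "s \<le> real k * d + d"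
    proof -
      have "real k = of_int \<lfloor>s / d\<rfloor>" using x assms by (simp add: k_def)
      moreover have "of_int \<lfloor>s / d\<rfloor> * d \<le> s"
        using mult_right_mono[OF of_int_floor_le[of "s / d"], of d] assms(2) by simp
      moreover have lt: "s / d < of_int \<lfloor>s / d\<rfloor> + 1" by linarith
      have "s < (of_int \<lfloor>s / d\<rfloor> + 1) * d"
        using mult_strict_right_mono[OF lt assms(2)] assms(2) by simp
      ultimately show "real k * d \<le> s" "s \<le> real k * d + d" by (auto simp: algebra_simps)
    qed
    have "k \<le> N" unfolding k_def N_def using x assms
      by (intro nat_mono floor_mono divide_right_mono) auto
    have "dist (z + (real k * d) *\<^sub>R e) x = norm ((z - y) + (real k * d - s) *\<^sub>R e)"
      unfolding x(1) dist_norm by (simp add: algebra_simps)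
    also have "\<dots> \<le> norm (z - y) + norm ((real k * d - s) *\<^sub>R e)" by (rule norm_triangle_ineq)
    also have "\<dots> \<le> d + d" using x(2) k assms(1) by (intro add_mono) (auto simp: dist_norm)
    finally have "x \<in> cball (z + (real k * d) *\<^sub>R e) (2 * d)" by simp
    with \<open>k \<le> N\<close> show "x \<in> (\<Union>k\<le>N. cball (z + (real k * d) *\<^sub>R e) (2 * d))" by blast
  qed
  have "emeasure lborel (sweep e T (cball z d)) \<le> emeasure lborel (\<Union>k\<le>N. cball (z + (real k * d) *\<^sub>R e) (2 * d))"
    by (rule emeasure_mono[OF sub]) auto
  also have "\<dots> \<le> (\<Sum>k\<le>N. emeasure lborel (cball (z + (real k * d) *\<^sub>R e) (2 * d)))"
    by (rule emeasure_subadditive_finite) auto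
  also have "\<dots> = ennreal ((real N + 1) * (unit_ball_vol ?n * (2 * d) ^ ?n))"
    using assms by (simp add: emeasure_cball ennreal_mult'' add.commute flip: ennreal_of_nat_eq_real_of_nat)
  also have "\<dots> \<le> ennreal (2 ^ (?n + 1) * unit_ball_vol ?n * T * d ^ (?n - 1))"
  proof (rule ennreal_leI)
    \<comment> \<open>Because \<open>d \<le> T\<close>, the one extra ball is absorbed into the
      factor 2 and the bound becomes linear in \<open>T\<close>.\<close>
    have "1 \<le> T / d" using assms by simp
    then have NN: "real N + 1 \<le> 2 * (T / d)" using N by linarith
    have "(real N + 1) * (unit_ball_vol ?n * (2 * d) ^ ?n) \<le> (2 * (T / d)) * (unit_ball_vol ?n * (2 * d) ^ ?n)"
      using assms by (intro mult_right_mono[OF NN]) auto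
    also have "\<dots> = 2 ^ (?n + 1) * unit_ball_vol ?n * T * d ^ (?n - 1)"
      using assms by (cases ?n) (auto simp: power_mult_distrib field_simps)
    finally show "(real N + 1) * (unit_ball_vol ?n * (2 * d) ^ ?n) \<le> \<dots>" .
  qed
  finally show ?thesis .
qed

lemma emeasure_sweep_cball:
  fixes e :: "'a::euclidean_space"
  assumes "norm e = 1" "0 \<le> d" "d \<le> T" "0 < T" "2 \<le> DIM('a)"
  shows "emeasure lborel (sweep e T (cball z d))
     \<le> ennreal (2 ^ (DIM('a) + 1) * unit_ball_vol (DIM('a)) * T * d ^ (DIM('a) - 1))"
proof (cases "d = 0")
  case True
  let ?c = "2 ^ (DIM('a) + 1) * unit_ball_vol (DIM('a)) * T"
  define h where "h = (\<lambda>k. T * inverse (real (Suc k)))"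
  have h: "0 < h k" "h k \<le> T" for k
  proof -
    show "0 < h k" using assms by (simp add: h_def)
    have "T * inverse (real (Suc k)) \<le> T * 1" using assms by (intro mult_left_mono) (auto simp: field_simps)
    then show "h k \<le> T" by (simp add: h_def)
  qed
  have "emeasure lborel (sweep e T (cball z d)) \<le> ennreal (?c * h k ^ (DIM('a) - 1))" for k
  proof -
    have "emeasure lborel (sweep e T (cball z d)) \<le> emeasure lborel (sweep e T (cball z (h k)))"
      using True h(1)[of k]
      by (intro emeasure_mono sweep_mono) (auto intro!: borel_compact compact_sweep)
    then show ?thesis using emeasure_sweep_cball_pos[OF assms(1) h(1)[of k] h(2)[of k], of z] by (rule order_trans)
  qed
  moreover have "(\<lambda>k. ?c * h k ^ (DIM('a) - 1)) \<longlonglongrightarrow> ?c * (T * 0) ^ (DIM('a) - 1)"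
    unfolding h_def by (intro tendsto_intros LIMSEQ_inverse_real_of_nat)
  then have "(\<lambda>k. ennreal (?c * h k ^ (DIM('a) - 1))) \<longlonglongrightarrow> ennreal (?c * (T * 0) ^ (DIM('a) - 1))"
    by (rule tendsto_ennrealI)
  ultimately have "emeasure lborel (sweep e T (cball z d)) \<le> ennreal (?c * (T * 0) ^ (DIM('a) - 1))"
    by (intro LIMSEQ_le_const) auto
  then show ?thesis using True by simp
qed (use emeasure_sweep_cball_pos[of e d T z] assms in auto)

text \<open>The factor in \<open>emeasure_sweep_cball\<close> divided by the normalisation of the
  Hausdorff measure. Multiplied by T and by the weight of a covering set, it gives the volume bound
  for sweeping a ball whose radius is the diameter of that set.\<close>

definition sweep_const :: "'a::euclidean_space itself \<Rightarrow> real" where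
  "sweep_const _ = 2 ^ (DIM('a) + 1) * unit_ball_vol (DIM('a)) * 2 ^ (DIM('a) - 1) / unit_ball_vol (DIM('a) - 1)"

lemma sweep_const_pos: "2 \<le> DIM('a::euclidean_space) \<Longrightarrow> 0 < sweep_const TYPE('a)"
  by (auto simp: sweep_const_def)

lemma ennreal_inverse_mult_cancel:
  assumes "0 < k"
  shows "ennreal (1 / k) * (ennreal k * x) = x" "ennreal k * (ennreal (1 / k) * x) = x"
  using assms by (simp_all add: mult.assoc[symmetric] ennreal_mult'[symmetric])

text \<open>A nonempty covering set of diameter at most \<open>T\<close> lies in the ball about any
  of its points whose radius is that diameter, so sweeping it costs at most \<open>?K\<close> times
  its weight. Coverings of mesh \<open>T\<close> suffice, because \<open>hausdorff_pre T\<close>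
  lies below the outer measure.\<close>

lemma emeasure_sweep_le_hausdorff:
  fixes e :: "'a::euclidean_space"
  assumes e: "norm e = 1" and T: "0 < T" and d: "2 \<le> DIM('a)"
    and S: "S \<subseteq> sweep e T A"
  shows "emeasure lborel S \<le> ennreal (sweep_const TYPE('a) * T) * hausdorff_outer A"
proof -
  let ?K = "sweep_const TYPE('a) * T"
  have K: "0 < ?K" using sweep_const_pos[OF d] T by simp
  \<comment> \<open>The constant is moved to the left so that the infimum over coverings can be used
    directly.\<close>
  have "ennreal (1 / ?K) * emeasure lborel S \<le> hausdorff_pre T A"
    unfolding hausdorff_pre_def
  proof (rule INF_greatest)
    fix U :: "nat \<Rightarrow> 'a set"
    assume "U \<in> {U. A \<subseteq> (\<Union>i. U i) \<and> (\<forall>i. bounded (U i) \<and> diameter (U i) \<le> T)}"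
    then have U: "A \<subseteq> (\<Union>i. U i)" "\<And>i. bounded (U i)" "\<And>i. diameter (U i) \<le> T" by auto
    let ?w = "\<lambda>i. unit_ball_vol (DIM('a) - 1) * (diameter (U i) / 2) ^ (DIM('a) - 1)"
    define Z where "Z = (\<lambda>i. if U i = {} then {} else sweep e T (cball (SOME z. z \<in> U i) (diameter (U i))))"
    have Zs: "Z i \<in> sets lborel" for i
      by (auto simp: Z_def intro!: borel_compact compact_sweep)
    have "S \<subseteq> (\<Union>i. Z i)"
    proof
      fix x assume "x \<in> S"
      then obtain y s where x: "x = y + s *\<^sub>R e" "y \<in> A" "s \<in> {0..T}" using S by (auto simp: sweep_def)
      then obtain i where i: "y \<in> U i" using U(1) by auto
      then have "(SOME z. z \<in> U i) \<in> U i" by (rule someI)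
      then have "y \<in> cball (SOME z. z \<in> U i) (diameter (U i))"
        using diameter_bounded_bound[OF U(2)] i by (simp add: dist_commute)
      then have "x \<in> Z i" using i x by (auto simp: Z_def sweep_def)
      then show "x \<in> (\<Union>i. Z i)" by blast
    qed
    then have "emeasure lborel S \<le> emeasure lborel (\<Union>i. Z i)"
      using Zs by (intro emeasure_mono) auto
    also have "\<dots> \<le> (\<Sum>i. emeasure lborel (Z i))"
      by (rule emeasure_subadditive_countably) (use Zs in auto)
    also have "\<dots> \<le> (\<Sum>i. ennreal ?K * ennreal (?w i))"
    proof (intro suminf_le)
      fix i
      show "emeasure lborel (Z i) \<le> ennreal ?K * ennreal (?w i)"
      proof (cases "U i = {}")
        case False
        have "emeasure lborel (Z i) \<le> ennreal (2 ^ (DIM('a) + 1) * unit_ball_vol (DIM('a)) * T * diameter (U i) ^ (DIM('a) - 1))"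
          using emeasure_sweep_cball[OF e diameter_ge_0[OF U(2)] U(3) T d] False by (simp add: Z_def)
        also have "2 ^ (DIM('a) + 1) * unit_ball_vol (DIM('a)) * T * diameter (U i) ^ (DIM('a) - 1) = ?K * ?w i"
        proof -
          from d have "0 \<le> real DIM('a) - 1" by simp
          then have "unit_ball_vol (real DIM('a) - 1) \<noteq> 0"
            using unit_ball_vol_pos less_irrefl by metis
          then show ?thesis using d by (simp add: sweep_const_def power_divide)
        qed
        also have "ennreal (?K * ?w i) = ennreal ?K * ennreal (?w i)"
          using K U(2) by (intro ennreal_mult) (auto intro!: diameter_ge_0 mult_nonneg_nonneg zero_le_power)
        finally show ?thesis .
      qed (simp add: Z_def)
    qed auto
    finally have "emeasure lborel S \<le> ennreal ?K * (\<Sum>i. ennreal (?w i))" by simp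
    then have "ennreal (1 / ?K) * emeasure lborel S \<le> ennreal (1 / ?K) * (ennreal ?K * (\<Sum>i. ennreal (?w i)))"
      by (rule mult_left_mono) simp
    also have "\<dots> = (\<Sum>i. ennreal (?w i))"
      by (rule ennreal_inverse_mult_cancel(1)[OF K])
    finally show "ennreal (1 / ?K) * emeasure lborel S \<le> (\<Sum>i. ennreal (?w i))" .
  qed
  also have "\<dots> \<le> hausdorff_outer A" by (rule hausdorff_pre_le_outer[OF T])
  finally have "ennreal ?K * (ennreal (1 / ?K) * emeasure lborel S) \<le> ennreal ?K * hausdorff_outer A"
    by (rule mult_left_mono) simp
  then show ?thesis unfolding ennreal_inverse_mult_cancel(2)[OF K] .
qed

lemma sets_hausdorff_measure: "sets hausdorff_measure = sets borel"
  unfolding hausdorff_measure_def using sets.sets_measure_of_eq[of borel] by simp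

text \<open>The image under \<open>Y\<close> of volume on \<open>L\<close> is compared with surface
  measure set by set: the points of \<open>L\<close> with foot in \<open>A\<close> are swept out
  from \<open>A \<inter> frontier \<Omega>\<close>. The inequality of measures passes to integrals
  and replaces a change of variables in charts.\<close>

lemma nn_integral_foot_point_le:
  fixes Y :: "'a::euclidean_space \<Rightarrow> 'a" and g :: "'a \<Rightarrow> ennreal"
  assumes e: "norm e = 1" and T: "0 < T" and d: "2 \<le> DIM('a)"
    and Y: "Y \<in> borel_measurable borel" and L: "L \<in> sets borel" and g: "g \<in> borel_measurable borel"
    and foot: "\<And>x. x \<in> L \<Longrightarrow> Y x \<in> frontier \<Omega> \<and> x \<in> sweep e T {Y x}"
  shows "(\<integral>\<^sup>+x. g (Y x) * indicator L x \<partial>lborel)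
    \<le> ennreal (sweep_const TYPE('a) * T) * (\<integral>\<^sup>+x. g x \<partial>surface \<Omega>)"
proof -
  let ?K = "ennreal (sweep_const TYPE('a) * T)"
  let ?F = "frontier \<Omega>"
  define N where "N = distr (density lborel (indicator L)) borel Y"
  define H where "H = scale_measure ?K (density hausdorff_measure (indicator ?F))"
  have F: "?F \<in> sets borel" by (intro borel_closed frontier_closed)
  have sN: "sets N = sets borel" by (simp add: N_def)
  have sH: "sets H = sets borel" by (simp add: H_def sets_hausdorff_measure)
  have Ym: "Y \<in> measurable (density lborel (indicator L)) borel" using Y by simp
  have mH: "measurable hausdorff_measure (borel :: ennreal measure) = measurable borel borel"
    by (rule measurable_cong_sets) (auto simp: sets_hausdorff_measure)
  have indF: "(indicator ?F :: 'a \<Rightarrow> ennreal) \<in> borel_measurable hausdorff_measure"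
    unfolding mH using F by simp
  have "N \<le> H"
  proof (rule less_eq_measure.intros(3))
    show "space N = space H" using sN sH by (metis sets_eq_imp_space_eq)
    show "sets N = sets H" using sN sH by simp
    show "emeasure N \<le> emeasure H"
    proof (rule le_funI)
      fix A
      show "emeasure N A \<le> emeasure H A"
      proof (cases "A \<in> sets borel")
        case True
        have YA: "Y -` A \<in> sets borel" using measurable_sets[OF Y True] by simp
        have "emeasure N A = emeasure (density lborel (indicator L)) (Y -` A)"
          unfolding N_def using Ym True by (simp add: emeasure_distr)
        also have "\<dots> = emeasure lborel (L \<inter> Y -` A)"
          using YA L by (subst emeasure_density) (auto simp flip: indicator_inter_arith nn_integral_indicator)
        also have "\<dots> \<le> ?K * hausdorff_outer (A \<inter> ?F)"
          by (rule emeasure_sweep_le_hausdorff[OF e T d]) (use foot in \<open>fastforce simp: sweep_def\<close>)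
        also have "hausdorff_outer (A \<inter> ?F) = emeasure hausdorff_measure (A \<inter> ?F)"
          using True F by (intro emeasure_hausdorff_measure[OF d, symmetric]) auto
        also have "\<dots> = emeasure (density hausdorff_measure (indicator ?F)) A"
          using True F indF
          by (subst emeasure_density)
            (auto simp: sets_hausdorff_measure nn_integral_indicator Int_commute simp flip: indicator_inter_arith)
        finally show ?thesis by (simp add: H_def)
      qed (simp add: emeasure_notin_sets sN)
    qed
  qed
  then have "nn_integral N g \<le> nn_integral H g"
    using sN sH by (intro nn_integral_mono_measure) auto
  also have "nn_integral N g = (\<integral>\<^sup>+x. g (Y x) \<partial>density lborel (indicator L))"
    unfolding N_def by (rule nn_integral_distr[OF Ym]) (use g in simp)
  also have "\<dots> = (\<integral>\<^sup>+x. g (Y x) * indicator L x \<partial>lborel)"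
    using L measurable_compose[OF Y g] by (subst nn_integral_density) (auto simp: mult.commute)
  also have "nn_integral H g = ?K * (\<integral>\<^sup>+x. indicator ?F x * g x \<partial>hausdorff_measure)"
    unfolding H_def using g indF mH
    by (subst nn_integral_scale_measure) (auto simp: nn_integral_density cong: measurable_cong_sets)
  also have "(\<integral>\<^sup>+x. indicator ?F x * g x \<partial>hausdorff_measure) = (\<integral>\<^sup>+x. g x \<partial>surface \<Omega>)"
    unfolding surface_def using F
    by (subst nn_integral_restrict_space) (auto simp: sets_hausdorff_measure mult.commute sets_eq_imp_space_eq[OF sets_hausdorff_measure])
  finally show ?thesis .
qed

section \<open>Increments along segments\<close>

definition grad_sq :: "('a::euclidean_space \<Rightarrow> complex) \<Rightarrow> 'a \<Rightarrow> real" where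
  "grad_sq \<phi> z = (\<Sum>b\<in>Basis. (cmod (dderiv b \<phi> z))\<^sup>2)"

lemma smooth_grad_sq_measurable: "smooth \<phi> \<Longrightarrow> grad_sq \<phi> \<in> borel_measurable borel"
  unfolding grad_sq_def
  by (intro borel_measurable_continuous_onI continuous_intros smooth_continuous smooth_dderiv)

lemma dderiv_sum_Basis:
  fixes \<phi> :: "'a::euclidean_space \<Rightarrow> complex"
  assumes "\<phi> differentiable (at z)"
  shows "dderiv v \<phi> z = (\<Sum>b\<in>Basis. of_real (v \<bullet> b) * dderiv b \<phi> z)"
proof -
  have l: "linear (\<lambda>b. dderiv b \<phi> z)"
    by (rule has_derivative_linear[OF differentiable_has_derivative[OF assms]])
  have "dderiv v \<phi> z = dderiv (\<Sum>b\<in>Basis. (v \<bullet> b) *\<^sub>R b) \<phi> z" by (simp add: euclidean_representation)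
  also have "\<dots> = (\<Sum>b\<in>Basis. (v \<bullet> b) *\<^sub>R dderiv b \<phi> z)"
    using linear_sum[OF l, of "\<lambda>b. (v \<bullet> b) *\<^sub>R b" Basis] linear_scale[OF l] by simp
  finally show ?thesis by (simp add: scaleR_conv_of_real)
qed

lemma dderiv_continuous:
  fixes \<phi> :: "'a::euclidean_space \<Rightarrow> complex"
  assumes "smooth \<phi>"
  shows "continuous_on S (dderiv v \<phi>)"
proof -
  have "dderiv v \<phi> = (\<lambda>z. \<Sum>b\<in>Basis. of_real (v \<bullet> b) * dderiv b \<phi> z)"
    using dderiv_sum_Basis[OF smooth_differentiable[OF assms]] by blast
  then show ?thesis
    by (simp only:) (intro continuous_intros smooth_continuous smooth_dderiv assms)
qed

lemma dderiv_sq_le_grad_sq: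
  fixes \<phi> :: "'a::euclidean_space \<Rightarrow> complex"
  assumes "smooth \<phi>" "norm v = 1"
  shows "(cmod (dderiv v \<phi> z))\<^sup>2 \<le> grad_sq \<phi> z"
proof -
  have "cmod (dderiv v \<phi> z) \<le> (\<Sum>b\<in>Basis. \<bar>v \<bullet> b\<bar> * cmod (dderiv b \<phi> z))"
    unfolding dderiv_sum_Basis[OF smooth_differentiable[OF assms(1)], of v]
    by (rule order_trans[OF norm_sum]) (simp add: norm_mult)
  then have "(cmod (dderiv v \<phi> z))\<^sup>2 \<le> (\<Sum>b\<in>Basis. \<bar>v \<bullet> b\<bar> * cmod (dderiv b \<phi> z))\<^sup>2"
    by (intro power_mono) auto
  also have "\<dots> \<le> (\<Sum>b\<in>Basis. \<bar>v \<bullet> b\<bar>\<^sup>2) * (\<Sum>b\<in>Basis. (cmod (dderiv b \<phi> z))\<^sup>2)"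
    by (rule Cauchy_Schwarz_ineq_sum)
  also have "(\<Sum>b\<in>Basis. \<bar>v \<bullet> b\<bar>\<^sup>2) = v \<bullet> v"
    by (subst euclidean_inner) (simp add: power2_eq_square)
  also have "v \<bullet> v = 1" using assms(2) by (simp add: dot_square_norm)
  finally show ?thesis by (simp add: grad_sq_def)
qed

text \<open>The fundamental theorem of calculus along the segment, then Cauchy-Schwarz against the
  indicator of \<open>{0..s}\<close>, whose squared norm is \<open>s\<close>.\<close>

lemma line_increment_sq:
  fixes \<phi> :: "'a::euclidean_space \<Rightarrow> complex"
  assumes "smooth \<phi>" "0 \<le> s"
  shows "ennreal ((cmod (\<phi> (x + s *\<^sub>R v) - \<phi> x))\<^sup>2)
    \<le> ennreal s * (\<integral>\<^sup>+\<sigma>. ennreal ((cmod (dderiv v \<phi> (x + \<sigma> *\<^sub>R v)))\<^sup>2) * indicator {0..s} \<sigma> \<partial>lborel)"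
proof -
  define G where "G = (\<lambda>\<sigma>. dderiv v \<phi> (x + \<sigma> *\<^sub>R v))"
  have cG: "continuous_on A G" for A
    unfolding G_def by (rule continuous_on_compose2[OF dderiv_continuous[OF assms(1), of UNIV]])
      (auto intro!: continuous_intros)
  have mG: "G \<in> borel_measurable lborel" using borel_measurable_continuous_onI[OF cG] by simp
  have "((\<lambda>\<sigma>. \<phi> (x + \<sigma> *\<^sub>R v)) has_vector_derivative G \<sigma>) (at \<sigma> within {0..s})" for \<sigma>
    unfolding G_def by (rule has_vector_derivative_line[OF smooth_differentiable[OF assms(1)]])
  from has_bochner_integral_FTC_Icc[OF assms(2) this cG]
  have "has_bochner_integral lborel (\<lambda>\<sigma>. indicator {0..s} \<sigma> *\<^sub>R G \<sigma>) (\<phi> (x + s *\<^sub>R v) - \<phi> (x + 0 *\<^sub>R v))" .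
  then have I: "integrable lborel (\<lambda>\<sigma>. indicator {0..s} \<sigma> *\<^sub>R G \<sigma>)"
    "(LINT \<sigma>|lborel. indicator {0..s} \<sigma> *\<^sub>R G \<sigma>) = \<phi> (x + s *\<^sub>R v) - \<phi> x"
    by (auto simp: has_bochner_integral_iff)
  let ?u = "\<lambda>\<sigma>. indicator {0..s} \<sigma> :: complex"
  have 1: "(\<integral>\<^sup>+\<sigma>. ennreal (cmod (indicator {0..s} \<sigma> *\<^sub>R G \<sigma>)) \<partial>lborel)
      = (\<integral>\<^sup>+\<sigma>. ennreal (cmod (?u \<sigma> * (?u \<sigma> * G \<sigma>))) \<partial>lborel)"
    by (rule nn_integral_cong) (auto simp: indicator_def)
  have 2: "L2_sq lborel ?u = ennreal s"
  proof -
    have "L2_sq lborel ?u = (\<integral>\<^sup>+\<sigma>. indicator {0..s} \<sigma> \<partial>lborel)"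
      unfolding L2_sq_def by (rule nn_integral_cong) (auto simp: indicator_def)
    then show ?thesis using assms(2) by simp
  qed
  have 3: "L2_sq lborel (\<lambda>\<sigma>. ?u \<sigma> * G \<sigma>) = (\<integral>\<^sup>+\<sigma>. ennreal ((cmod (G \<sigma>))\<^sup>2) * indicator {0..s} \<sigma> \<partial>lborel)"
    unfolding L2_sq_def by (rule nn_integral_cong) (auto simp: indicator_def)
  have mu: "?u \<in> borel_measurable lborel" by simp
  have "ennreal ((cmod (\<phi> (x + s *\<^sub>R v) - \<phi> x))\<^sup>2) = (ennreal (cmod (\<phi> (x + s *\<^sub>R v) - \<phi> x)))\<^sup>2"
    by (simp add: ennreal_power)
  also have "\<dots> \<le> (\<integral>\<^sup>+\<sigma>. ennreal (cmod (indicator {0..s} \<sigma> *\<^sub>R G \<sigma>)) \<partial>lborel)\<^sup>2"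
    using integral_norm_bound_ennreal[OF I(1)] unfolding I(2) by (intro power_mono) auto
  also have "\<dots> \<le> L2_sq lborel ?u * L2_sq lborel (\<lambda>\<sigma>. ?u \<sigma> * G \<sigma>)"
    unfolding 1 by (rule cauchy_schwarz_L2_nn[OF mu borel_measurable_times[OF mu mG]])
  finally show ?thesis unfolding 2 3 by (simp add: G_def)
qed

text \<open>Tonelli and the translation z = x + \<sigma> v. The average over the segment moves from
  \<open>g\<close> to \<open>f\<close>; with \<open>f\<close> an indicator, the inner integral
  becomes a length that can be bounded uniformly.\<close>

lemma nn_integral_line_average:
  fixes f :: "'a::euclidean_space \<Rightarrow> ennreal" and g :: "'a \<Rightarrow> ennreal"
  assumes f: "f \<in> borel_measurable borel" and g: "g \<in> borel_measurable borel"
  shows "(\<integral>\<^sup>+x. f x * (\<integral>\<^sup>+\<sigma>. g (x + \<sigma> *\<^sub>R v) * indicator {0..T} \<sigma> \<partial>lborel) \<partial>lborel)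
    = (\<integral>\<^sup>+z. g z * (\<integral>\<^sup>+\<sigma>. f (z - \<sigma> *\<^sub>R v) * indicator {0..T} \<sigma> \<partial>lborel) \<partial>lborel)"
proof -
  have m1: "(\<lambda>(x, \<sigma>). x + \<sigma> *\<^sub>R v) \<in> borel_measurable (lborel \<Otimes>\<^sub>M lborel)"
    "(\<lambda>(x, \<sigma>). x - \<sigma> *\<^sub>R v) \<in> borel_measurable (lborel \<Otimes>\<^sub>M lborel)" by measurable
  have mg: "(\<lambda>(x, \<sigma>). g (x + \<sigma> *\<^sub>R v)) \<in> borel_measurable (lborel \<Otimes>\<^sub>M lborel)"
    using measurable_compose[OF m1(1) g] by (simp add: case_prod_beta)
  have mf: "(\<lambda>(x, \<sigma>). f (x - \<sigma> *\<^sub>R v)) \<in> borel_measurable (lborel \<Otimes>\<^sub>M lborel)"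
    using measurable_compose[OF m1(2) f] by (simp add: case_prod_beta)
  have mi: "(\<lambda>(x :: 'a, \<sigma> :: real). indicator {0..T} \<sigma> :: ennreal) \<in> borel_measurable (lborel \<Otimes>\<^sub>M lborel)" by measurable
  have mf1: "(\<lambda>(x, \<sigma> :: real). f x) \<in> borel_measurable (lborel \<Otimes>\<^sub>M lborel)"
    using f by (simp add: case_prod_beta)
  have mg1: "(\<lambda>(x, \<sigma> :: real). g x) \<in> borel_measurable (lborel \<Otimes>\<^sub>M lborel)"
    using g by (simp add: case_prod_beta)
  have P: "(\<lambda>(x, \<sigma>). f x * (g (x + \<sigma> *\<^sub>R v) * indicator {0..T} \<sigma>)) \<in> borel_measurable (lborel \<Otimes>\<^sub>M lborel)"
    using borel_measurable_times_ennreal[OF mf1 borel_measurable_times_ennreal[OF mg mi]] by (simp add: case_prod_beta)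
  have Q: "(\<lambda>(x, \<sigma>). g x * (f (x - \<sigma> *\<^sub>R v) * indicator {0..T} \<sigma>)) \<in> borel_measurable (lborel \<Otimes>\<^sub>M lborel)"
    using borel_measurable_times_ennreal[OF mg1 borel_measurable_times_ennreal[OF mf mi]] by (simp add: case_prod_beta)
  have sec: "(\<lambda>\<sigma>. g (x + \<sigma> *\<^sub>R v) * indicator {0..T} \<sigma>) \<in> borel_measurable lborel"
    "(\<lambda>\<sigma>. f (x - \<sigma> *\<^sub>R v) * indicator {0..T} \<sigma>) \<in> borel_measurable lborel" for x
  proof -
    have "(\<lambda>\<sigma>. x + \<sigma> *\<^sub>R v) \<in> borel_measurable lborel" "(\<lambda>\<sigma>. x - \<sigma> *\<^sub>R v) \<in> borel_measurable lborel" by measurable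
    from measurable_compose[OF this(1) g] measurable_compose[OF this(2) f]
    show "(\<lambda>\<sigma>. g (x + \<sigma> *\<^sub>R v) * indicator {0..T} \<sigma>) \<in> borel_measurable lborel"
      "(\<lambda>\<sigma>. f (x - \<sigma> *\<^sub>R v) * indicator {0..T} \<sigma>) \<in> borel_measurable lborel"
      by (auto intro!: borel_measurable_times_ennreal)
  qed
  have "(\<integral>\<^sup>+x. f x * (\<integral>\<^sup>+\<sigma>. g (x + \<sigma> *\<^sub>R v) * indicator {0..T} \<sigma> \<partial>lborel) \<partial>lborel)
      = (\<integral>\<^sup>+x. \<integral>\<^sup>+\<sigma>. f x * (g (x + \<sigma> *\<^sub>R v) * indicator {0..T} \<sigma>) \<partial>lborel \<partial>lborel)"
    using sec by (simp add: nn_integral_cmult)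
  also have "\<dots> = (\<integral>\<^sup>+\<sigma>. \<integral>\<^sup>+x. f x * (g (x + \<sigma> *\<^sub>R v) * indicator {0..T} \<sigma>) \<partial>lborel \<partial>lborel)"
    by (rule lborel_pair.Fubini'[OF P, symmetric])
  also have "\<dots> = (\<integral>\<^sup>+\<sigma>. \<integral>\<^sup>+z. g z * (f (z - \<sigma> *\<^sub>R v) * indicator {0..T} \<sigma>) \<partial>lborel \<partial>lborel)"
  proof (rule nn_integral_cong)
    fix \<sigma>
    have "(\<lambda>z. z - \<sigma> *\<^sub>R v) \<in> borel_measurable borel" by measurable
    from measurable_compose[OF this f]
    have "(\<lambda>z. g z * (f (z - \<sigma> *\<^sub>R v) * indicator {0..T} \<sigma>)) \<in> borel_measurable borel"
      using g by (intro borel_measurable_times_ennreal) auto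
    from nn_integral_lborel_translation[OF this, of "\<sigma> *\<^sub>R v"]
    show "(\<integral>\<^sup>+x. f x * (g (x + \<sigma> *\<^sub>R v) * indicator {0..T} \<sigma>) \<partial>lborel)
        = (\<integral>\<^sup>+z. g z * (f (z - \<sigma> *\<^sub>R v) * indicator {0..T} \<sigma>) \<partial>lborel)"
      by (simp add: mult.left_commute)
  qed
  also have "\<dots> = (\<integral>\<^sup>+z. \<integral>\<^sup>+\<sigma>. g z * (f (z - \<sigma> *\<^sub>R v) * indicator {0..T} \<sigma>) \<partial>lborel \<partial>lborel)"
    by (rule lborel_pair.Fubini'[OF Q])
  also have "\<dots> = (\<integral>\<^sup>+z. g z * (\<integral>\<^sup>+\<sigma>. f (z - \<sigma> *\<^sub>R v) * indicator {0..T} \<sigma> \<partial>lborel) \<partial>lborel)"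
    using sec by (simp add: nn_integral_cmult)
  finally show ?thesis .
qed

section \<open>The boundary layer estimate\<close>

definition layer :: "'a::euclidean_space set \<Rightarrow> real \<Rightarrow> 'a set" where
  "layer \<Omega> t = {x \<in> \<Omega>. infdist x (frontier \<Omega>) \<le> t}"

lemma layer_measurable: "open \<Omega> \<Longrightarrow> layer \<Omega> t \<in> sets borel"
proof -
  assume "open \<Omega>"
  have "closed {x. infdist x (frontier \<Omega>) \<le> t}"
    by (intro closed_Collect_le continuous_intros)
  moreover have "layer \<Omega> t = \<Omega> \<inter> {x. infdist x (frontier \<Omega>) \<le> t}" by (auto simp: layer_def)
  ultimately show ?thesis using \<open>open \<Omega>\<close> by (simp add: borel_open borel_closed sets.Int)
qed

text \<open>\<open>Y x\<close> is the boundary point reached from \<open>x\<close> in direction \<open>- e\<close>, through points of \<open>L'\<close>.\<close>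

definition foot_along :: "'a::euclidean_space set \<Rightarrow> 'a \<Rightarrow> real \<Rightarrow> 'a set \<Rightarrow> ('a \<Rightarrow> 'a) \<Rightarrow> 'a \<Rightarrow> bool" where
  "foot_along \<Omega> e T L' Y x \<longleftrightarrow> Y x \<in> frontier \<Omega> \<and>
     (\<exists>s\<in>{0..T}. x = Y x + s *\<^sub>R e \<and> (\<forall>\<sigma>\<in>{0..<s}. x - \<sigma> *\<^sub>R e \<in> L'))"

text \<open>Compare the value at \<open>x\<close> with that at the foot; the increment is controlled
  by the gradient along the connecting segment, which runs inside \<open>L'\<close>.\<close>

lemma foot_pointwise:
  fixes \<phi> :: "'a::euclidean_space \<Rightarrow> complex"
  assumes \<phi>: "smooth \<phi>" and e: "norm e = 1" and T: "0 < T" and foot: "foot_along \<Omega> e T L' Y x"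
    and L': "L' \<in> sets borel"
  shows "ennreal ((cmod (\<phi> x))\<^sup>2) \<le> 2 * ennreal ((cmod (\<phi> (Y x)))\<^sup>2) + 2 * (ennreal T *
     (\<integral>\<^sup>+\<sigma>. (ennreal (grad_sq \<phi> (x + \<sigma> *\<^sub>R (-e))) * indicator L' (x + \<sigma> *\<^sub>R (-e))) * indicator {0..T} \<sigma> \<partial>lborel))"
    (is "_ \<le> _ + 2 * (ennreal T * ?I)")
proof -
  obtain s where s: "0 \<le> s" "s \<le> T" "x = Y x + s *\<^sub>R e" "\<And>\<sigma>. 0 \<le> \<sigma> \<Longrightarrow> \<sigma> < s \<Longrightarrow> x - \<sigma> *\<^sub>R e \<in> L'"
    using foot unfolding foot_along_def by auto
  have Yx: "x + s *\<^sub>R (-e) = Y x" by (subst s(3)) simp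
  have "(cmod (\<phi> x))\<^sup>2 \<le> 2 * (cmod (\<phi> (Y x)))\<^sup>2 + 2 * (cmod (\<phi> (x + s *\<^sub>R (-e)) - \<phi> x))\<^sup>2"
    using cmod_add_sq[of "\<phi> (Y x)" "\<phi> x - \<phi> (Y x)"] unfolding Yx by (simp add: norm_minus_commute)
  from ennreal_leI[OF this]
  have "ennreal ((cmod (\<phi> x))\<^sup>2) \<le> 2 * ennreal ((cmod (\<phi> (Y x)))\<^sup>2) + 2 * ennreal ((cmod (\<phi> (x + s *\<^sub>R (-e)) - \<phi> x))\<^sup>2)"
    by (simp add: ennreal_mult)
  also have "\<dots> \<le> 2 * ennreal ((cmod (\<phi> (Y x)))\<^sup>2) + 2 * (ennreal T * ?I)"
  proof (intro add_left_mono mult_left_mono)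
    have "ennreal ((cmod (\<phi> (x + s *\<^sub>R (-e)) - \<phi> x))\<^sup>2) \<le> ennreal s *
      (\<integral>\<^sup>+\<sigma>. ennreal ((cmod (dderiv (-e) \<phi> (x + \<sigma> *\<^sub>R (-e))))\<^sup>2) * indicator {0..s} \<sigma> \<partial>lborel)"
      by (rule line_increment_sq[OF \<phi> s(1)])
    also have "\<dots> \<le> ennreal T * ?I"
    proof (rule mult_mono)
      show "ennreal s \<le> ennreal T" using s(2) by (rule ennreal_leI)
      show "(\<integral>\<^sup>+\<sigma>. ennreal ((cmod (dderiv (-e) \<phi> (x + \<sigma> *\<^sub>R (-e))))\<^sup>2) * indicator {0..s} \<sigma> \<partial>lborel) \<le> ?I"
      proof (rule nn_integral_mono_AE)
        \<comment> \<open>At \<sigma> = s the point is the foot itself, about which membership in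
          \<open>L'\<close> is not known; a single parameter is a null set.\<close>
        have "AE \<sigma> in lborel. \<sigma> \<noteq> s" by (rule AE_lborel_singleton)
        then show "AE \<sigma> in lborel. ennreal ((cmod (dderiv (-e) \<phi> (x + \<sigma> *\<^sub>R (-e))))\<^sup>2) * indicator {0..s} \<sigma>
          \<le> (ennreal (grad_sq \<phi> (x + \<sigma> *\<^sub>R (-e))) * indicator L' (x + \<sigma> *\<^sub>R (-e))) * indicator {0..T} \<sigma>"
        proof eventually_elim
          case (elim \<sigma>)
          show ?case
          proof (cases "\<sigma> \<in> {0..s}")
            case True
            then have "x + \<sigma> *\<^sub>R (-e) \<in> L'" "\<sigma> \<in> {0..T}" using s(2) s(4)[of \<sigma>] elim by auto
            moreover have "ennreal ((cmod (dderiv (-e) \<phi> (x + \<sigma> *\<^sub>R (-e))))\<^sup>2) \<le> ennreal (grad_sq \<phi> (x + \<sigma> *\<^sub>R (-e)))"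
              by (rule ennreal_leI, rule dderiv_sq_le_grad_sq[OF \<phi>]) (use e in simp)
            ultimately show ?thesis using True by simp
          qed simp
        qed
      qed
    qed auto
    finally show "ennreal ((cmod (\<phi> (x + s *\<^sub>R (-e)) - \<phi> x))\<^sup>2) \<le> ennreal T * ?I" .
  qed auto
  finally show ?thesis .
qed

text \<open>\<open>foot_pointwise\<close> is integrated over \<open>L\<close>. In the gradient term
  one factor \<open>T\<close> comes from Cauchy-Schwarz on the segment, the other from exchanging
  integrals: each point is hit from \<open>L\<close> for parameters in a set of length at most
  \<open>T\<close>.\<close>

lemma foot_estimate:
  fixes \<phi> :: "'a::euclidean_space \<Rightarrow> complex"
  assumes \<phi>: "smooth \<phi>" and e: "norm e = 1" and T: "0 < T" and d: "2 \<le> DIM('a)"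
    and Y: "Y \<in> borel_measurable borel" and L: "L \<in> sets borel" and L': "L' \<in> sets borel"
    and foot: "\<And>x. x \<in> L \<Longrightarrow> foot_along \<Omega> e T L' Y x"
  shows "(\<integral>\<^sup>+x. ennreal ((cmod (\<phi> x))\<^sup>2) * indicator L x \<partial>lborel)
    \<le> ennreal (2 * sweep_const TYPE('a) * T) * L2_sq (surface \<Omega>) \<phi>
      + ennreal (2 * T\<^sup>2) * (\<integral>\<^sup>+x. ennreal (grad_sq \<phi> x) * indicator L' x \<partial>lborel)"
proof -
  define g where "g = (\<lambda>z. ennreal (grad_sq \<phi> z) * indicator L' z)"
  define q where "q = (\<lambda>z. ennreal ((cmod (\<phi> z))\<^sup>2))"
  define I where "I = (\<lambda>x. \<integral>\<^sup>+\<sigma>. g (x + \<sigma> *\<^sub>R (-e)) * indicator {0..T} \<sigma> \<partial>lborel)"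
  have g: "g \<in> borel_measurable borel"
    unfolding g_def using smooth_grad_sq_measurable[OF \<phi>] L' by simp
  have q: "q \<in> borel_measurable borel"
    unfolding q_def using smooth_measurable[OF \<phi>] by simp
  have iL: "(indicator L :: 'a \<Rightarrow> ennreal) \<in> borel_measurable borel" using L by simp
  have I: "I \<in> borel_measurable lborel"
  proof -
    have "(\<lambda>(x, \<sigma>). x + \<sigma> *\<^sub>R (-e)) \<in> borel_measurable (lborel \<Otimes>\<^sub>M lborel)" by measurable
    from measurable_compose[OF this g]
    have "(\<lambda>(x, \<sigma>). g (x + \<sigma> *\<^sub>R (-e)) * indicator {0..T} \<sigma>) \<in> borel_measurable (lborel \<Otimes>\<^sub>M lborel)"
      by (auto simp: case_prod_beta intro!: borel_measurable_times_ennreal)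
    then show ?thesis unfolding I_def by (rule lborel.borel_measurable_nn_integral)
  qed
  have qY: "(\<lambda>x. q (Y x)) \<in> borel_measurable borel" by (rule measurable_compose[OF Y q])
  have "(\<integral>\<^sup>+x. q x * indicator L x \<partial>lborel)
      \<le> (\<integral>\<^sup>+x. 2 * (q (Y x) * indicator L x) + 2 * ennreal T * (indicator L x * I x) \<partial>lborel)"
  proof (rule nn_integral_mono)
    fix x
    show "q x * indicator L x \<le> 2 * (q (Y x) * indicator L x) + 2 * ennreal T * (indicator L x * I x)"
      using foot_pointwise[OF \<phi> e T foot L', of x]
      by (cases "x \<in> L") (auto simp: q_def I_def g_def mult.assoc)
  qed
  also have "\<dots> = 2 * (\<integral>\<^sup>+x. q (Y x) * indicator L x \<partial>lborel) + 2 * ennreal T * (\<integral>\<^sup>+x. indicator L x * I x \<partial>lborel)"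
    using qY iL I by (simp add: nn_integral_add nn_integral_cmult)
  also have "\<dots> \<le> 2 * (ennreal (sweep_const TYPE('a) * T) * L2_sq (surface \<Omega>) \<phi>)
      + 2 * ennreal T * (ennreal T * (\<integral>\<^sup>+x. g x \<partial>lborel))"
  proof (intro add_mono mult_left_mono)
    have "Y x \<in> frontier \<Omega> \<and> x \<in> sweep e T {Y x}" if "x \<in> L" for x
      using foot[OF that] unfolding foot_along_def sweep_def by blast
    from nn_integral_foot_point_le[OF e T d Y L q this]
    show "(\<integral>\<^sup>+x. q (Y x) * indicator L x \<partial>lborel) \<le> ennreal (sweep_const TYPE('a) * T) * L2_sq (surface \<Omega>) \<phi>"
      by (simp add: L2_sq_def q_def)
    have "(\<integral>\<^sup>+x. indicator L x * I x \<partial>lborel)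
        = (\<integral>\<^sup>+z. g z * (\<integral>\<^sup>+\<sigma>. indicator L (z - \<sigma> *\<^sub>R (-e)) * indicator {0..T} \<sigma> \<partial>lborel) \<partial>lborel)"
      unfolding I_def by (rule nn_integral_line_average[OF iL g])
    also have "\<dots> \<le> (\<integral>\<^sup>+z. g z * ennreal T \<partial>lborel)"
    proof (intro nn_integral_mono mult_left_mono)
      fix z
      have "(\<integral>\<^sup>+\<sigma>. indicator L (z - \<sigma> *\<^sub>R (-e)) * indicator {0..T} \<sigma> \<partial>lborel) \<le> (\<integral>\<^sup>+\<sigma>. indicator {0..T} \<sigma> \<partial>lborel)"
        by (rule nn_integral_mono) (auto simp: indicator_def)
      then show "(\<integral>\<^sup>+\<sigma>. indicator L (z - \<sigma> *\<^sub>R (-e)) * indicator {0..T} \<sigma> \<partial>lborel) \<le> ennreal T"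
        using T by simp
    qed auto
    also have "\<dots> = ennreal T * (\<integral>\<^sup>+x. g x \<partial>lborel)"
      using nn_integral_multc[of g lborel "ennreal T"] g by (simp add: mult.commute)
    finally show "(\<integral>\<^sup>+x. indicator L x * I x \<partial>lborel) \<le> ennreal T * (\<integral>\<^sup>+x. g x \<partial>lborel)" .
  qed auto
  also have "2 * (ennreal (sweep_const TYPE('a) * T) * L2_sq (surface \<Omega>) \<phi>)
      = ennreal (2 * sweep_const TYPE('a) * T) * L2_sq (surface \<Omega>) \<phi>"
    using T sweep_const_pos[OF d] by (simp add: ennreal_mult mult.assoc)
  also have "2 * ennreal T * (ennreal T * (\<integral>\<^sup>+x. g x \<partial>lborel)) = ennreal (2 * T\<^sup>2) * (\<integral>\<^sup>+x. g x \<partial>lborel)"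
    using T by (simp add: ennreal_mult power2_eq_square mult.assoc)
  finally show ?thesis unfolding q_def g_def .
qed

text \<open>In the chart \<open>g\<close> is the height above the graph and \<open>Y\<close> the
  projection along \<open>e\<close> onto it. Being (1 + L)-Lipschitz and zero on the frontier,
  \<open>g\<close> is at most \<open>M * t\<close> within distance \<open>t\<close> of it. Hence the
  descent along -e reaches the frontier after length \<open>g x\<close>, inside the layer of width
  \<open>M * t\<close>.\<close>

lemma lipschitz_boundary_feet:
  fixes \<Omega> :: "'a::euclidean_space set"
  assumes op: "open \<Omega>" and lip: "lipschitz_boundary \<Omega>" and p: "p \<in> frontier \<Omega>"
  shows "\<exists>\<rho>>0. \<exists>t\<^sub>0>0. \<exists>M>0. \<exists>e Y. norm e = 1 \<and> Y \<in> borel_measurable borel \<and>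
    (\<forall>t x. 0 < t \<longrightarrow> t < t\<^sub>0 \<longrightarrow> x \<in> layer \<Omega> t \<longrightarrow> dist p x < \<rho> \<longrightarrow> foot_along \<Omega> e (M * t) (layer \<Omega> (M * t)) Y x)"
proof -
  from lip p obtain e r h L \<gamma> where e: "norm e = 1" and r: "0 < r" and h: "0 < h"
    and \<gamma>: "L-lipschitz_on {y. y \<bullet> e = 0} \<gamma>"
    and graph: "\<And>x. norm ((x - p) - ((x - p) \<bullet> e) *\<^sub>R e) < r \<Longrightarrow> \<bar>(x - p) \<bullet> e\<bar> < h \<Longrightarrow>
             (x \<in> \<Omega> \<longleftrightarrow> \<gamma> ((x - p) - ((x - p) \<bullet> e) *\<^sub>R e) < (x - p) \<bullet> e)"
    unfolding lipschitz_boundary_def by blast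
  define c where "c = (\<lambda>x. (x - p) \<bullet> e)"
  define P where "P = (\<lambda>x. (x - p) - c x *\<^sub>R e)"
  define g where "g = (\<lambda>x. c x - \<gamma> (P x))"
  define Cyl where "Cyl = {x. norm (P x) < r \<and> \<bar>c x\<bar> < h}"
  have L0: "0 \<le> L" using \<gamma> by (rule lipschitz_on_nonneg)
  have ee: "e \<bullet> e = 1" using e by (simp add: dot_square_norm)
  have Pe: "P x \<bullet> e = 0" for x by (simp add: P_def c_def inner_diff_left ee)
  have \<Omega>: "x \<in> \<Omega> \<longleftrightarrow> 0 < g x" if "x \<in> Cyl" for x
    using graph[of x] that by (auto simp: Cyl_def P_def c_def g_def)
  have Pd: "norm (P x - P z) \<le> norm (x - z)" for x z
  proof -
    have "P x - P z = (x - z) - ((x - z) \<bullet> e) *\<^sub>R e" by (simp add: P_def c_def algebra_simps)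
    moreover have "(norm ((x - z) - ((x - z) \<bullet> e) *\<^sub>R e))\<^sup>2 = (norm (x - z))\<^sup>2 - ((x - z) \<bullet> e)\<^sup>2"
      unfolding power2_norm_eq_inner using ee
      by (simp add: inner_diff_left inner_diff_right inner_commute power2_eq_square)
    ultimately have "(norm (P x - P z))\<^sup>2 \<le> (norm (x - z))\<^sup>2" by simp
    then show ?thesis by (simp add: power2_le_iff_abs_le)
  qed
  have cd: "\<bar>c x - c z\<bar> \<le> norm (x - z)" for x z
  proof -
    have "c x - c z = (x - z) \<bullet> e" by (simp add: c_def algebra_simps)
    then show ?thesis using Cauchy_Schwarz_ineq2[of "x - z" e] e by simp
  qed
  have \<gamma>d: "\<bar>\<gamma> (P x) - \<gamma> (P z)\<bar> \<le> L * norm (x - z)" for x z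
  proof -
    have "dist (\<gamma> (P x)) (\<gamma> (P z)) \<le> L * dist (P x) (P z)"
      by (rule lipschitz_onD[OF \<gamma>]) (auto simp: Pe)
    also have "\<dots> \<le> L * norm (x - z)" using Pd[of x z] L0 by (intro mult_left_mono) (auto simp: dist_norm)
    finally show ?thesis by (simp add: dist_real_def)
  qed
  have gd: "\<bar>g x - g z\<bar> \<le> (1 + L) * norm (x - z)" for x z
    using cd[of x z] \<gamma>d[of x z] unfolding g_def by (simp add: algebra_simps)
  have cont_c: "continuous_on UNIV c" unfolding c_def by (intro continuous_intros)
  have cont_P: "continuous_on UNIV P" unfolding P_def by (intro continuous_intros cont_c)
  have cont_g: "continuous_on UNIV g"
  proof -
    have "(1 + L)-lipschitz_on UNIV g"
      by (rule lipschitz_onI) (use gd L0 in \<open>auto simp: dist_norm dist_real_def\<close>)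
    then show ?thesis by (rule lipschitz_on_continuous_on)
  qed
  have open_Cyl: "open Cyl"
    unfolding Cyl_def using cont_P cont_c
    by (intro open_Collect_conj open_Collect_less continuous_intros) auto
  \<comment> \<open>Frontier points lie outside the open set \<Omega>, so
    \<open>g q \<le> 0\<close>; and the part of the cylinder where \<open>g < 0\<close> is open and
    misses \<Omega>, hence also its closure.\<close>
  have bdry: "g q = 0" if "q \<in> frontier \<Omega>" "q \<in> Cyl" for q
  proof -
    have "q \<notin> \<Omega>" using that(1) op by (simp add: frontier_def interior_open)
    then have "g q \<le> 0" using \<Omega>[OF that(2)] by simp
    moreover have "\<not> g q < 0"
    proof
      assume "g q < 0"
      have "open (Cyl \<inter> {x. g x < 0})"
        using cont_g by (intro open_Int open_Cyl open_Collect_less continuous_intros) auto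
      moreover have "(Cyl \<inter> {x. g x < 0}) \<inter> \<Omega> = {}" using \<Omega> by fastforce
      moreover have "q \<in> closure \<Omega>" using that(1) by (simp add: frontier_def)
      ultimately show False using that(2) \<open>g q < 0\<close> open_Int_closure_eq_empty by blast
    qed
    ultimately show ?thesis by simp
  qed
  \<comment> \<open>Half the chart size: balls of radius \<open>2 * \<rho>\<close> about
    \<open>p\<close> lie in the cylinder, and for \<open>t < t\<^sub>0\<close> a descent starting
    within \<open>\<rho>\<close> of \<open>p\<close> has length below \<open>\<rho>\<close> and
    stays there.\<close>
  define \<rho> where "\<rho> = min r h / 2"
  define M where "M = 1 + L"
  define t\<^sub>0 where "t\<^sub>0 = \<rho> / M"
  have \<rho>: "0 < \<rho>" "2 * \<rho> \<le> r" "2 * \<rho> \<le> h" using r h by (auto simp: \<rho>_def)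
  have M: "1 \<le> M" using L0 by (simp add: M_def)
  have t0: "0 < t\<^sub>0" "t\<^sub>0 \<le> \<rho>" using \<rho> M by (auto simp: t\<^sub>0_def field_simps)
  have cyl: "x \<in> Cyl" if "dist p x < 2 * \<rho>" for x
    using Pd[of x p] cd[of x p] that \<rho> by (auto simp: Cyl_def P_def c_def dist_norm norm_minus_commute)
  define Y where "Y = (\<lambda>x. x - g x *\<^sub>R e)"
  have "continuous_on UNIV Y" unfolding Y_def by (intro continuous_intros cont_g)
  then have Ym: "Y \<in> borel_measurable borel" by (rule borel_measurable_continuous_onI)
  have foot: "foot_along \<Omega> e (M * t) (layer \<Omega> (M * t)) Y x"
    if t: "0 < t" "t < t\<^sub>0" and x: "x \<in> layer \<Omega> t" "dist p x < \<rho>" for t x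
  proof -
    have x\<Omega>: "x \<in> \<Omega>" "infdist x (frontier \<Omega>) \<le> t" using x by (auto simp: layer_def)
    obtain q where q: "q \<in> frontier \<Omega>" "infdist x (frontier \<Omega>) = dist x q"
      using infdist_attains_inf[of "frontier \<Omega>" x] p by auto
    have xq: "dist x q \<le> t" using q x\<Omega> by simp
    have "dist p q < 2 * \<rho>"
      using dist_triangle[of p q x] x(2) xq t t0 by linarith
    then have "g q = 0" using bdry[OF q(1) cyl] by blast
    define s where "s = g x"
    have xC: "x \<in> Cyl" using cyl x(2) \<rho> by simp
    have s0: "0 < s" using \<Omega>[OF xC] x\<Omega> by (simp add: s_def)
    have sT: "s \<le> M * t"
    proof -
      have "s \<le> M * norm (x - q)" using gd[of x q] \<open>g q = 0\<close> by (simp add: s_def M_def)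
      also have "\<dots> \<le> M * t" using xq M by (intro mult_left_mono) (auto simp: dist_norm)
      finally show ?thesis .
    qed
    have Mt: "M * t < \<rho>" using t M by (simp add: t\<^sub>0_def field_simps)
    have shift: "c (x - \<sigma> *\<^sub>R e) = c x - \<sigma>" "P (x - \<sigma> *\<^sub>R e) = P x" "g (x - \<sigma> *\<^sub>R e) = g x - \<sigma>" for \<sigma>
    proof -
      show 1: "c (x - \<sigma> *\<^sub>R e) = c x - \<sigma>" by (simp add: c_def inner_diff_left ee)
      show 2: "P (x - \<sigma> *\<^sub>R e) = P x" unfolding P_def 1 by (simp add: algebra_simps)
      show "g (x - \<sigma> *\<^sub>R e) = g x - \<sigma>" unfolding g_def 1 2 by simp
    qed
    have inC: "x - \<sigma> *\<^sub>R e \<in> Cyl" if "0 \<le> \<sigma>" "\<sigma> \<le> s" for \<sigma>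
    proof (rule cyl)
      have "dist p (x - \<sigma> *\<^sub>R e) \<le> dist p x + dist x (x - \<sigma> *\<^sub>R e)" by (rule dist_triangle)
      also have "dist x (x - \<sigma> *\<^sub>R e) = \<sigma>" using that e by (simp add: dist_norm)
      finally show "dist p (x - \<sigma> *\<^sub>R e) < 2 * \<rho>" using that sT Mt x(2) by linarith
    qed
    have in\<Omega>: "x - \<sigma> *\<^sub>R e \<in> \<Omega>" if "0 \<le> \<sigma>" "\<sigma> < s" for \<sigma>
      using \<Omega>[OF inC[of \<sigma>]] that shift(3)[of \<sigma>] by (simp add: s_def)
    have Yx: "Y x = x - s *\<^sub>R e" by (simp add: Y_def s_def)
    have "Y x \<notin> \<Omega>" using \<Omega>[OF inC[of s]] s0 shift(3)[of s] by (simp add: Yx s_def)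
    moreover have "Y x \<in> closure \<Omega>"
    proof (rule closure_sequential[THEN iffD2], intro exI conjI allI)
      \<comment> \<open>Points of the segment just before the foot still lie in \<Omega> and
        converge to the foot.\<close>
      let ?\<sigma> = "\<lambda>n. s - s * inverse (real (Suc n))"
      show "x - ?\<sigma> n *\<^sub>R e \<in> \<Omega>" for n
      proof (rule in\<Omega>)
        have "s * inverse (real (Suc n)) \<le> s * 1" using s0 by (intro mult_left_mono) (auto simp: field_simps)
        then show "0 \<le> ?\<sigma> n" by simp
        show "?\<sigma> n < s" using s0 by simp
      qed
      have "(\<lambda>n. x - ?\<sigma> n *\<^sub>R e) \<longlonglongrightarrow> x - (s - s * 0) *\<^sub>R e"
        by (intro tendsto_intros LIMSEQ_inverse_real_of_nat)
      then show "(\<lambda>n. x - ?\<sigma> n *\<^sub>R e) \<longlonglongrightarrow> Y x" by (simp add: Yx)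
    qed
    ultimately have Yf: "Y x \<in> frontier \<Omega>" using op by (simp add: frontier_def interior_open)
    have "x - \<sigma> *\<^sub>R e \<in> layer \<Omega> (M * t)" if "0 \<le> \<sigma>" "\<sigma> < s" for \<sigma>
    proof -
      have "infdist (x - \<sigma> *\<^sub>R e) (frontier \<Omega>) \<le> dist (x - \<sigma> *\<^sub>R e) (Y x)" by (rule infdist_le[OF Yf])
      also have "\<dots> = norm ((s - \<sigma>) *\<^sub>R e)" by (simp add: Yx dist_norm algebra_simps)
      also have "\<dots> = s - \<sigma>" using e that by simp
      finally show ?thesis using in\<Omega>[OF that] that sT by (simp add: layer_def)
    qed
    moreover have "x = Y x + s *\<^sub>R e" by (simp add: Yx)
    ultimately show ?thesis
      using Yf s0 sT unfolding foot_along_def by (intro conjI bexI[of _ s]) auto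
  qed
  show ?thesis
    using \<rho>(1) t0(1) M e Ym foot
    by (intro exI[of _ \<rho>] exI[of _ t\<^sub>0] exI[of _ M] conjI exI[of _ e] exI[of _ Y]) auto
qed

lemma layer_mono: "s \<le> t \<Longrightarrow> layer \<Omega> s \<subseteq> layer \<Omega> t"
  by (auto simp: layer_def)

text \<open>Compactness of the frontier reduces the claim to finitely many charts, over which
  \<open>foot_estimate\<close> with \<open>T = M p * t\<close> is summed.\<close>

lemma layer_estimate:
  fixes \<Omega> :: "'a::euclidean_space set"
  assumes op: "open \<Omega>" and bd: "bounded \<Omega>" and lip: "lipschitz_boundary \<Omega>"
    and ne: "frontier \<Omega> \<noteq> {}" and d: "2 \<le> DIM('a)"
  obtains C M t\<^sub>0 where "0 \<le> C" "0 \<le> M" "0 < t\<^sub>0"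
    "\<And>t \<phi>. 0 < t \<Longrightarrow> t < t\<^sub>0 \<Longrightarrow> smooth \<phi> \<Longrightarrow>
       (\<integral>\<^sup>+x. ennreal ((cmod (\<phi> x))\<^sup>2) * indicator (layer \<Omega> t) x \<partial>lborel)
       \<le> ennreal (C * t) * L2_sq (surface \<Omega>) \<phi>
         + ennreal (C * t\<^sup>2) * (\<integral>\<^sup>+x. ennreal (grad_sq \<phi> x) * indicator (layer \<Omega> (M * t)) x \<partial>lborel)"
proof -
  let ?F = "frontier \<Omega>"
  let ?K = "sweep_const TYPE('a)"
  have K: "0 < ?K" by (rule sweep_const_pos[OF d])
  have "\<forall>p\<in>?F. \<exists>\<rho> t\<^sub>0 M e Y. 0 < \<rho> \<and> 0 < t\<^sub>0 \<and> 0 < M \<and> norm e = 1 \<and> Y \<in> borel_measurable borel \<and>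
    (\<forall>t x. 0 < t \<longrightarrow> t < t\<^sub>0 \<longrightarrow> x \<in> layer \<Omega> t \<longrightarrow> dist p x < \<rho> \<longrightarrow> foot_along \<Omega> e (M * t) (layer \<Omega> (M * t)) Y x)"
    using lipschitz_boundary_feet[OF op lip] by meson
  then obtain \<rho> \<tau> M e Y where feet: "\<And>p. p \<in> ?F \<Longrightarrow> 0 < \<rho> p \<and> 0 < \<tau> p \<and> 0 < M p \<and> norm (e p) = 1 \<and>
      Y p \<in> borel_measurable borel \<and>
    (\<forall>t x. 0 < t \<longrightarrow> t < \<tau> p \<longrightarrow> x \<in> layer \<Omega> t \<longrightarrow> dist p x < \<rho> p \<longrightarrow>
       foot_along \<Omega> (e p) (M p * t) (layer \<Omega> (M p * t)) (Y p) x)"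
    by metis
  have cF: "compact ?F" using bd by (intro compact_frontier_bounded)
  have "?F \<subseteq> (\<Union>p\<in>?F. ball p (\<rho> p / 2))" using feet by force
  then obtain S where S: "S \<subseteq> ?F" "finite S" "?F \<subseteq> (\<Union>p\<in>S. ball p (\<rho> p / 2))"
    using compactE_image[OF cF, of ?F "\<lambda>p. ball p (\<rho> p / 2)"] open_ball by metis
  define Mx where "Mx = (\<Sum>p\<in>S. M p)"
  \<comment> \<open>Adds the surface coefficient \<open>2 * ?K * M p\<close> and the gradient
    coefficient \<open>2 * (M p)\<^sup>2\<close> of each chart, so that one constant serves both
    terms.\<close>
  define C where "C = (\<Sum>p\<in>S. 2 * ?K * M p + 2 * (M p)\<^sup>2)"
  \<comment> \<open>With \<open>t\<^sub>0 \<le> \<rho> p / 2\<close>, a point within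
    \<open>t\<close> of a frontier point in the half-radius ball about \<open>p\<close> stays in the
    ball of radius \<open>\<rho> p\<close>, where the chart applies.\<close>
  define t\<^sub>0 where "t\<^sub>0 = Min (insert 1 ((\<lambda>p. min (\<tau> p) (\<rho> p / 2)) ` S))"
  have t0: "0 < t\<^sub>0" using S feet by (auto simp: t\<^sub>0_def)
  have t0p: "t\<^sub>0 \<le> \<tau> p" "t\<^sub>0 \<le> \<rho> p / 2" if "p \<in> S" for p
  proof -
    have "t\<^sub>0 \<le> min (\<tau> p) (\<rho> p / 2)" unfolding t\<^sub>0_def using S that by (intro Min_le) auto
    then show "t\<^sub>0 \<le> \<tau> p" "t\<^sub>0 \<le> \<rho> p / 2" by auto
  qed
  have Mp: "0 < M p" "M p \<le> Mx" if "p \<in> S" for p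
  proof -
    show "0 < M p" using feet S(1) that by blast
    have "0 \<le> M q" if "q \<in> S" for q using feet S(1) that by (meson less_imp_le subsetD)
    then show "M p \<le> Mx" unfolding Mx_def by (intro member_le_sum that S(2)) auto
  qed
  have est: "(\<integral>\<^sup>+x. ennreal ((cmod (\<phi> x))\<^sup>2) * indicator (layer \<Omega> t) x \<partial>lborel)
       \<le> ennreal (C * t) * L2_sq (surface \<Omega>) \<phi>
         + ennreal (C * t\<^sup>2) * (\<integral>\<^sup>+x. ennreal (grad_sq \<phi> x) * indicator (layer \<Omega> (Mx * t)) x \<partial>lborel)"
    if t: "0 < t" "t < t\<^sub>0" and \<phi>: "smooth \<phi>" for t \<phi>
  proof -
    define L where "L = (\<lambda>p. layer \<Omega> t \<inter> ball p (\<rho> p))"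
    let ?q = "\<lambda>x. ennreal ((cmod (\<phi> x))\<^sup>2)"
    let ?Su = "L2_sq (surface \<Omega>) \<phi>"
    let ?G = "\<integral>\<^sup>+x. ennreal (grad_sq \<phi> x) * indicator (layer \<Omega> (Mx * t)) x \<partial>lborel"
    have Lm: "L p \<in> sets borel" for p unfolding L_def using layer_measurable[OF op] by auto
    have mq: "?q \<in> borel_measurable borel" using smooth_measurable[OF \<phi>] by simp
    have cov: "layer \<Omega> t \<subseteq> (\<Union>p\<in>S. L p)"
    proof
      fix x assume x: "x \<in> layer \<Omega> t"
      obtain q where q: "q \<in> ?F" "infdist x ?F = dist x q"
        using infdist_attains_inf[OF _ ne] by (metis frontier_closed)
      obtain p where p: "p \<in> S" "dist p q < \<rho> p / 2" using S(3) q(1) by auto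
      have "dist x q \<le> t" using x q by (simp add: layer_def)
      then have "dist p x < \<rho> p"
        using dist_triangle2[of p x q] p t0p[OF p(1)] t by linarith
      then show "x \<in> (\<Union>p\<in>S. L p)" using x p by (auto simp: L_def)
    qed
    have "(\<integral>\<^sup>+x. ?q x * indicator (layer \<Omega> t) x \<partial>lborel) \<le> (\<integral>\<^sup>+x. (\<Sum>p\<in>S. ?q x * indicator (L p) x) \<partial>lborel)"
    proof (rule nn_integral_mono)
      fix x
      show "?q x * indicator (layer \<Omega> t) x \<le> (\<Sum>p\<in>S. ?q x * indicator (L p) x)"
      proof (cases "x \<in> layer \<Omega> t")
        case True
        then obtain p where p: "p \<in> S" "x \<in> L p" using cov by blast
        have "?q x * indicator (layer \<Omega> t) x = ?q x * indicator (L p) x" using True p by simp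
        also have "\<dots> \<le> (\<Sum>p\<in>S. ?q x * indicator (L p) x)"
          by (rule member_le_sum[OF p(1) _ S(2)]) simp
        finally show ?thesis .
      qed simp
    qed
    also have "\<dots> = (\<Sum>p\<in>S. \<integral>\<^sup>+x. ?q x * indicator (L p) x \<partial>lborel)"
      using mq Lm by (intro nn_integral_sum) auto
    also have "\<dots> \<le> (\<Sum>p\<in>S. ennreal ((2 * ?K * M p + 2 * (M p)\<^sup>2) * t) * ?Su
        + ennreal ((2 * ?K * M p + 2 * (M p)\<^sup>2) * t\<^sup>2) * ?G)"
    proof (rule sum_mono)
      fix p assume p: "p \<in> S"
      then have pF: "p \<in> ?F" using S by blast
      have "(\<integral>\<^sup>+x. ?q x * indicator (L p) x \<partial>lborel)
        \<le> ennreal (2 * ?K * (M p * t)) * ?Su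
          + ennreal (2 * (M p * t)\<^sup>2) * (\<integral>\<^sup>+x. ennreal (grad_sq \<phi> x) * indicator (layer \<Omega> (M p * t)) x \<partial>lborel)"
      proof (rule foot_estimate[OF \<phi> _ _ d _ Lm layer_measurable[OF op]])
        show "norm (e p) = 1" "0 < M p * t" "Y p \<in> borel_measurable borel" using feet[OF pF] t by auto
        show "foot_along \<Omega> (e p) (M p * t) (layer \<Omega> (M p * t)) (Y p) x" if "x \<in> L p" for x
          using feet[OF pF] t t0p[OF p] that by (auto simp: L_def)
      qed
      also have "\<dots> \<le> ennreal ((2 * ?K * M p + 2 * (M p)\<^sup>2) * t) * ?Su
        + ennreal ((2 * ?K * M p + 2 * (M p)\<^sup>2) * t\<^sup>2) * ?G"
      proof (rule add_mono)
        have 1: "2 * ?K * (M p * t) \<le> (2 * ?K * M p + 2 * (M p)\<^sup>2) * t"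
          using t by (simp add: algebra_simps)
        have 2: "2 * (M p * t)\<^sup>2 \<le> (2 * ?K * M p + 2 * (M p)\<^sup>2) * t\<^sup>2"
          using t K Mp[OF p] by (simp add: algebra_simps power_mult_distrib)
        have "layer \<Omega> (M p * t) \<subseteq> layer \<Omega> (Mx * t)"
          using Mp[OF p] t by (intro layer_mono mult_right_mono) auto
        then have 3: "(\<integral>\<^sup>+x. ennreal (grad_sq \<phi> x) * indicator (layer \<Omega> (M p * t)) x \<partial>lborel) \<le> ?G"
          by (intro nn_integral_mono mult_left_mono) (auto simp: indicator_def)
        show "ennreal (2 * ?K * (M p * t)) * ?Su \<le> ennreal ((2 * ?K * M p + 2 * (M p)\<^sup>2) * t) * ?Su"
          by (rule mult_right_mono[OF ennreal_leI[OF 1]]) simp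
        show "ennreal (2 * (M p * t)\<^sup>2) * (\<integral>\<^sup>+x. ennreal (grad_sq \<phi> x) * indicator (layer \<Omega> (M p * t)) x \<partial>lborel)
          \<le> ennreal ((2 * ?K * M p + 2 * (M p)\<^sup>2) * t\<^sup>2) * ?G"
          by (rule mult_mono[OF ennreal_leI[OF 2] 3]) auto
      qed
      finally show "(\<integral>\<^sup>+x. ?q x * indicator (L p) x \<partial>lborel)
        \<le> ennreal ((2 * ?K * M p + 2 * (M p)\<^sup>2) * t) * ?Su + ennreal ((2 * ?K * M p + 2 * (M p)\<^sup>2) * t\<^sup>2) * ?G" .
    qed
    also have "\<dots> = ennreal (C * t) * ?Su + ennreal (C * t\<^sup>2) * ?G"
    proof -
      have nn: "0 \<le> 2 * ?K * M p + 2 * (M p)\<^sup>2" if "p \<in> S" for p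
        using K Mp[OF that] by simp
      have "(\<Sum>p\<in>S. ennreal ((2 * ?K * M p + 2 * (M p)\<^sup>2) * s)) = ennreal (C * s)" if "0 \<le> s" for s
        using nn that unfolding C_def sum_distrib_right by (intro sum_ennreal) auto
      then show ?thesis using t by (simp add: sum.distrib flip: sum_distrib_right)
    qed
    finally show ?thesis .
  qed
  have "0 \<le> C" unfolding C_def
  proof (rule sum_nonneg)
    fix p assume "p \<in> S"
    then show "0 \<le> 2 * ?K * M p + 2 * (M p)\<^sup>2" using K Mp(1)[of p] by simp
  qed
  moreover have "0 \<le> Mx" unfolding Mx_def using Mp by (intro sum_nonneg) (auto intro: less_imp_le)
  ultimately show ?thesis using that[OF _ _ t0 est] by blast
qed

lemma L2_sq_diff_tendsto_0:
  assumes "\<And>n. A n \<in> borel_measurable N" "\<And>n. B n \<in> borel_measurable N"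
    "(\<lambda>n. L2_sq N (A n)) \<longlonglongrightarrow> 0" "(\<lambda>n. L2_sq N (B n)) \<longlonglongrightarrow> 0"
  shows "(\<lambda>n. L2_sq N (\<lambda>x. A n x - B n x)) \<longlonglongrightarrow> 0"
proof (rule tendsto_sandwich[OF _ _ tendsto_const])
  have "(\<lambda>n. 2 * L2_sq N (A n) + 2 * L2_sq N (B n)) \<longlonglongrightarrow> 2 * 0 + 2 * 0"
    by (intro tendsto_add ennreal_tendsto_cmult assms) auto
  then show "(\<lambda>n. 2 * L2_sq N (A n) + 2 * L2_sq N (B n)) \<longlonglongrightarrow> 0" by simp
  show "\<forall>\<^sub>F n in sequentially. L2_sq N (\<lambda>x. A n x - B n x) \<le> 2 * L2_sq N (A n) + 2 * L2_sq N (B n)"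
    by (intro always_eventually allI L2_sq_diff_le assms)
qed auto

context bounded_domain
begin

text \<open>Each point of the open set \<Omega> has positive distance to the frontier and so
  eventually leaves the layers; |g|^2 dominates.\<close>

lemma L2_layer_tendsto_0:
  assumes "g \<in> L2 M" "s \<longlonglongrightarrow> 0" "frontier \<Omega> \<noteq> {}"
  shows "(\<lambda>k. L2_sq M (\<lambda>x. indicator (layer \<Omega> (s k)) x * g x)) \<longlonglongrightarrow> 0"
proof -
  have gm: "g \<in> borel_measurable M" by (rule L2_measurable[OF assms(1)])
  have im: "(indicator (layer \<Omega> t) :: 'a \<Rightarrow> complex) \<in> borel_measurable M" for t
    by (intro borel_measurable_lebesgue_on borel_measurable_indicator layer_measurable open_domain)
  have "(\<lambda>k. \<integral>\<^sup>+x. ennreal ((cmod (indicator (layer \<Omega> (s k)) x * g x))\<^sup>2) \<partial>M) \<longlonglongrightarrow> (\<integral>\<^sup>+x. 0 \<partial>M)"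
  proof (rule nn_integral_dominated_convergence[where w="\<lambda>x. ennreal ((cmod (g x))\<^sup>2)"])
    show "(\<lambda>x. ennreal ((cmod (indicator (layer \<Omega> (s k)) x * g x))\<^sup>2)) \<in> borel_measurable M" for k
      using borel_measurable_times[OF im gm] by measurable
    show "(\<lambda>x. ennreal ((cmod (g x))\<^sup>2)) \<in> borel_measurable M" using gm by measurable
    show "AE x in M. ennreal ((cmod (indicator (layer \<Omega> (s k)) x * g x))\<^sup>2) \<le> ennreal ((cmod (g x))\<^sup>2)" for k
      by (rule AE_I2) (auto simp: indicator_def)
    show "(\<integral>\<^sup>+x. ennreal ((cmod (g x))\<^sup>2) \<partial>M) < \<infinity>"
      using L2_sq_finite[OF assms(1)] by (simp add: L2_sq_def)
    show "AE x in M. (\<lambda>k. ennreal ((cmod (indicator (layer \<Omega> (s k)) x * g x))\<^sup>2)) \<longlonglongrightarrow> 0"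
    proof (rule AE_I2)
      fix x assume "x \<in> space M"
      then have "x \<in> \<Omega>" by (simp add: space_restrict_space)
      then have "x \<notin> frontier \<Omega>" using open_domain by (simp add: frontier_def interior_open)
      then have "0 < infdist x (frontier \<Omega>)"
        using infdist_pos_not_in_closed[OF frontier_closed assms(3)] by blast
      then have "\<forall>\<^sub>F k in sequentially. s k < infdist x (frontier \<Omega>)"
        using order_tendstoD(2)[OF assms(2)] by blast
      then have "\<forall>\<^sub>F k in sequentially. ennreal ((cmod (indicator (layer \<Omega> (s k)) x * g x))\<^sup>2) = 0"
        by eventually_elim (auto simp: layer_def indicator_def)
      then show "(\<lambda>k. ennreal ((cmod (indicator (layer \<Omega> (s k)) x * g x))\<^sup>2)) \<longlonglongrightarrow> 0"
        by (rule tendsto_eventually)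
    qed
  qed simp
  then show ?thesis by (simp add: L2_sq_def)
qed

lemma L2_sq_M_eq:
  assumes "f \<in> borel_measurable borel"
  shows "L2_sq M (\<lambda>x. indicator (layer \<Omega> t) x * f x)
    = (\<integral>\<^sup>+x. ennreal ((cmod (f x))\<^sup>2) * indicator (layer \<Omega> t) x \<partial>lborel)"
  unfolding L2_sq_def nn_integral_lebesgue_on[OF domain_sets(1)]
  by (rule nn_integral_cong) (auto simp: indicator_def layer_def)

text \<open>The margin \<open>4 * t\<close> is twice the reach of a cutoff, so its support stays in
  \<Omega>: a ball about a point of \<open>K\<close> that left \<Omega> would, being connected, meet
  the frontier. The interior of \<open>K\<close> matters because there the cutoff is locally
  constant and its gradient vanishes.\<close>

lemma inner_cutoff:
  assumes "0 < t" "frontier \<Omega> \<noteq> {}"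
  defines "K \<equiv> {x \<in> closure \<Omega>. 4 * t \<le> infdist x (frontier \<Omega>)}"
  shows "compact K" "\<And>x. x \<in> K \<Longrightarrow> cball x (2 * t) \<subseteq> \<Omega>" "\<Omega> - layer \<Omega> (4 * t) \<subseteq> interior K"
proof -
  have "closed {x. 4 * t \<le> infdist x (frontier \<Omega>)}" by (intro closed_Collect_le continuous_intros)
  moreover have "K = closure \<Omega> \<inter> {x. 4 * t \<le> infdist x (frontier \<Omega>)}" by (auto simp: K_def)
  ultimately show "compact K" using bounded_domain by (simp add: compact_Int_closed compact_closure)
  show "cball x (2 * t) \<subseteq> \<Omega>" if "x \<in> K" for x
  proof (rule ccontr)
    assume c: "\<not> ?thesis"
    have far: "2 * t < dist x q" if "q \<in> frontier \<Omega>" for q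
      using infdist_le[OF that, of x] \<open>x \<in> K\<close> assms(1) by (simp add: K_def)
    have "x \<in> closure \<Omega>" using that by (simp add: K_def)
    moreover have "x \<notin> frontier \<Omega>" using far[of x] assms(1) by auto
    ultimately have "x \<in> \<Omega>" using open_domain by (simp add: frontier_def interior_open)
    then have "cball x (2 * t) \<inter> frontier \<Omega> \<noteq> {}"
    proof (intro connected_Int_frontier)
      show "cball x (2 * t) \<inter> \<Omega> \<noteq> {}" using \<open>x \<in> \<Omega>\<close> assms(1) by (auto intro!: exI[of _ x] simp: disjoint_iff)
    qed (use c in auto)
    then obtain q where "q \<in> frontier \<Omega>" "dist x q \<le> 2 * t" by auto
    then show False using far by force
  qed
  have "open {x. 4 * t < infdist x (frontier \<Omega>)}" by (intro open_Collect_less continuous_intros)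
  then have "open (\<Omega> \<inter> {x. 4 * t < infdist x (frontier \<Omega>)})" using open_domain by blast
  moreover have "\<Omega> \<inter> {x. 4 * t < infdist x (frontier \<Omega>)} \<subseteq> K"
    using closure_subset[of \<Omega>] by (auto simp: K_def)
  ultimately have "\<Omega> \<inter> {x. 4 * t < infdist x (frontier \<Omega>)} \<subseteq> interior K" by (simp add: interior_maximal)
  then show "\<Omega> - layer \<Omega> (4 * t) \<subseteq> interior K" by (auto simp: layer_def)
qed

end

section \<open>Vanishing trace and approximation by test functions\<close>

locale lipschitz_domain = bounded_domain +
  assumes lipschitz: "lipschitz_boundary \<Omega>" and frontier_nonempty: "frontier \<Omega> \<noteq> {}"
    and dim_ge_2: "2 \<le> DIM('a::euclidean_space)"
begin

text \<open>The squared H1 distance of \<theta> to a function \<open>w\<close> whose gradient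
  \<open>g\<close> is supplied explicitly, which avoids handling \<open>wderiv\<close> of a
  difference.\<close>

definition H1_err :: "('a \<Rightarrow> complex) \<Rightarrow> ('a \<Rightarrow> complex) \<Rightarrow> ('a \<Rightarrow> 'a \<Rightarrow> complex) \<Rightarrow> ennreal" where
  "H1_err \<theta> w g = L2_sq M (\<lambda>x. \<theta> x - w x) + (\<Sum>b\<in>Basis. L2_sq M (\<lambda>x. dderiv b \<theta> x - g b x))"

text \<open>The part of the squared H1 norm that a cutoff may discard.\<close>

definition layer_err :: "real \<Rightarrow> ('a \<Rightarrow> complex) \<Rightarrow> ('a \<Rightarrow> 'a \<Rightarrow> complex) \<Rightarrow> ennreal" where
  "layer_err s w g = L2_sq M (\<lambda>x. indicator (layer \<Omega> s) x * w x)
     + (\<Sum>b\<in>Basis. L2_sq M (\<lambda>x. indicator (layer \<Omega> s) x * g b x))"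

lemma H1_err_ge:
  "L2_sq M (\<lambda>x. \<theta> x - w x) \<le> H1_err \<theta> w g"
  "b \<in> Basis \<Longrightarrow> L2_sq M (\<lambda>x. dderiv b \<theta> x - g b x) \<le> H1_err \<theta> w g"
  unfolding H1_err_def
  by (auto intro: order_trans[OF member_le_sum[of b Basis "\<lambda>b. L2_sq M (\<lambda>x. dderiv b \<theta> x - g b x)"]])

lemma L2_sq_layer_mono:
  "s \<le> t \<Longrightarrow> L2_sq M (\<lambda>x. indicator (layer \<Omega> s) x * g x) \<le> L2_sq M (\<lambda>x. indicator (layer \<Omega> t) x * g x)"
  using layer_mono[of s t \<Omega>] by (intro L2_sq_mono_AE AE_I2) (auto simp: indicator_def)

lemma layer_err_ge:
  "L2_sq M (\<lambda>x. indicator (layer \<Omega> s) x * w x) \<le> layer_err s w g"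
  "b \<in> Basis \<Longrightarrow> L2_sq M (\<lambda>x. indicator (layer \<Omega> s) x * g b x) \<le> layer_err s w g"
  unfolding layer_err_def
  by (auto intro: order_trans[OF member_le_sum[of b Basis "\<lambda>b. L2_sq M (\<lambda>x. indicator (layer \<Omega> s) x * g b x)"]])

lemma layer_err_mono: "s \<le> t \<Longrightarrow> layer_err s w g \<le> layer_err t w g"
  unfolding layer_err_def by (intro add_mono sum_mono L2_sq_layer_mono)

lemma layer_err_tendsto_0:
  assumes "w \<in> L2 M" "\<And>b. b \<in> Basis \<Longrightarrow> g b \<in> L2 M" "s \<longlonglongrightarrow> 0"
  shows "(\<lambda>k. layer_err (s k) w g) \<longlonglongrightarrow> 0"
proof -
  have "(\<lambda>k. layer_err (s k) w g) \<longlonglongrightarrow> 0 + (\<Sum>b\<in>(Basis :: 'a set). 0)"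
    unfolding layer_err_def
    by (intro tendsto_add tendsto_sum L2_layer_tendsto_0 assms frontier_nonempty)
  then show ?thesis by simp
qed

lemma layer_indicator_measurable:
  "(indicator (layer \<Omega> t) :: 'a \<Rightarrow> complex) \<in> borel_measurable M"
  by (intro borel_measurable_lebesgue_on borel_measurable_indicator layer_measurable open_domain)

lemma smooth_measurable_M: "smooth f \<Longrightarrow> f \<in> borel_measurable M"
  by (intro borel_measurable_lebesgue_on smooth_measurable)

lemma L2_sq_layer_le:
  assumes "u \<in> borel_measurable M" "g \<in> borel_measurable M"
  shows "L2_sq M (\<lambda>x. indicator (layer \<Omega> s) x * u x)
    \<le> 2 * L2_sq M (\<lambda>x. u x - g x) + 2 * L2_sq M (\<lambda>x. indicator (layer \<Omega> s) x * g x)"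
proof -
  let ?i = "\<lambda>x. indicator (layer \<Omega> s) x :: complex"
  have "L2_sq M (\<lambda>x. ?i x * u x) = L2_sq M (\<lambda>x. ?i x * (u x - g x) + ?i x * g x)"
    by (simp add: algebra_simps)
  also have "\<dots> \<le> 2 * L2_sq M (\<lambda>x. ?i x * (u x - g x)) + 2 * L2_sq M (\<lambda>x. ?i x * g x)"
    by (intro L2_sq_add_le borel_measurable_times borel_measurable_diff layer_indicator_measurable assms)
  also have "\<dots> \<le> 2 * L2_sq M (\<lambda>x. u x - g x) + 2 * L2_sq M (\<lambda>x. ?i x * g x)"
    by (intro add_right_mono mult_left_mono L2_sq_mono_AE AE_I2) (auto simp: indicator_def)
  finally show ?thesis .
qed

text \<open>The cutoff error \<open>\<psi> \<nabla>\<eta>\<close> is of size \<open>|\<psi>| / t\<close> on a layer of width \<open>t\<close>. Since \<open>\<psi>\<close> is small on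
  the boundary, the layer estimate compensates the factor \<open>1 / t\<^sup>2\<close>.\<close>

lemma cutoff_error:
  obtains \<kappa> c t\<^sub>1 C where "0 \<le> \<kappa>" "0 < t\<^sub>1" "0 \<le> c" "0 \<le> C"
    "\<And>t \<psi> w g. 0 < t \<Longrightarrow> t < t\<^sub>1 \<Longrightarrow> smooth \<psi> \<Longrightarrow> w \<in> L2 M \<Longrightarrow> (\<And>b. b \<in> Basis \<Longrightarrow> g b \<in> L2 M) \<Longrightarrow>
       \<exists>\<theta>\<in>test_functions \<Omega>. H1_err \<theta> w g \<le> ennreal c * (H1_err \<psi> w g + layer_err (\<kappa> * t) w g)
         + ennreal (C / t) * L2_sq (surface \<Omega>) \<psi>"
proof -
  obtain C\<^sub>0 where C0: "0 \<le> C\<^sub>0" "\<And>(K :: 'a set) t. 0 < t \<Longrightarrow> compact K \<Longrightarrow> \<exists>\<eta>. cutoff K t C\<^sub>0 \<eta>"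
    using smooth_cutoff_exists by blast
  obtain C\<^sub>1 m t\<^sub>0 where C1: "0 \<le> C\<^sub>1" "0 \<le> m" "0 < t\<^sub>0"
    and est: "\<And>t \<phi>. 0 < t \<Longrightarrow> t < t\<^sub>0 \<Longrightarrow> smooth \<phi> \<Longrightarrow>
       (\<integral>\<^sup>+x. ennreal ((cmod (\<phi> x))\<^sup>2) * indicator (layer \<Omega> t) x \<partial>lborel)
       \<le> ennreal (C\<^sub>1 * t) * L2_sq (surface \<Omega>) \<phi>
         + ennreal (C\<^sub>1 * t\<^sup>2) * (\<integral>\<^sup>+x. ennreal (grad_sq \<phi> x) * indicator (layer \<Omega> (m * t)) x \<partial>lborel)"
    using layer_estimate[OF open_domain bounded_domain lipschitz frontier_nonempty dim_ge_2] by blast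
  \<comment> \<open>Large enough for the layer of width \<open>4 * t\<close> where the cutoff varies
    and for the layer of width \<open>m * (4 * t)\<close> on which the layer estimate needs the
    gradient.\<close>
  define \<kappa> where "\<kappa> = 4 + m * 4"
  \<comment> \<open>The squared cutoff gradient \<open>(C\<^sub>0 / t)\<^sup>2\<close> times the
    coefficients of the layer estimate at width \<open>4 * t\<close> is \<open>c1 / t\<close> on the
    surface and \<open>c2\<close> for the gradient: there the powers of \<open>t\<close>
    cancel.\<close>
  define c1 where "c1 = 4 * C\<^sub>0\<^sup>2 * C\<^sub>1"
  define c2 where "c2 = 16 * C\<^sub>0\<^sup>2 * C\<^sub>1"
  define D where "D = real DIM('a)"
  \<comment> \<open>The 2 is the share of the function itself; each of the \<open>D\<close> partial
    derivatives contributes \<open>4 + 4 * (c2 * 2)\<close>.\<close>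
  define c where "c = 2 + D * (4 + 4 * (c2 * 2))"
  define C where "C = D * (4 * c1)"
  have nn: "0 \<le> c1" "0 \<le> c2" "0 \<le> D" using C0 C1 by (auto simp: c1_def c2_def D_def)
  have main: "\<exists>\<theta>\<in>test_functions \<Omega>. H1_err \<theta> w g \<le> ennreal c * (H1_err \<psi> w g + layer_err (\<kappa> * t) w g)
         + ennreal (C / t) * L2_sq (surface \<Omega>) \<psi>"
    if t: "0 < t" "t < t\<^sub>0 / 4" and \<psi>: "smooth \<psi>" and w: "w \<in> L2 M" and g: "\<And>b. b \<in> Basis \<Longrightarrow> g b \<in> L2 M"
    for t \<psi> w g
  proof -
    define K where "K = {x \<in> closure \<Omega>. 4 * t \<le> infdist x (frontier \<Omega>)}"
    note K = inner_cutoff[OF t(1) frontier_nonempty, folded K_def]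
    obtain \<eta> where \<eta>: "cutoff K t C\<^sub>0 \<eta>" using C0(2)[OF t(1) K(1)] by blast
    have \<eta>t: "\<eta> \<in> test_functions \<Omega>" by (rule cutoff_test_function[OF \<eta> K(1,2)])
    have \<eta>s: "smooth \<eta>" using \<eta> by (simp add: cutoff_def)
    have \<eta>1: "\<eta> x = 1" if "x \<in> K" for x using \<eta> that by (simp add: cutoff_def)
    have \<eta>r: "cmod (\<eta> x) \<le> 1" "cmod (1 - \<eta> x) \<le> 1" for x
    proof -
      obtain r where r: "r \<in> {0..1}" "\<eta> x = of_real r" using \<eta> unfolding cutoff_def by blast
      then show "cmod (\<eta> x) \<le> 1" by simp
      have "1 - \<eta> x = of_real (1 - r)" using r by simp
      then show "cmod (1 - \<eta> x) \<le> 1" using r(1) by (simp only: norm_of_real) simp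
    qed
    have \<eta>d: "cmod (dderiv b \<eta> x) \<le> C\<^sub>0 / t" if "b \<in> Basis" for b x
      using \<eta> that by (simp add: cutoff_def)
    have \<eta>in: "\<eta> x = 1" "dderiv b \<eta> x = 0" if "x \<in> \<Omega>" "x \<notin> layer \<Omega> (4 * t)" for b x
    proof -
      have x: "x \<in> interior K" using K(3) that by blast
      then show "\<eta> x = 1" using \<eta>1 interior_subset by blast
      have "dderiv b \<eta> x = dderiv b (\<lambda>_. 1) x"
        by (rule dderiv_cong_open[OF open_interior x]) (use \<eta>1 interior_subset in blast)
      then show "dderiv b \<eta> x = 0" by (simp add: dderiv_const)
    qed
    define \<theta> where "\<theta> = (\<lambda>x. \<psi> x * \<eta> x)"
    let ?i = "\<lambda>x. indicator (layer \<Omega> (4 * t)) x :: complex"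
    let ?e = "H1_err \<psi> w g + layer_err (\<kappa> * t) w g"
    let ?S = "L2_sq (surface \<Omega>) \<psi>"
    have k4: "4 * t \<le> \<kappa> * t" "m * (4 * t) \<le> \<kappa> * t" using t C1 by (auto simp: \<kappa>_def algebra_simps)
    have e1: "H1_err \<psi> w g \<le> ?e" "layer_err (\<kappa> * t) w g \<le> ?e" by auto
    have \<theta>t: "\<theta> \<in> test_functions \<Omega>" unfolding \<theta>_def by (rule test_mult[OF \<eta>t \<psi>])
    have m\<psi>: "\<psi> \<in> borel_measurable M" "\<eta> \<in> borel_measurable M" by (intro smooth_measurable_M \<psi> \<eta>s)+
    have mw: "w \<in> borel_measurable M" by (rule L2_measurable[OF w])
    have mw1: "(\<lambda>x. \<eta> x * (\<psi> x - w x)) \<in> borel_measurable M" "(\<lambda>x. (1 - \<eta> x) * w x) \<in> borel_measurable M"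
      by (intro borel_measurable_times borel_measurable_diff borel_measurable_const m\<psi> mw)+
    have 1: "L2_sq M (\<lambda>x. \<theta> x - w x) \<le> 2 * ?e"
    proof -
      have "L2_sq M (\<lambda>x. \<theta> x - w x) = L2_sq M (\<lambda>x. \<eta> x * (\<psi> x - w x) - (1 - \<eta> x) * w x)"
        by (simp add: \<theta>_def algebra_simps)
      also have "\<dots> \<le> 2 * L2_sq M (\<lambda>x. \<eta> x * (\<psi> x - w x)) + 2 * L2_sq M (\<lambda>x. (1 - \<eta> x) * w x)"
        by (rule L2_sq_diff_le[OF mw1])
      also have "\<dots> \<le> 2 * H1_err \<psi> w g + 2 * layer_err (\<kappa> * t) w g"
      proof (intro add_mono mult_left_mono)
        have "L2_sq M (\<lambda>x. \<eta> x * (\<psi> x - w x)) \<le> L2_sq M (\<lambda>x. \<psi> x - w x)"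
          using \<eta>r(1) by (intro L2_sq_mono_AE AE_I2) (simp add: norm_mult mult_left_le_one_le)
        then show "L2_sq M (\<lambda>x. \<eta> x * (\<psi> x - w x)) \<le> H1_err \<psi> w g"
          using H1_err_ge(1) order_trans by blast
        have "L2_sq M (\<lambda>x. (1 - \<eta> x) * w x) \<le> L2_sq M (\<lambda>x. ?i x * w x)"
        proof (intro L2_sq_mono_AE AE_I2)
          fix x assume "x \<in> space M"
          then show "cmod ((1 - \<eta> x) * w x) \<le> cmod (?i x * w x)"
            using \<eta>r(2)[of x] \<eta>in(1)[of x]
            by (auto simp: space_restrict_space norm_mult indicator_def mult_left_le_one_le)
        qed
        also have "\<dots> \<le> layer_err (4 * t) w g" by (rule layer_err_ge(1))
        also have "\<dots> \<le> layer_err (\<kappa> * t) w g" by (rule layer_err_mono[OF k4(1)])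
        finally show "L2_sq M (\<lambda>x. (1 - \<eta> x) * w x) \<le> layer_err (\<kappa> * t) w g" .
      qed auto
      finally show ?thesis by (simp add: distrib_left)
    qed
    have G: "(\<integral>\<^sup>+x. ennreal (grad_sq \<psi> x) * indicator (layer \<Omega> (m * (4 * t))) x \<partial>lborel) \<le> 2 * ?e"
    proof -
      let ?L = "layer \<Omega> (m * (4 * t))"
      have md: "dderiv b \<psi> \<in> borel_measurable borel" if "b \<in> Basis" for b
        by (rule smooth_measurable[OF smooth_dderiv[OF \<psi> that]])
      have "(\<integral>\<^sup>+x. ennreal (grad_sq \<psi> x) * indicator ?L x \<partial>lborel)
          = (\<integral>\<^sup>+x. (\<Sum>b\<in>Basis. ennreal ((cmod (dderiv b \<psi> x))\<^sup>2) * indicator ?L x) \<partial>lborel)"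
      proof -
        have "ennreal (grad_sq \<psi> x) = (\<Sum>b\<in>Basis. ennreal ((cmod (dderiv b \<psi> x))\<^sup>2))" for x
          unfolding grad_sq_def by (rule sum_ennreal[symmetric]) simp
        then show ?thesis by (simp only: sum_distrib_right)
      qed
      also have "\<dots> = (\<Sum>b\<in>Basis. \<integral>\<^sup>+x. ennreal ((cmod (dderiv b \<psi> x))\<^sup>2) * indicator ?L x \<partial>lborel)"
        using md layer_measurable[OF open_domain] by (intro nn_integral_sum) auto
      also have "\<dots> = (\<Sum>b\<in>Basis. L2_sq M (\<lambda>x. indicator ?L x * dderiv b \<psi> x))"
        using L2_sq_M_eq[OF md] by simp
      also have "\<dots> \<le> (\<Sum>b\<in>Basis. 2 * L2_sq M (\<lambda>x. dderiv b \<psi> x - g b x)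
          + 2 * L2_sq M (\<lambda>x. indicator (layer \<Omega> (\<kappa> * t)) x * g b x))"
      proof (rule sum_mono)
        fix b :: 'a assume b: "b \<in> Basis"
        have "L2_sq M (\<lambda>x. indicator ?L x * dderiv b \<psi> x)
          \<le> 2 * L2_sq M (\<lambda>x. dderiv b \<psi> x - g b x) + 2 * L2_sq M (\<lambda>x. indicator ?L x * g b x)"
          by (intro L2_sq_layer_le borel_measurable_lebesgue_on md b L2_measurable g)
        also have "\<dots> \<le> 2 * L2_sq M (\<lambda>x. dderiv b \<psi> x - g b x)
          + 2 * L2_sq M (\<lambda>x. indicator (layer \<Omega> (\<kappa> * t)) x * g b x)"
          by (intro add_left_mono mult_left_mono L2_sq_layer_mono k4) auto
        finally show "L2_sq M (\<lambda>x. indicator ?L x * dderiv b \<psi> x) \<le> \<dots>" .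
      qed
      also have "\<dots> = 2 * (\<Sum>b\<in>Basis. L2_sq M (\<lambda>x. dderiv b \<psi> x - g b x))
          + 2 * (\<Sum>b\<in>Basis. L2_sq M (\<lambda>x. indicator (layer \<Omega> (\<kappa> * t)) x * g b x))"
        by (simp add: sum.distrib sum_distrib_left)
      also have "\<dots> \<le> 2 * H1_err \<psi> w g + 2 * layer_err (\<kappa> * t) w g"
        unfolding H1_err_def layer_err_def by (intro add_mono mult_left_mono) auto
      finally show ?thesis by (simp add: distrib_left)
    qed
    have Q: "L2_sq M (\<lambda>x. \<psi> x * dderiv b \<eta> x) \<le> ennreal (c1 / t) * ?S + ennreal c2 * (2 * ?e)" if b: "b \<in> Basis" for b
    proof -
      have "L2_sq M (\<lambda>x. \<psi> x * dderiv b \<eta> x) \<le> L2_sq M (\<lambda>x. of_real (C\<^sub>0 / t) * (?i x * \<psi> x))"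
      proof (intro L2_sq_mono_AE AE_I2)
        fix x assume x: "x \<in> space M"
        show "cmod (\<psi> x * dderiv b \<eta> x) \<le> cmod (of_real (C\<^sub>0 / t) * (?i x * \<psi> x))"
        proof (cases "x \<in> layer \<Omega> (4 * t)")
          case True
          then have "cmod (\<psi> x * dderiv b \<eta> x) \<le> cmod (\<psi> x) * (C\<^sub>0 / t)"
            unfolding norm_mult by (intro mult_left_mono \<eta>d b) auto
          also have "\<dots> = cmod (of_real (C\<^sub>0 / t) * (?i x * \<psi> x))"
            using True C0(1) t by (simp add: norm_mult norm_divide)
          finally show ?thesis .
        next
          case False
          then show ?thesis using \<eta>in(2)[of x b] x by (simp add: space_restrict_space)
        qed
      qed
      also have "\<dots> = ennreal ((C\<^sub>0 / t)\<^sup>2) * L2_sq M (\<lambda>x. ?i x * \<psi> x)"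
        using C0(1) t by (subst L2_sq_cmult) (auto intro!: borel_measurable_times layer_indicator_measurable m\<psi> simp: norm_divide power_divide)
      also have "L2_sq M (\<lambda>x. ?i x * \<psi> x) = (\<integral>\<^sup>+x. ennreal ((cmod (\<psi> x))\<^sup>2) * indicator (layer \<Omega> (4 * t)) x \<partial>lborel)"
        by (rule L2_sq_M_eq[OF smooth_measurable[OF \<psi>]])
      also have "ennreal ((C\<^sub>0 / t)\<^sup>2) * \<dots> \<le> ennreal ((C\<^sub>0 / t)\<^sup>2) * (ennreal (C\<^sub>1 * (4 * t)) * ?S + ennreal (C\<^sub>1 * (4 * t)\<^sup>2) * (2 * ?e))"
      proof (rule mult_left_mono)
        have t4: "0 < 4 * t" "4 * t < t\<^sub>0" using t by auto
        show "(\<integral>\<^sup>+x. ennreal ((cmod (\<psi> x))\<^sup>2) * indicator (layer \<Omega> (4 * t)) x \<partial>lborel)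
          \<le> ennreal (C\<^sub>1 * (4 * t)) * ?S + ennreal (C\<^sub>1 * (4 * t)\<^sup>2) * (2 * ?e)"
          by (rule order_trans[OF est[OF t4 \<psi>] add_left_mono[OF mult_left_mono[OF G]]]) simp
      qed simp
      also have "\<dots> = ennreal ((C\<^sub>0 / t)\<^sup>2 * (C\<^sub>1 * (4 * t))) * ?S + ennreal ((C\<^sub>0 / t)\<^sup>2 * (C\<^sub>1 * (4 * t)\<^sup>2)) * (2 * ?e)"
        using C1 t by (subst (1 2) ennreal_mult) (auto simp: distrib_left mult.assoc)
      also have "(C\<^sub>0 / t)\<^sup>2 * (C\<^sub>1 * (4 * t)) = c1 / t" using t by (simp add: c1_def power2_eq_square field_simps)
      also have "(C\<^sub>0 / t)\<^sup>2 * (C\<^sub>1 * (4 * t)\<^sup>2) = c2" using t by (simp add: c2_def power2_eq_square field_simps)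
      finally show ?thesis .
    qed
    have 2: "L2_sq M (\<lambda>x. dderiv b \<theta> x - g b x) \<le> 4 * ?e + 4 * (ennreal (c1 / t) * ?S + ennreal c2 * (2 * ?e))"
      if b: "b \<in> Basis" for b
    proof -
      have d: "dderiv b \<theta> x = \<psi> x * dderiv b \<eta> x + dderiv b \<psi> x * \<eta> x" for x
        unfolding \<theta>_def by (rule dderiv_mult[OF smooth_differentiable[OF \<psi>] smooth_differentiable[OF \<eta>s]])
      have md: "dderiv b \<psi> \<in> borel_measurable M" "dderiv b \<eta> \<in> borel_measurable M" "g b \<in> borel_measurable M"
        by (intro smooth_measurable_M smooth_dderiv \<psi> \<eta>s b L2_measurable g)+
      have m1: "(\<lambda>x. \<eta> x * (dderiv b \<psi> x - g b x)) \<in> borel_measurable M"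
        "(\<lambda>x. (1 - \<eta> x) * g b x) \<in> borel_measurable M" "(\<lambda>x. \<psi> x * dderiv b \<eta> x) \<in> borel_measurable M"
        by (intro borel_measurable_times borel_measurable_diff borel_measurable_const m\<psi> md)+
      \<comment> \<open>The product rule rearranged: the error before the cutoff, a part living on
        the layer, and \<open>\<psi> x * dderiv b \<eta> x\<close>, the only one with a factor 1 /
        t, which \<open>Q\<close> controls.\<close>
      have "L2_sq M (\<lambda>x. dderiv b \<theta> x - g b x)
          = L2_sq M (\<lambda>x. \<eta> x * (dderiv b \<psi> x - g b x) - ((1 - \<eta> x) * g b x - \<psi> x * dderiv b \<eta> x))"
        by (simp add: d algebra_simps)
      also have "\<dots> \<le> 2 * L2_sq M (\<lambda>x. \<eta> x * (dderiv b \<psi> x - g b x))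
          + 2 * L2_sq M (\<lambda>x. (1 - \<eta> x) * g b x - \<psi> x * dderiv b \<eta> x)"
        by (rule L2_sq_diff_le[OF m1(1) borel_measurable_diff[OF m1(2,3)]])
      also have "\<dots> \<le> 2 * L2_sq M (\<lambda>x. \<eta> x * (dderiv b \<psi> x - g b x))
          + 2 * (2 * L2_sq M (\<lambda>x. (1 - \<eta> x) * g b x) + 2 * L2_sq M (\<lambda>x. \<psi> x * dderiv b \<eta> x))"
        by (intro add_left_mono mult_left_mono L2_sq_diff_le m1) auto
      also have "\<dots> \<le> 2 * H1_err \<psi> w g + 2 * (2 * layer_err (\<kappa> * t) w g + 2 * (ennreal (c1 / t) * ?S + ennreal c2 * (2 * ?e)))"
      proof (intro add_mono mult_left_mono Q b)
        have "L2_sq M (\<lambda>x. \<eta> x * (dderiv b \<psi> x - g b x)) \<le> L2_sq M (\<lambda>x. dderiv b \<psi> x - g b x)"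
          using \<eta>r(1) by (intro L2_sq_mono_AE AE_I2) (simp add: norm_mult mult_left_le_one_le)
        then show "L2_sq M (\<lambda>x. \<eta> x * (dderiv b \<psi> x - g b x)) \<le> H1_err \<psi> w g"
          using H1_err_ge(2)[OF b] order_trans by blast
        have "L2_sq M (\<lambda>x. (1 - \<eta> x) * g b x) \<le> L2_sq M (\<lambda>x. ?i x * g b x)"
        proof (intro L2_sq_mono_AE AE_I2)
          fix x assume "x \<in> space M"
          then show "cmod ((1 - \<eta> x) * g b x) \<le> cmod (?i x * g b x)"
            using \<eta>r(2)[of x] \<eta>in(1)[of x]
            by (auto simp: space_restrict_space norm_mult indicator_def mult_left_le_one_le)
        qed
        also have "\<dots> \<le> layer_err (4 * t) w g" by (rule layer_err_ge(2)[OF b])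
        also have "\<dots> \<le> layer_err (\<kappa> * t) w g" by (rule layer_err_mono[OF k4(1)])
        finally show "L2_sq M (\<lambda>x. (1 - \<eta> x) * g b x) \<le> layer_err (\<kappa> * t) w g" .
      qed auto
      also have "\<dots> = 2 * H1_err \<psi> w g + 4 * layer_err (\<kappa> * t) w g + 4 * (ennreal (c1 / t) * ?S + ennreal c2 * (2 * ?e))"
        by (simp add: distrib_left mult.assoc[symmetric] add.assoc)
      also have "\<dots> \<le> 4 * ?e + 4 * (ennreal (c1 / t) * ?S + ennreal c2 * (2 * ?e))"
        by (intro add_right_mono) (auto simp: distrib_left intro!: add_mono mult_right_mono)
      finally show ?thesis .
    qed
    have "H1_err \<theta> w g \<le> 2 * ?e + (\<Sum>b\<in>(Basis :: 'a set). 4 * ?e + 4 * (ennreal (c1 / t) * ?S + ennreal c2 * (2 * ?e)))"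
      unfolding H1_err_def[of \<theta>] by (intro add_mono sum_mono 1 2)
    also have "\<dots> = 2 * ?e + ennreal D * (4 * ?e + 4 * (ennreal (c1 / t) * ?S + ennreal c2 * (2 * ?e)))"
      by (simp add: D_def ennreal_of_nat_eq_real_of_nat)
    also have "\<dots> = (2 + ennreal D * (4 + 4 * (ennreal c2 * 2))) * ?e + (ennreal D * (4 * ennreal (c1 / t))) * ?S"
      by (simp add: distrib_left distrib_right mult.assoc add.assoc add.commute add.left_commute)
    also have "2 + ennreal D * (4 + 4 * (ennreal c2 * 2)) = ennreal c"
    proof -
      have "4 * (ennreal c2 * 2) = 8 * ennreal c2"
        by (subst mult.commute[of "ennreal c2"]) (simp flip: mult.assoc)
      then show ?thesis unfolding c_def using nn by (simp add: ennreal_mult ennreal_plus)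
    qed
    also have "ennreal D * (4 * ennreal (c1 / t)) = ennreal (C / t)"
    proof -
      have eq: "C / t = D * (4 * (c1 / t))" by (simp add: C_def)
      show ?thesis
        unfolding eq using nn t by (simp add: ennreal_mult del: times_divide_eq_right)
    qed
    finally show ?thesis using \<theta>t by blast
  qed
  show ?thesis
    by (rule that[of \<kappa> "t\<^sub>0 / 4", OF _ _ _ _ main]) (use C1 C0 nn in \<open>auto simp: \<kappa>_def c_def C_def\<close>)
qed

end

section \<open>Green's identity\<close>

lemma borel_measurable_surface: "f \<in> borel_measurable borel \<Longrightarrow> f \<in> borel_measurable (surface \<Omega>)"
  unfolding surface_def
  by (intro measurable_restrict_space1) (simp add: measurable_cong_sets[OF sets_hausdorff_measure refl])

context lipschitz_domain
begin

text \<open>The differences of the approximants of \<open>V\<close> and \<open>v\<close> tend to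
  \<open>V - v\<close> in H1 and to 0 in L2 of the surface, since both sequences tend there to the
  same \<tau>. \<open>cutoff_error\<close> then turns them into test functions.\<close>

lemma trace_diff_approx:
  assumes V: "has_trace \<Omega> V \<tau>" and v: "has_trace \<Omega> v \<tau>"
  obtains \<theta> :: "nat \<Rightarrow> 'a \<Rightarrow> complex" where "\<And>n. \<theta> n \<in> test_functions \<Omega>"
    "(\<lambda>n. H1_err (\<theta> n) (\<lambda>x. V x - v x) (\<lambda>b x. wderiv \<Omega> b V x - wderiv \<Omega> b v x)) \<longlonglongrightarrow> 0"
proof -
  define w where "w = (\<lambda>x. V x - v x)"
  define g where "g = (\<lambda>b x. wderiv \<Omega> b V x - wderiv \<Omega> b v x)"
  have HV: "V \<in> H1 \<Omega>" and Hv: "v \<in> H1 \<Omega>" and \<tau>: "\<tau> \<in> L2 (surface \<Omega>)"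
    using V v by (auto simp: has_trace_def)
  obtain \<phi> :: "nat \<Rightarrow> 'a \<Rightarrow> complex" where \<phi>: "\<And>n. smooth (\<phi> n)" "(\<lambda>n. L2_sq M (\<lambda>x. \<phi> n x - V x)) \<longlonglongrightarrow> 0"
    "\<And>b. b \<in> Basis \<Longrightarrow> (\<lambda>n. L2_sq M (\<lambda>x. dderiv b (\<phi> n) x - wderiv \<Omega> b V x)) \<longlonglongrightarrow> 0"
    "(\<lambda>n. L2_sq (surface \<Omega>) (\<lambda>x. \<phi> n x - \<tau> x)) \<longlonglongrightarrow> 0"
    by (rule has_trace_approx[OF V]) blast
  obtain \<psi> :: "nat \<Rightarrow> 'a \<Rightarrow> complex" where \<psi>: "\<And>n. smooth (\<psi> n)" "(\<lambda>n. L2_sq M (\<lambda>x. \<psi> n x - v x)) \<longlonglongrightarrow> 0"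
    "\<And>b. b \<in> Basis \<Longrightarrow> (\<lambda>n. L2_sq M (\<lambda>x. dderiv b (\<psi> n) x - wderiv \<Omega> b v x)) \<longlonglongrightarrow> 0"
    "(\<lambda>n. L2_sq (surface \<Omega>) (\<lambda>x. \<psi> n x - \<tau> x)) \<longlonglongrightarrow> 0"
    by (rule has_trace_approx[OF v]) blast
  define h where "h = (\<lambda>n x. \<phi> n x - \<psi> n x)"
  have hs: "smooth (h n)" for n unfolding h_def by (intro smooth_diff \<phi> \<psi>)
  have w: "w \<in> L2 M" unfolding w_def by (intro L2_diff H1_L2 HV Hv)
  have g: "g b \<in> L2 M" if "b \<in> Basis" for b
    unfolding g_def by (intro L2_diff wderiv_L2_weak HV Hv that)
  have E: "(\<lambda>n. H1_err (h n) w g) \<longlonglongrightarrow> 0"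
  proof -
    have "(\<lambda>n. L2_sq M (\<lambda>x. (\<phi> n x - V x) - (\<psi> n x - v x))) \<longlonglongrightarrow> 0"
      by (intro L2_sq_diff_tendsto_0 \<phi> \<psi> borel_measurable_diff smooth_measurable_M L2_measurable H1_L2 HV Hv)
    then have 1: "(\<lambda>n. L2_sq M (\<lambda>x. h n x - w x)) \<longlonglongrightarrow> 0" by (simp add: h_def w_def algebra_simps)
    have 2: "(\<lambda>n. L2_sq M (\<lambda>x. dderiv b (h n) x - g b x)) \<longlonglongrightarrow> 0" if b: "b \<in> Basis" for b
    proof -
      have "(\<lambda>n. L2_sq M (\<lambda>x. (dderiv b (\<phi> n) x - wderiv \<Omega> b V x) - (dderiv b (\<psi> n) x - wderiv \<Omega> b v x))) \<longlonglongrightarrow> 0"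
        by (intro L2_sq_diff_tendsto_0 \<phi> \<psi> b borel_measurable_diff smooth_measurable_M smooth_dderiv L2_measurable
            wderiv_L2_weak HV Hv)
      moreover have "dderiv b (h n) x = dderiv b (\<phi> n) x - dderiv b (\<psi> n) x" for n x
        unfolding h_def by (intro dderiv_diff smooth_differentiable \<phi> \<psi>)
      then have "(dderiv b (\<phi> n) x - wderiv \<Omega> b V x) - (dderiv b (\<psi> n) x - wderiv \<Omega> b v x) = dderiv b (h n) x - g b x" for n x
        by (simp add: g_def)
      ultimately show ?thesis by (simp only:)
    qed
    have "(\<lambda>n. H1_err (h n) w g) \<longlonglongrightarrow> 0 + (\<Sum>b\<in>(Basis :: 'a set). 0)"
      unfolding H1_err_def by (intro tendsto_add tendsto_sum 1 2)
    then show ?thesis by simp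
  qed
  have S: "(\<lambda>n. L2_sq (surface \<Omega>) (h n)) \<longlonglongrightarrow> 0"
  proof -
    have "(\<lambda>n. L2_sq (surface \<Omega>) (\<lambda>x. (\<phi> n x - \<tau> x) - (\<psi> n x - \<tau> x))) \<longlonglongrightarrow> 0"
      by (intro L2_sq_diff_tendsto_0 \<phi> \<psi> borel_measurable_diff borel_measurable_surface smooth_measurable L2_measurable \<tau>)
    then show ?thesis by (simp add: h_def)
  qed
  obtain \<kappa> c t\<^sub>1 C where k: "0 \<le> \<kappa>" "0 < t\<^sub>1" "0 \<le> c" "0 \<le> C" and cut:
    "\<And>t \<psi> w g. 0 < t \<Longrightarrow> t < t\<^sub>1 \<Longrightarrow> smooth \<psi> \<Longrightarrow> w \<in> L2 M \<Longrightarrow> (\<And>b. b \<in> Basis \<Longrightarrow> g b \<in> L2 M) \<Longrightarrow>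
       \<exists>\<theta>\<in>test_functions \<Omega>. H1_err \<theta> w g \<le> ennreal c * (H1_err \<psi> w g + layer_err (\<kappa> * t) w g)
         + ennreal (C / t) * L2_sq (surface \<Omega>) \<psi>"
    by (rule cutoff_error) blast
  have main: "\<exists>\<theta>. \<theta> \<in> test_functions \<Omega> \<and> H1_err \<theta> w g < e" if e: "0 < e" for e
  proof -
    define s where "s = (\<lambda>k. t\<^sub>1 / 2 * inverse (real (Suc k)))"
    have s: "0 < s k" "s k < t\<^sub>1" for k
    proof -
      show "0 < s k" using k by (simp add: s_def)
      have "t\<^sub>1 / 2 * inverse (real (Suc k)) \<le> t\<^sub>1 / 2 * 1" using k by (intro mult_left_mono) (auto simp: field_simps)
      then show "s k < t\<^sub>1" using k by (simp add: s_def)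
    qed
    have "(\<lambda>k. \<kappa> * s k) \<longlonglongrightarrow> \<kappa> * (t\<^sub>1 / 2 * 0)"
      unfolding s_def by (intro tendsto_intros LIMSEQ_inverse_real_of_nat)
    then have "(\<lambda>k. \<kappa> * s k) \<longlonglongrightarrow> 0" by simp
    from ennreal_tendsto_cmult[OF _ layer_err_tendsto_0[OF w g this], of "ennreal c"]
    have "(\<lambda>k. ennreal c * layer_err (\<kappa> * s k) w g) \<longlonglongrightarrow> 0" by simp
    from order_tendstoD(2)[OF this e] obtain k where k: "ennreal c * layer_err (\<kappa> * s k) w g < e"
      unfolding eventually_sequentially by blast
    \<comment> \<open>The width \<open>s k\<close> is fixed before \<open>n\<close> grows, so that
      the factor \<open>C / s k\<close> of the surface term is a constant.\<close>
    have "(\<lambda>n. ennreal c * (H1_err (h n) w g + layer_err (\<kappa> * s k) w g) + ennreal (C / s k) * L2_sq (surface \<Omega>) (h n))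
       \<longlonglongrightarrow> ennreal c * (0 + layer_err (\<kappa> * s k) w g) + ennreal (C / s k) * 0"
      by (intro tendsto_add ennreal_tendsto_cmult E S tendsto_const) auto
    from order_tendstoD(2)[OF this, of e] k
    obtain n where n: "ennreal c * (H1_err (h n) w g + layer_err (\<kappa> * s k) w g) + ennreal (C / s k) * L2_sq (surface \<Omega>) (h n) < e"
      unfolding eventually_sequentially by auto
    obtain \<theta> where "\<theta> \<in> test_functions \<Omega>"
      "H1_err \<theta> w g \<le> ennreal c * (H1_err (h n) w g + layer_err (\<kappa> * s k) w g) + ennreal (C / s k) * L2_sq (surface \<Omega>) (h n)"
      using cut[where g=g, OF s[of k] hs[of n] w g] by blast
    with n show ?thesis by (meson le_less_trans)
  qed
  have "\<exists>\<theta>. \<theta> \<in> test_functions \<Omega> \<and> H1_err \<theta> w g < ennreal (inverse (real (Suc n)))" for n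
    by (rule main) simp
  then obtain \<theta> where \<theta>: "\<And>n. \<theta> n \<in> test_functions \<Omega>" "\<And>n. H1_err (\<theta> n) w g < ennreal (inverse (real (Suc n)))"
    by metis
  have "(\<lambda>n. H1_err (\<theta> n) w g) \<longlonglongrightarrow> 0"
  proof (rule tendsto_sandwich[OF _ _ tendsto_const])
    show "(\<lambda>n. ennreal (inverse (real (Suc n)))) \<longlonglongrightarrow> 0"
      using tendsto_ennrealI[OF LIMSEQ_inverse_real_of_nat] by simp
    show "\<forall>\<^sub>F n in sequentially. H1_err (\<theta> n) w g \<le> ennreal (inverse (real (Suc n)))"
      using \<theta>(2) by (intro always_eventually) (auto intro: less_imp_le)
  qed auto
  then show ?thesis using that \<theta>(1) unfolding w_def g_def by blast
qed

section \<open>Normal derivatives and the reciprocity gap\<close>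

lemma H1_err_tendsto_0_D:
  assumes "(\<lambda>n. H1_err (\<theta> n) w g) \<longlonglongrightarrow> 0"
  shows "(\<lambda>n. L2_sq M (\<lambda>x. \<theta> n x - w x)) \<longlonglongrightarrow> 0"
    "b \<in> Basis \<Longrightarrow> (\<lambda>n. L2_sq M (\<lambda>x. dderiv b (\<theta> n) x - g b x)) \<longlonglongrightarrow> 0"
  using H1_err_ge
  by (auto intro!: tendsto_sandwich[OF _ _ tendsto_const assms] always_eventually)

text \<open>Both sides of the weak equation are L2 pairings with the test function or its
  derivatives, so the equation may be tested with any H1 limit of test functions.\<close>

lemma weak_laplacian_limit:
  assumes "u \<in> H1 \<Omega>" "k \<in> L2 M" "has_weak_laplacian \<Omega> u k" "\<And>n. \<theta> n \<in> test_functions \<Omega>"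
    "(\<lambda>n. H1_err (\<theta> n) w g) \<longlonglongrightarrow> 0" "w \<in> L2 M" "\<And>b. b \<in> Basis \<Longrightarrow> g b \<in> L2 M"
  shows "(\<Sum>b\<in>Basis. LINT x|M. wderiv \<Omega> b u x * g b x) = - (LINT x|M. k x * w x)"
proof -
  have 1: "(\<lambda>n. \<Sum>b\<in>Basis. LINT x|M. wderiv \<Omega> b u x * dderiv b (\<theta> n) x)
      \<longlonglongrightarrow> (\<Sum>b\<in>Basis. LINT x|M. wderiv \<Omega> b u x * g b x)"
    by (intro tendsto_sum tendsto_integral_L2 H1_err_tendsto_0_D[OF assms(5)] wderiv_L2_weak test_dderiv_L2 assms)
  have 2: "(\<lambda>n. - (LINT x|M. k x * \<theta> n x)) \<longlonglongrightarrow> - (LINT x|M. k x * w x)"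
    by (intro tendsto_minus tendsto_integral_L2 H1_err_tendsto_0_D[OF assms(5)] test_L2 assms)
  have "(\<Sum>b\<in>Basis. LINT x|M. wderiv \<Omega> b u x * dderiv b (\<theta> n) x) = - (LINT x|M. k x * \<theta> n x)" for n
    using assms(3,4) grad_dot_test[OF assms(1,4)] unfolding has_weak_laplacian_def by metis
  with 1 2 show ?thesis using LIMSEQ_unique by simp
qed

text \<open>The difference of two liftings is a limit of test functions, against which the weak
  equation holds. This makes \<open>normal_deriv\<close> computable although it picks its lifting by
  \<open>SOME\<close>.\<close>

lemma green_independent_of_lifting:
  assumes u: "u \<in> H1 \<Omega>" and k: "k \<in> L2 M" "has_weak_laplacian \<Omega> u k"
    and V: "has_trace \<Omega> V \<tau>" and v: "has_trace \<Omega> v \<tau>"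
  shows "grad_dot \<Omega> u V + (LINT x|M. k x * V x) = grad_dot \<Omega> u v + (LINT x|M. k x * v x)"
proof -
  have HV: "V \<in> H1 \<Omega>" and Hv: "v \<in> H1 \<Omega>" using V v by (auto simp: has_trace_def)
  obtain \<theta> :: "nat \<Rightarrow> 'a \<Rightarrow> complex" where \<theta>: "\<And>n. \<theta> n \<in> test_functions \<Omega>"
    "(\<lambda>n. H1_err (\<theta> n) (\<lambda>x. V x - v x) (\<lambda>b x. wderiv \<Omega> b V x - wderiv \<Omega> b v x)) \<longlonglongrightarrow> 0"
    by (rule trace_diff_approx[OF V v]) blast
  have "(\<Sum>b\<in>Basis. LINT x|M. wderiv \<Omega> b u x * (wderiv \<Omega> b V x - wderiv \<Omega> b v x)) = - (LINT x|M. k x * (V x - v x))"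
    by (rule weak_laplacian_limit[OF u k \<theta>]) (intro L2_diff H1_L2 HV Hv wderiv_L2_weak; assumption)+
  moreover have "(LINT x|M. k x * (V x - v x)) = (LINT x|M. k x * V x) - (LINT x|M. k x * v x)"
    using L2_mult_integrable[OF k(1) H1_L2[OF HV]] L2_mult_integrable[OF k(1) H1_L2[OF Hv]]
    by (simp add: right_diff_distrib)
  moreover have "(\<Sum>b\<in>Basis. LINT x|M. wderiv \<Omega> b u x * (wderiv \<Omega> b V x - wderiv \<Omega> b v x))
      = grad_dot \<Omega> u V - grad_dot \<Omega> u v"
    unfolding grad_dot_sum[OF u HV] grad_dot_sum[OF u Hv] sum_subtractf[symmetric]
  proof (rule sum.cong[OF refl])
    fix b :: 'a assume b: "b \<in> Basis"
    show "(LINT x|M. wderiv \<Omega> b u x * (wderiv \<Omega> b V x - wderiv \<Omega> b v x))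
      = (LINT x|M. wderiv \<Omega> b u x * wderiv \<Omega> b V x) - (LINT x|M. wderiv \<Omega> b u x * wderiv \<Omega> b v x)"
      using L2_mult_integrable[OF wderiv_L2_weak(1)[OF u b] wderiv_L2_weak(1)[OF HV b]]
        L2_mult_integrable[OF wderiv_L2_weak(1)[OF u b] wderiv_L2_weak(1)[OF Hv b]]
      by (simp add: right_diff_distrib)
  qed
  ultimately show ?thesis by (simp add: algebra_simps add_eq_0_iff2)
qed

lemma wlaplacian_AE_eq:
  assumes "k \<in> L2 M" "has_weak_laplacian \<Omega> u k"
  shows "wlaplacian \<Omega> u \<in> L2 M" "AE x in M. wlaplacian \<Omega> u x = k x"
proof -
  have "\<exists>k. k \<in> L2 M \<and> has_weak_laplacian \<Omega> u k" using assms by blast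
  from someI_ex[OF this] have *: "wlaplacian \<Omega> u \<in> L2 M" "has_weak_laplacian \<Omega> u (wlaplacian \<Omega> u)"
    by (auto simp: wlaplacian_def)
  show "wlaplacian \<Omega> u \<in> L2 M" by (rule *)
  show "AE x in M. wlaplacian \<Omega> u x = k x"
    by (rule L2_eq_if_tests[OF *(1) assms(1)])
      (use *(2) assms(2) in \<open>auto simp: has_weak_laplacian_def\<close>)
qed

lemma normal_deriv_eq:
  assumes u: "u \<in> H1 \<Omega>" and k: "k \<in> L2 M" "has_weak_laplacian \<Omega> u k" and v: "has_trace \<Omega> v \<tau>"
  shows "normal_deriv \<Omega> u \<tau> = grad_dot \<Omega> u v + (LINT x|M. k x * v x)"
proof -
  define V where "V = (SOME v. has_trace \<Omega> v \<tau>)"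
  have V: "has_trace \<Omega> V \<tau>" unfolding V_def by (rule someI[of "\<lambda>v. has_trace \<Omega> v \<tau>", OF v])
  then have mV: "V \<in> borel_measurable M" by (intro L2_measurable H1_L2) (simp add: has_trace_def)
  note l = wlaplacian_AE_eq[OF k]
  have "(LINT x|M. wlaplacian \<Omega> u x * V x) = (LINT x|M. k x * V x)"
  proof (rule integral_cong_AE)
    show "AE x in M. wlaplacian \<Omega> u x * V x = k x * V x" using l(2) by eventually_elim simp
  qed (intro borel_measurable_times L2_measurable l k mV)+
  then have "normal_deriv \<Omega> u \<tau> = grad_dot \<Omega> u V + (LINT x|M. k x * V x)"
    by (simp add: normal_deriv_def V_def[symmetric])
  then show ?thesis using green_independent_of_lifting[OF u k V v] by simp
qed

text \<open>\<open>u\<close> and \<open>v\<close> serve as liftings of their own traces, whichever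
  representatives \<open>bdry_trace\<close> selects. The gradient terms cancel by symmetry of
  \<open>grad_dot\<close>, and harmonicity of \<open>v\<close> leaves only the pairing with
  \<open>k\<close>.\<close>

lemma reciprocity_gap_eq:
  assumes u: "has_trace \<Omega> u f" and k: "k \<in> L2 M" "has_weak_laplacian \<Omega> u k"
    and v: "has_trace \<Omega> v g" and h: "has_weak_laplacian \<Omega> v (\<lambda>_. 0)"
  shows "reciprocity_gap \<Omega> u v = (LINT x|M. k x * v x)"
proof -
  have Hu: "u \<in> H1 \<Omega>" and Hv: "v \<in> H1 \<Omega>" using u v by (auto simp: has_trace_def)
  have tu: "has_trace \<Omega> u (bdry_trace \<Omega> u)" and tv: "has_trace \<Omega> v (bdry_trace \<Omega> v)"
    unfolding bdry_trace_def using someI[of "has_trace \<Omega> u", OF u] someI[of "has_trace \<Omega> v", OF v] by auto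
  have "grad_dot \<Omega> v u = grad_dot \<Omega> u v" by (simp add: grad_dot_def mult.commute)
  then show ?thesis
    unfolding reciprocity_gap_def normal_deriv_eq[OF Hu k tv] normal_deriv_eq[OF Hv L2_zero h tu] by simp
qed

text \<open>Integrating the divergence of v grad \<phi> - \<phi> grad v shows that v times the
  Laplacian of \<phi> has integral 0; the weak derivatives of \<open>v\<close>, tested with
  \<open>dderiv b \<phi>\<close>, turn this into the claim. The classical derivatives of
  \<open>v\<close> occur only multiplied by \<phi> and are never compared with
  \<open>wderiv\<close>.\<close>

lemma harmonic_has_weak_laplacian:
  assumes v: "v \<in> H1 \<Omega>" and h: "harmonic_on \<Omega> v"
  shows "has_weak_laplacian \<Omega> v (\<lambda>_. 0)"
  unfolding has_weak_laplacian_def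
proof
  fix \<phi> assume \<phi>: "\<phi> \<in> test_functions \<Omega>"
  then obtain K where K: "compact K" "K \<subseteq> \<Omega>" "\<And>x. x \<notin> K \<Longrightarrow> \<phi> x = 0"
    unfolding test_functions_iff by blast
  have s\<phi>: "smooth \<phi>" by (rule test_smooth[OF \<phi>])
  have dv: "v differentiable (at x)" "b \<in> Basis \<Longrightarrow> dderiv b v differentiable (at x)" if "x \<in> \<Omega>" for x b
    using h that by (auto simp: harmonic_on_def)
  have cv: "continuous_on \<Omega> v" "b \<in> Basis \<Longrightarrow> continuous_on \<Omega> (dderiv b v)" for b
    using dv by (meson differentiable_imp_continuous_within continuous_at_imp_continuous_on)+
  define F where "F = (\<lambda>b x. v x * dderiv b \<phi> x - dderiv b v x * \<phi> x)"
  define G where "G = (\<lambda>b x. v x * dderiv b (dderiv b \<phi>) x - dderiv b (dderiv b v) x * \<phi> x)"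
  have z: "\<phi> x = 0" "dderiv b \<phi> x = 0" "dderiv b (dderiv b \<phi>) x = 0" if "x \<notin> K" for x b
    using K that dderiv_zero_outside[OF K(1)] by metis+
  have oK: "open (- K)" using compact_imp_closed[OF K(1)] by (simp add: open_Compl)
  have F: "F b differentiable (at x)" "dderiv b (F b) x = G b x" if b: "b \<in> Basis" for b x
  proof -
    have "F b differentiable (at x) \<and> dderiv b (F b) x = G b x"
    proof (cases "x \<in> \<Omega>")
      case True
      note d = dv(1)[OF True] dv(2)[OF True b] smooth_differentiable[OF s\<phi>, of x]
        smooth_differentiable[OF smooth_dderiv[OF s\<phi> b], of x]
      have "F b differentiable (at x)"
        unfolding F_def by (intro differentiable_diff differentiable_mult d)
      moreover have "dderiv b (F b) x = G b x"
        unfolding F_def G_def using d by (simp add: dderiv_diff dderiv_mult differentiable_mult algebra_simps)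
      ultimately show ?thesis by blast
    next
      case False
      then have x: "x \<in> - K" using K(2) by blast
      have F0: "F b y = 0" if "y \<in> - K" for y using z that by (simp add: F_def)
      have "F b differentiable (at x)"
        using differentiable_const[of 0 "at x"] has_derivative_transform_within_open[OF _ oK x, of "\<lambda>_. 0" _ UNIV "F b"] F0
        unfolding differentiable_def by (metis)
      moreover have "dderiv b (F b) x = dderiv b (\<lambda>_. 0) x"
        by (rule dderiv_cong_open[OF oK x]) (rule F0)
      ultimately show ?thesis using z x by (simp add: dderiv_const G_def)
    qed
    then show "F b differentiable (at x)" "dderiv b (F b) x = G b x" by auto
  qed
  \<comment> \<open>\<open>v\<close> is uncontrolled outside \<Omega>; continuity is glued from the
    open sets \<Omega> and \<open>- K\<close>, on the second of which \<open>G b\<close>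
    vanishes.\<close>
  have cG: "continuous_on UNIV (G b)" if b: "b \<in> Basis" for b
  proof -
    have 1: "continuous_on \<Omega> (G b)"
    proof -
      have "continuous_on \<Omega> (dderiv b (dderiv b v))" using h b by (simp add: harmonic_on_def)
      then show ?thesis
        unfolding G_def
        by (intro continuous_intros cv(1) smooth_continuous[OF s\<phi>]
          smooth_continuous[OF smooth_dderiv[OF smooth_dderiv[OF s\<phi> b] b]])
    qed
    have "continuous_on (- K) (G b) = continuous_on (- K) (\<lambda>_. 0 :: complex)"
      by (rule continuous_on_cong) (use z in \<open>auto simp: G_def\<close>)
    then have "continuous_on (\<Omega> \<union> - K) (G b)"
      using 1 open_domain oK by (intro continuous_on_open_Un) auto
    moreover have "\<Omega> \<union> - K = UNIV" using K(2) by blast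
    ultimately show ?thesis by simp
  qed
  have G0: "G b x = 0" if "x \<notin> K" for b x using z that by (simp add: G_def)
  have intG: "integrable lborel (G b)" if "b \<in> Basis" for b
    by (rule integrable_compact_support[OF cG[OF that] K(1) G0])
  have int0: "(LINT x|lborel. G b x) = 0" if b: "b \<in> Basis" for b
  proof -
    have "dderiv b (F b) = G b" using F(2)[OF b] by blast
    then show ?thesis
      using integral_dderiv_eq_0[of "F b" b K, OF F(1)[OF b] _ K(1)] cG[OF b] z by (simp add: F_def)
  qed
  have m: "(\<lambda>x. v x * dderiv b (dderiv b \<phi>) x) \<in> borel_measurable borel" if b: "b \<in> Basis" for b
  proof -
    have "continuous_on (\<Omega> \<union> - K) (\<lambda>x. v x * dderiv b (dderiv b \<phi>) x)"
    proof (rule continuous_on_open_Un[OF open_domain oK])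
      show "continuous_on \<Omega> (\<lambda>x. v x * dderiv b (dderiv b \<phi>) x)"
        by (intro continuous_intros cv smooth_continuous smooth_dderiv s\<phi> b)
      have "continuous_on (- K) (\<lambda>x. v x * dderiv b (dderiv b \<phi>) x) = continuous_on (- K) (\<lambda>_. 0 :: complex)"
        by (rule continuous_on_cong) (use z in auto)
      then show "continuous_on (- K) (\<lambda>x. v x * dderiv b (dderiv b \<phi>) x)" by simp
    qed
    moreover have "\<Omega> \<union> - K = UNIV" using K(2) by blast
    ultimately show ?thesis by (intro borel_measurable_continuous_onI) simp
  qed
  have "0 = (\<Sum>b\<in>Basis. LINT x|lborel. G b x)" using int0 by simp
  also have "\<dots> = (LINT x|lborel. (\<Sum>b\<in>Basis. G b x))"
    by (rule Bochner_Integration.integral_sum[symmetric]) (rule intG)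
  finally have "(LINT x|lborel. (\<Sum>b\<in>Basis. G b x)) = 0" by simp
  moreover have "(\<Sum>b\<in>Basis. G b x) = (\<Sum>b\<in>Basis. v x * dderiv b (dderiv b \<phi>) x)" for x
  proof (cases "x \<in> \<Omega>")
    case True
    then have "(\<Sum>b\<in>Basis. dderiv b (dderiv b v) x) = 0" using h by (simp add: harmonic_on_def)
    then show ?thesis by (simp add: G_def sum_subtractf flip: sum_distrib_right)
  next
    case False
    then have "x \<notin> K" using K by blast
    then show ?thesis using z by (simp add: G_def)
  qed
  moreover have "grad_dot \<Omega> v \<phi> = - (LINT x|lborel. (\<Sum>b\<in>Basis. v x * dderiv b (dderiv b \<phi>) x))"
  proof -
    have "(LINT x|M. wderiv \<Omega> b v x * dderiv b \<phi> x) = - (LINT x|M. v x * dderiv b (dderiv b \<phi>) x)" if b: "b \<in> Basis" for b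
      using wderiv_L2_weak(2)[OF v b] test_dderiv[OF \<phi> b] unfolding has_weak_dderiv_def by simp
    then have "grad_dot \<Omega> v \<phi> = - (\<Sum>b\<in>Basis. LINT x|M. v x * dderiv b (dderiv b \<phi>) x)"
      unfolding grad_dot_test[OF v \<phi>] by (simp add: sum_negf)
    also have "(\<Sum>b\<in>Basis. LINT x|M. v x * dderiv b (dderiv b \<phi>) x) = (LINT x|M. (\<Sum>b\<in>Basis. v x * dderiv b (dderiv b \<phi>) x))"
      by (rule Bochner_Integration.integral_sum[symmetric])
        (intro L2_mult_integrable H1_L2 v test_L2 test_dderiv \<phi>; assumption)
    also have "\<dots> = (LINT x|lborel. (\<Sum>b\<in>Basis. v x * dderiv b (dderiv b \<phi>) x))"
    proof (rule integral_lebesgue_on_supported[OF domain_sets(1)])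
      show "(\<lambda>x. \<Sum>b\<in>Basis. v x * dderiv b (dderiv b \<phi>) x) \<in> borel_measurable borel"
        by (intro borel_measurable_sum m)
      show "(\<Sum>b\<in>Basis. v x * dderiv b (dderiv b \<phi>) x) = 0" if "x \<notin> \<Omega>" for x
      proof -
        have "x \<notin> K" using K(2) that by blast
        then show ?thesis using z by simp
      qed
    qed
    finally show ?thesis .
  qed
  ultimately show "grad_dot \<Omega> v \<phi> = - (LINT x|M. 0 * \<phi> x)" by simp
qed

end

section \<open>Perturbation by a potential of small support\<close>

context lipschitz_domain
begin

section \<open>A Poincare inequality on strips\<close>

definition strip :: "'a \<Rightarrow> 'a \<Rightarrow> real \<Rightarrow> 'a set" where
  "strip b p \<delta> = {x. \<bar>(x - p) \<bullet> b\<bar> \<le> \<delta>}"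

lemma strip_measurable: "strip b p \<delta> \<in> sets borel"
  unfolding strip_def by (intro borel_closed closed_Collect_le continuous_intros)

text \<open>Going the length \<open>2 * R\<close> in direction \<open>b\<close> leads out of
  \<Omega>, where \<theta> = 0. After the exchange of integrals, each line meets the strip in length
  at most \<open>2 * \<delta>\<close>; the product of the two lengths is the constant.\<close>

lemma strip_estimate_test:
  assumes b: "b \<in> Basis" and R: "0 < R" "\<And>x. x \<in> \<Omega> \<Longrightarrow> norm x < R" and \<theta>: "\<theta> \<in> test_functions \<Omega>" and \<delta>: "0 \<le> \<delta>"
  shows "L2_sq M (\<lambda>x. indicator (strip b p \<delta>) x * \<theta> x) \<le> ennreal (4 * R * \<delta>) * L2_sq M (dderiv b \<theta>)"
proof -
  let ?S = "strip b p \<delta>"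
  have s: "smooth \<theta>" by (rule test_smooth[OF \<theta>])
  define g where "g = (\<lambda>z. ennreal ((cmod (dderiv b \<theta> z))\<^sup>2))"
  have g: "g \<in> borel_measurable borel"
    unfolding g_def using smooth_measurable[OF smooth_dderiv[OF s b]] by simp
  have iS: "(indicator ?S :: 'a \<Rightarrow> ennreal) \<in> borel_measurable borel" using strip_measurable by simp
  have nb: "norm b = 1" using b by simp
  have far: "\<theta> (x + (2 * R) *\<^sub>R b) = 0" if "x \<in> \<Omega>" for x
  proof (rule test_zero_outside[OF \<theta>])
    have "2 * R - norm x \<le> norm (x + (2 * R) *\<^sub>R b)"
      using norm_triangle_ineq4[of "x + (2 * R) *\<^sub>R b" x] R(1) nb by simp
    then show "x + (2 * R) *\<^sub>R b \<notin> \<Omega>" using R(2)[OF that] R(2)[of "x + (2 * R) *\<^sub>R b"] by auto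
  qed
  have pt: "ennreal ((cmod (\<theta> x))\<^sup>2) \<le> ennreal (2 * R) * (\<integral>\<^sup>+\<sigma>. g (x + \<sigma> *\<^sub>R b) * indicator {0..2 * R} \<sigma> \<partial>lborel)" if "x \<in> \<Omega>" for x
    using line_increment_sq[OF s, of "2 * R" x b] far[OF that] R(1) by (simp add: g_def)
  have mI: "(\<lambda>x. \<integral>\<^sup>+\<sigma>. g (x + \<sigma> *\<^sub>R b) * indicator {0..2 * R} \<sigma> \<partial>lborel) \<in> borel_measurable lborel"
  proof -
    have "(\<lambda>(x, \<sigma>). x + \<sigma> *\<^sub>R b) \<in> borel_measurable (lborel \<Otimes>\<^sub>M lborel)" by measurable
    from measurable_compose[OF this g]
    have "(\<lambda>(x, \<sigma>). g (x + \<sigma> *\<^sub>R b) * indicator {0..2 * R} \<sigma>) \<in> borel_measurable (lborel \<Otimes>\<^sub>M lborel)"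
      by (auto simp: case_prod_beta intro!: borel_measurable_times_ennreal)
    then show ?thesis by (rule lborel.borel_measurable_nn_integral)
  qed
  have "L2_sq M (\<lambda>x. indicator ?S x * \<theta> x) = (\<integral>\<^sup>+x. ennreal ((cmod (\<theta> x))\<^sup>2) * indicator ?S x * indicator \<Omega> x \<partial>lborel)"
    unfolding L2_sq_def nn_integral_lebesgue_on[OF domain_sets(1)]
    by (rule nn_integral_cong) (auto simp: indicator_def)
  also have "\<dots> \<le> (\<integral>\<^sup>+x. ennreal (2 * R) * (indicator ?S x * (\<integral>\<^sup>+\<sigma>. g (x + \<sigma> *\<^sub>R b) * indicator {0..2 * R} \<sigma> \<partial>lborel)) \<partial>lborel)"
    using pt by (intro nn_integral_mono) (auto simp: indicator_def)
  also have "\<dots> = ennreal (2 * R) * (\<integral>\<^sup>+x. indicator ?S x * (\<integral>\<^sup>+\<sigma>. g (x + \<sigma> *\<^sub>R b) * indicator {0..2 * R} \<sigma> \<partial>lborel) \<partial>lborel)"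
    using mI iS by (intro nn_integral_cmult borel_measurable_times_ennreal) auto
  also have "\<dots> = ennreal (2 * R) * (\<integral>\<^sup>+z. g z * (\<integral>\<^sup>+\<sigma>. indicator ?S (z - \<sigma> *\<^sub>R b) * indicator {0..2 * R} \<sigma> \<partial>lborel) \<partial>lborel)"
    using nn_integral_line_average[OF iS g, of b "2 * R"] by simp
  also have "\<dots> \<le> ennreal (2 * R) * (\<integral>\<^sup>+z. g z * ennreal (2 * \<delta>) \<partial>lborel)"
  proof (intro mult_left_mono nn_integral_mono)
    fix z
    let ?a = "(z - p) \<bullet> b"
    have "(\<integral>\<^sup>+\<sigma>. indicator ?S (z - \<sigma> *\<^sub>R b) * indicator {0..2 * R} \<sigma> \<partial>lborel) \<le> (\<integral>\<^sup>+\<sigma>. indicator {?a - \<delta>..?a + \<delta>} \<sigma> \<partial>lborel)"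
    proof (rule nn_integral_mono)
      fix \<sigma>
      have "(z - \<sigma> *\<^sub>R b - p) \<bullet> b = ?a - \<sigma>" using b by (simp add: inner_diff_left)
      then show "indicator ?S (z - \<sigma> *\<^sub>R b) * indicator {0..2 * R} \<sigma> \<le> (indicator {?a - \<delta>..?a + \<delta>} \<sigma> :: ennreal)"
        by (auto simp: indicator_def strip_def)
    qed
    also have "\<dots> = ennreal (2 * \<delta>)" using \<delta> by simp
    finally show "(\<integral>\<^sup>+\<sigma>. indicator ?S (z - \<sigma> *\<^sub>R b) * indicator {0..2 * R} \<sigma> \<partial>lborel) \<le> ennreal (2 * \<delta>)" .
  qed auto
  also have "(\<integral>\<^sup>+z. g z * ennreal (2 * \<delta>) \<partial>lborel) = ennreal (2 * \<delta>) * (\<integral>\<^sup>+z. g z \<partial>lborel)"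
    using nn_integral_multc[of g lborel "ennreal (2 * \<delta>)"] g by (simp add: mult.commute)
  also have "(\<integral>\<^sup>+z. g z \<partial>lborel) = L2_sq M (dderiv b \<theta>)"
    unfolding L2_sq_def nn_integral_lebesgue_on[OF domain_sets(1)]
    using test_zero_outside[OF test_dderiv[OF \<theta> b]]
    by (intro nn_integral_cong) (auto simp: indicator_def g_def)
  also have "ennreal (2 * R) * (ennreal (2 * \<delta>) * L2_sq M (dderiv b \<theta>)) = ennreal (4 * R * \<delta>) * L2_sq M (dderiv b \<theta>)"
  proof -
    have eq: "4 * R * \<delta> = (2 * R) * (2 * \<delta>)" by simp
    show ?thesis unfolding eq using R(1) \<delta> by (subst ennreal_mult) (auto simp: mult.assoc)
  qed
  finally show ?thesis .
qed

text \<open>Density carries the inequality over to \<open>w\<close>. The two splittings into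
  approximant and error cost a factor 2 each, which turns 4 into 16.\<close>

lemma strip_estimate:
  assumes b: "b \<in> Basis" and R: "0 < R" "\<And>x. x \<in> \<Omega> \<Longrightarrow> norm x < R" and \<delta>: "0 \<le> \<delta>"
    and \<theta>: "\<And>n. \<theta> n \<in> test_functions \<Omega>" "(\<lambda>n. H1_err (\<theta> n) w g) \<longlonglongrightarrow> 0"
    and w: "w \<in> L2 M" and g: "\<And>b. b \<in> Basis \<Longrightarrow> g b \<in> L2 M"
  shows "L2_sq M (\<lambda>x. indicator (strip b p \<delta>) x * w x) \<le> ennreal (16 * R * \<delta>) * L2_sq M (g b)"
proof (rule LIMSEQ_le_const)
  let ?i = "\<lambda>x. indicator (strip b p \<delta>) x :: complex"
  let ?c = "ennreal (4 * R * \<delta>)"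
  have mi: "?i \<in> borel_measurable M"
    by (intro borel_measurable_lebesgue_on borel_measurable_indicator strip_measurable)
  have mw: "w \<in> borel_measurable M" "g b \<in> borel_measurable M" by (intro L2_measurable w g b)+
  show "(\<lambda>n. 2 * H1_err (\<theta> n) w g + 2 * (?c * (2 * H1_err (\<theta> n) w g + 2 * L2_sq M (g b))))
      \<longlonglongrightarrow> ennreal (16 * R * \<delta>) * L2_sq M (g b)"
  proof -
    have "(\<lambda>n. 2 * H1_err (\<theta> n) w g + 2 * (?c * (2 * H1_err (\<theta> n) w g + 2 * L2_sq M (g b))))
      \<longlonglongrightarrow> 2 * 0 + 2 * (?c * (2 * 0 + 2 * L2_sq M (g b)))"
      by (intro tendsto_add ennreal_tendsto_cmult \<theta> tendsto_const) auto
    moreover have "2 * 0 + 2 * (?c * (2 * 0 + 2 * L2_sq M (g b))) = ennreal (16 * R * \<delta>) * L2_sq M (g b)"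
    proof -
      have "ennreal (16 * R * \<delta>) = ennreal (4 * (4 * R * \<delta>))" by (simp add: mult.assoc)
      also have "\<dots> = 4 * ?c" using R(1) \<delta> by (subst ennreal_mult) auto
      finally show ?thesis by (simp add: mult.assoc mult.left_commute flip: mult.assoc)
    qed
    ultimately show ?thesis by simp
  qed
  have "L2_sq M (\<lambda>x. ?i x * w x) \<le> 2 * H1_err (\<theta> n) w g + 2 * (?c * (2 * H1_err (\<theta> n) w g + 2 * L2_sq M (g b)))" for n
  proof -
    have m\<theta>: "\<theta> n \<in> borel_measurable M" "dderiv b (\<theta> n) \<in> borel_measurable M"
      by (intro smooth_measurable_M smooth_dderiv test_smooth[OF \<theta>(1)] b)+
    have "L2_sq M (\<lambda>x. ?i x * w x) = L2_sq M (\<lambda>x. ?i x * \<theta> n x - ?i x * (\<theta> n x - w x))"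
      by (simp add: algebra_simps)
    also have "\<dots> \<le> 2 * L2_sq M (\<lambda>x. ?i x * \<theta> n x) + 2 * L2_sq M (\<lambda>x. ?i x * (\<theta> n x - w x))"
      by (intro L2_sq_diff_le borel_measurable_times borel_measurable_diff mi m\<theta> mw)
    also have "\<dots> \<le> 2 * (?c * (2 * H1_err (\<theta> n) w g + 2 * L2_sq M (g b))) + 2 * H1_err (\<theta> n) w g"
    proof (intro add_mono mult_left_mono)
      have "L2_sq M (\<lambda>x. ?i x * (\<theta> n x - w x)) \<le> L2_sq M (\<lambda>x. \<theta> n x - w x)"
        by (intro L2_sq_mono_AE AE_I2) (auto simp: indicator_def)
      then show "L2_sq M (\<lambda>x. ?i x * (\<theta> n x - w x)) \<le> H1_err (\<theta> n) w g"
        using H1_err_ge(1) order_trans by blast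
      have "L2_sq M (dderiv b (\<theta> n)) = L2_sq M (\<lambda>x. (dderiv b (\<theta> n) x - g b x) + g b x)" by simp
      also have "\<dots> \<le> 2 * L2_sq M (\<lambda>x. dderiv b (\<theta> n) x - g b x) + 2 * L2_sq M (g b)"
        by (intro L2_sq_add_le borel_measurable_diff m\<theta> mw)
      also have "\<dots> \<le> 2 * H1_err (\<theta> n) w g + 2 * L2_sq M (g b)"
        by (intro add_right_mono mult_left_mono H1_err_ge b) auto
      finally have "L2_sq M (dderiv b (\<theta> n)) \<le> 2 * H1_err (\<theta> n) w g + 2 * L2_sq M (g b)" .
      then show "L2_sq M (\<lambda>x. ?i x * \<theta> n x) \<le> ?c * (2 * H1_err (\<theta> n) w g + 2 * L2_sq M (g b))"
        using strip_estimate_test[OF b R \<theta>(1)[of n] \<delta>, of p] by (meson mult_left_mono order_trans zero_le)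
    qed auto
    finally show ?thesis by (simp add: add.commute)
  qed
  then show "\<exists>N. \<forall>n\<ge>N. L2_sq M (\<lambda>x. ?i x * w x)
      \<le> 2 * H1_err (\<theta> n) w g + 2 * (?c * (2 * H1_err (\<theta> n) w g + 2 * L2_sq M (g b)))" by blast
qed

text \<open>The pairings are bilinear, while the energy identity tests the equation with the
  conjugate of \<open>w\<close>; conjugated approximants converge equally well.\<close>

lemma H1_err_cnj:
  assumes "smooth \<theta>"
  shows "H1_err (\<lambda>x. cnj (\<theta> x)) (\<lambda>x. cnj (w x)) (\<lambda>b x. cnj (g b x)) = H1_err \<theta> w g"
proof -
  have c: "L2_sq M (\<lambda>x. cnj (p x) - cnj (q x)) = L2_sq M (\<lambda>x. p x - q x)" for p q
    unfolding L2_sq_def by (rule nn_integral_cong) (simp flip: complex_cnj_diff)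
  have "dderiv b (\<lambda>x. cnj (\<theta> x)) x = cnj (dderiv b \<theta> x)" for b x
    by (rule dderiv_cnj[OF smooth_differentiable[OF assms]])
  then show ?thesis unfolding H1_err_def by (simp add: c)
qed

text \<open>The energy identity for \<open>w = u - u\<^sub>0\<close> bounds \<open>\<parallel>\<nabla>w\<parallel>\<^sup>2\<close> by a multiple of \<open>\<integral>\<^sub>D |w|\<close>, while a
  one-dimensional Poincare inequality on strips of width \<open>\<delta>\<close> containing \<open>D\<close> bounds
  \<open>(\<integral>\<^sub>D |w|)\<^sup>2\<close> by \<open>\<delta> |D| \<parallel>\<nabla>w\<parallel>\<^sup>2\<close>. Together \<open>\<integral>\<^sub>D |w| = O(\<delta> |D|)\<close>.\<close>

lemma potential_perturbation_bound:
  fixes q :: "'a \<Rightarrow> real" and R P U \<delta> :: real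
  assumes R: "0 < R" "\<And>x. x \<in> \<Omega> \<Longrightarrow> norm x < R" and u: "dirichlet_solution \<Omega> q f u"
    and u0: "harmonic_extension \<Omega> f u0" and k: "(\<lambda>x. of_real (q x) * u x) \<in> L2 M"
    and q: "q \<in> borel_measurable M" "AE x in M. 0 \<le> q x \<and> q x \<le> P * indicator D x"
    and D: "D \<in> sets borel" "D \<subseteq> \<Omega>" "D \<subseteq> (\<Union>j\<in>I. strip b (z j) \<delta>)" and I: "finite I"
    and b: "b \<in> Basis" and \<delta>: "0 \<le> \<delta>" and P: "0 \<le> P" and U: "0 \<le> U" "\<And>x. x \<in> D \<Longrightarrow> cmod (u0 x) \<le> U"
    "\<And>x. x \<in> D \<Longrightarrow> cmod (v x) \<le> U" and v: "v \<in> L2 M"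
  shows "integrable M (\<lambda>x. of_real (q x) * (u x - u0 x) * v x)"
    "cmod (LINT x|M. of_real (q x) * (u x - u0 x) * v x) \<le> (P * U)\<^sup>2 * (card I * (16 * R * \<delta>)) * measure lebesgue D"
proof -
  define w where "w = (\<lambda>x. u x - u0 x)"
  define g where "g = (\<lambda>b x. wderiv \<Omega> b u x - wderiv \<Omega> b u0 x)"
  have Hu: "u \<in> H1 \<Omega>" and Hu0: "u0 \<in> H1 \<Omega>" and tr: "has_trace \<Omega> u f" "has_trace \<Omega> u0 f"
    and lap: "has_weak_laplacian \<Omega> u (\<lambda>x. of_real (q x) * u x)" and har: "harmonic_on \<Omega> u0"
    using u u0 by (auto simp: dirichlet_solution_def harmonic_extension_def)
  have lap0: "has_weak_laplacian \<Omega> u0 (\<lambda>_. 0)" by (rule harmonic_has_weak_laplacian[OF Hu0 har])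
  obtain \<theta> :: "nat \<Rightarrow> 'a \<Rightarrow> complex" where \<theta>: "\<And>n. \<theta> n \<in> test_functions \<Omega>" "(\<lambda>n. H1_err (\<theta> n) w g) \<longlonglongrightarrow> 0"
    unfolding w_def g_def by (rule trace_diff_approx[OF tr]) blast
  have w: "w \<in> L2 M" unfolding w_def by (intro L2_diff H1_L2 Hu Hu0)
  have g: "g b \<in> L2 M" if "b \<in> Basis" for b
    unfolding g_def by (intro L2_diff wderiv_L2_weak Hu Hu0 that)
  have DM: "D \<in> sets M" using D borel_in_lebesgue domain_sets by (simp add: sets_restrict_space_iff)
  have mD: "(indicator D :: 'a \<Rightarrow> complex) \<in> borel_measurable M"
    using DM by simp
  have iD: "(indicator D :: 'a \<Rightarrow> complex) \<in> L2 M"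
    by (rule L2_bounded[OF finite_M mD, of 1]) (auto simp: indicator_def)
  let ?Dw = "\<lambda>x. indicator D x * w x :: complex"
  have Dw: "?Dw \<in> L2 M"
  proof (rule L2_bound[OF w, of _ 1])
    show "?Dw \<in> borel_measurable M" by (intro borel_measurable_times mD L2_measurable[OF w])
  qed (auto simp: indicator_def)
  \<comment> \<open>\<open>Y\<close> and \<open>X\<close> are the integrals of |w| and |w|^2 over
    \<open>D\<close>, \<open>N\<close> is the squared norm of the gradient. Cauchy-Schwarz
    (\<open>YX\<close>), the strip inequality (\<open>XN\<close>) and the energy identity
    (\<open>NY\<close>) form a closed loop that bounds \<open>Y\<close>.\<close>
  define Y where "Y = (LINT x|M. cmod (indicator D x * ?Dw x))"
  define X where "X = (LINT x|M. (cmod (?Dw x))\<^sup>2)"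
  define N where "N = (\<Sum>b\<in>Basis. LINT x|M. (cmod (g b x))\<^sup>2)"
  let ?c = "card I * (16 * R * \<delta>)"
  let ?m = "measure lebesgue D"
  have Y0: "0 \<le> Y" by (simp add: Y_def)
  have intY: "integrable M (\<lambda>x. cmod (indicator D x * ?Dw x))"
    using L2_mult_integrable[OF iD Dw] by (rule integrable_norm)
  have mdom: "(LINT x|M. (cmod (indicator D x))\<^sup>2) = ?m"
  proof -
    have "(LINT x|M. (cmod (indicator D x))\<^sup>2) = (LINT x|M. indicator D x)"
      by (rule Bochner_Integration.integral_cong) (auto simp: indicator_def)
    also have "\<dots> = measure M D" using DM sets.sets_into_space[OF DM] by (simp add: Int_absorb2)
    also have "\<dots> = ?m" using D domain_sets by (simp add: measure_restrict_space)
    finally show ?thesis .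
  qed
  have YX: "Y\<^sup>2 \<le> ?m * X"
    using cauchy_schwarz_L2[OF iD Dw] unfolding Y_def X_def mdom .
  have XN: "X \<le> ?c * N"
  proof -
    have "ennreal X = L2_sq M ?Dw" unfolding X_def by (rule L2_sq_eq_integral[OF Dw, symmetric])
    also have "\<dots> \<le> (\<Sum>j\<in>I. L2_sq M (\<lambda>x. indicator (strip b (z j) \<delta>) x * w x))"
    proof -
      have "L2_sq M ?Dw \<le> (\<integral>\<^sup>+x. (\<Sum>j\<in>I. ennreal ((cmod (indicator (strip b (z j) \<delta>) x * w x))\<^sup>2)) \<partial>M)"
        unfolding L2_sq_def
      proof (rule nn_integral_mono)
        fix x
        show "ennreal ((cmod (?Dw x))\<^sup>2) \<le> (\<Sum>j\<in>I. ennreal ((cmod (indicator (strip b (z j) \<delta>) x * w x))\<^sup>2))"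
        proof (cases "x \<in> D")
          case True
          then obtain j where j: "j \<in> I" "x \<in> strip b (z j) \<delta>" using D(3) by blast
          then have "ennreal ((cmod (?Dw x))\<^sup>2) = ennreal ((cmod (indicator (strip b (z j) \<delta>) x * w x))\<^sup>2)"
            using True by simp
          also have "\<dots> \<le> (\<Sum>j\<in>I. ennreal ((cmod (indicator (strip b (z j) \<delta>) x * w x))\<^sup>2))"
            by (rule member_le_sum[OF j(1) _ I]) simp
          finally show ?thesis .
        qed simp
      qed
      also have "\<dots> = (\<Sum>j\<in>I. L2_sq M (\<lambda>x. indicator (strip b (z j) \<delta>) x * w x))"
        unfolding L2_sq_def
      proof (rule nn_integral_sum)
        fix j
        have "(\<lambda>x. indicator (strip b (z j) \<delta>) x * w x) \<in> borel_measurable M"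
          by (intro borel_measurable_times L2_measurable[OF w] borel_measurable_lebesgue_on
              borel_measurable_indicator strip_measurable)
        then show "(\<lambda>x. ennreal ((cmod (indicator (strip b (z j) \<delta>) x * w x))\<^sup>2)) \<in> borel_measurable M" by simp
      qed
      finally show ?thesis .
    qed
    also have "\<dots> \<le> (\<Sum>j\<in>I. ennreal (16 * R * \<delta>) * L2_sq M (g b))"
      by (intro sum_mono strip_estimate[OF b R \<delta> \<theta> w g])
    also have "\<dots> = (\<Sum>j\<in>I. ennreal (16 * R * \<delta> * (LINT x|M. (cmod (g b x))\<^sup>2)))"
      using R(1) \<delta> by (simp add: L2_sq_eq_integral[OF g[OF b]] ennreal_mult)
    also have "\<dots> = ennreal (\<Sum>j\<in>I. 16 * R * \<delta> * (LINT x|M. (cmod (g b x))\<^sup>2))"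
      using R(1) \<delta> by (intro sum_ennreal) simp
    finally have "X \<le> (\<Sum>j\<in>I. 16 * R * \<delta> * (LINT x|M. (cmod (g b x))\<^sup>2))"
      using R(1) \<delta> by (subst (asm) ennreal_le_iff) (auto intro!: sum_nonneg)
    also have "\<dots> = ?c * (LINT x|M. (cmod (g b x))\<^sup>2)" by simp
    also have "\<dots> \<le> ?c * N"
      unfolding N_def using R(1) \<delta> b by (intro mult_left_mono member_le_sum) auto
    finally show ?thesis .
  qed
  have mq: "(\<lambda>x. complex_of_real (q x)) \<in> borel_measurable M" using q(1) by simp
  \<comment> \<open>Used with \<open>cnj (w x)\<close> and \<open>u0\<close> in the energy identity
    and with \<open>w\<close> and \<open>v\<close> in the conclusion; only the modulus of
    \<open>w'\<close> enters.\<close>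
  have bd: "integrable M (\<lambda>x. of_real (q x) * w' x * v' x)"
    "cmod (LINT x|M. of_real (q x) * w' x * v' x) \<le> P * U * Y"
    if w': "w' \<in> borel_measurable M" "\<And>x. cmod (w' x) = cmod (w x)"
      and v': "v' \<in> borel_measurable M" "\<And>x. x \<in> D \<Longrightarrow> cmod (v' x) \<le> U" for w' v'
  proof -
    have m: "(\<lambda>x. of_real (q x) * w' x * v' x) \<in> borel_measurable M"
      by (intro borel_measurable_times mq w' v')
    have le: "AE x in M. cmod (of_real (q x) * w' x * v' x) \<le> P * U * cmod (indicator D x * ?Dw x)"
      using q(2)
    proof eventually_elim
      case (elim x)
      show ?case
      proof (cases "x \<in> D")
        case True
        then have "cmod (of_real (q x) * w' x * v' x) \<le> P * cmod (w x) * U"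
          unfolding norm_mult w'(2) using elim v'(2)[OF True] P by (intro mult_mono) auto
        then show ?thesis using True by (simp add: mult_ac)
      next
        case False
        then show ?thesis using elim by auto
      qed
    qed
    have i: "integrable M (\<lambda>x. P * U * cmod (indicator D x * ?Dw x))"
      by (intro integrable_mult_right intY)
    show int: "integrable M (\<lambda>x. of_real (q x) * w' x * v' x)"
      by (rule Bochner_Integration.integrable_bound[OF i m])
        (use le in eventually_elim, simp add: P U abs_mult)
    have "cmod (LINT x|M. of_real (q x) * w' x * v' x) \<le> (LINT x|M. cmod (of_real (q x) * w' x * v' x))"
      by (rule integral_norm_bound)
    also have "\<dots> \<le> (LINT x|M. P * U * cmod (indicator D x * ?Dw x))"
      by (rule integral_mono_AE[OF integrable_norm[OF int] i le])
    also have "\<dots> = P * U * Y" unfolding Y_def by simp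
    finally show "cmod (LINT x|M. of_real (q x) * w' x * v' x) \<le> P * U * Y" .
  qed
  have NY: "N \<le> P * U * Y"
  proof -
    have c\<theta>: "(\<lambda>x. cnj (\<theta> n x)) \<in> test_functions \<Omega>" for n by (rule test_cnj[OF \<theta>(1)])
    have cE: "(\<lambda>n. H1_err (\<lambda>x. cnj (\<theta> n x)) (\<lambda>x. cnj (w x)) (\<lambda>b x. cnj (g b x))) \<longlonglongrightarrow> 0"
      using \<theta>(2) by (simp add: H1_err_cnj test_smooth[OF \<theta>(1)])
    note lim = weak_laplacian_limit[OF _ _ _ c\<theta> cE L2_cnj[OF w] L2_cnj[OF g]]
    have 1: "(\<Sum>b\<in>Basis. LINT x|M. wderiv \<Omega> b u x * cnj (g b x)) = - (LINT x|M. of_real (q x) * u x * cnj (w x))"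
      by (rule lim[OF Hu k lap]) 
    have 2: "(\<Sum>b\<in>Basis. LINT x|M. wderiv \<Omega> b u0 x * cnj (g b x)) = 0"
      using lim[OF Hu0 L2_zero lap0] by simp
    have "(\<Sum>b\<in>Basis. LINT x|M. wderiv \<Omega> b u x * cnj (g b x)) - (\<Sum>b\<in>Basis. LINT x|M. wderiv \<Omega> b u0 x * cnj (g b x))
        = of_real N"
      unfolding N_def sum_subtractf[symmetric] of_real_sum
    proof (rule sum.cong[OF refl])
      fix b :: 'a assume b: "b \<in> Basis"
      have "(LINT x|M. wderiv \<Omega> b u x * cnj (g b x)) - (LINT x|M. wderiv \<Omega> b u0 x * cnj (g b x))
          = (LINT x|M. wderiv \<Omega> b u x * cnj (g b x) - wderiv \<Omega> b u0 x * cnj (g b x))"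
        by (intro Bochner_Integration.integral_diff[symmetric] L2_mult_integrable wderiv_L2_weak Hu Hu0 L2_cnj g b)
      also have "\<dots> = (LINT x|M. complex_of_real ((cmod (g b x))\<^sup>2))"
        by (rule Bochner_Integration.integral_cong[OF refl])
          (simp only: left_diff_distrib[symmetric] g_def complex_norm_square)
      also have "\<dots> = of_real (LINT x|M. (cmod (g b x))\<^sup>2)"
        by (rule integral_of_real[OF L2_integrable[OF g[OF b]]])
      finally show "(LINT x|M. wderiv \<Omega> b u x * cnj (g b x)) - (LINT x|M. wderiv \<Omega> b u0 x * cnj (g b x))
          = of_real (LINT x|M. (cmod (g b x))\<^sup>2)" .
    qed
    then have N1: "of_real N = - (LINT x|M. of_real (q x) * u x * cnj (w x))" using 1 2 by simp
    have mw: "w \<in> borel_measurable M" "(\<lambda>x. cnj (w x)) \<in> borel_measurable M" "u0 \<in> borel_measurable M"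
      by (intro L2_measurable w L2_cnj H1_L2 Hu0)+
    have i0: "integrable M (\<lambda>x. of_real (q x) * cnj (w x) * u0 x)"
      and b0: "cmod (LINT x|M. of_real (q x) * cnj (w x) * u0 x) \<le> P * U * Y"
      using bd[OF mw(2) _ mw(3) U(2)] by auto
    have i1: "integrable M (\<lambda>x. of_real (q x) * u x * cnj (w x))"
      by (rule L2_mult_integrable[OF k L2_cnj[OF w]])
    have eq: "of_real (q x) * u x * cnj (w x) - of_real (q x) * cnj (w x) * u0 x = complex_of_real (q x * (cmod (w x))\<^sup>2)" for x
    proof -
      have "of_real (q x) * u x * cnj (w x) - of_real (q x) * cnj (w x) * u0 x = of_real (q x) * (w x * cnj (w x))"
        by (simp add: w_def algebra_simps)
      then show ?thesis by (simp only: complex_norm_square[symmetric] of_real_mult[symmetric])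
    qed
    have "(LINT x|M. of_real (q x) * u x * cnj (w x)) - (LINT x|M. of_real (q x) * cnj (w x) * u0 x)
        = (LINT x|M. complex_of_real (q x * (cmod (w x))\<^sup>2))"
      unfolding Bochner_Integration.integral_diff[OF i1 i0, symmetric] eq ..
    also have "\<dots> = of_real (LINT x|M. q x * (cmod (w x))\<^sup>2)"
    proof (rule integral_of_real)
      from integrable_Re[OF Bochner_Integration.integrable_diff[OF i1 i0, unfolded eq]]
      show "integrable M (\<lambda>x. q x * (cmod (w x))\<^sup>2)" by (simp only: Re_complex_of_real)
    qed
    finally have "of_real N = - (LINT x|M. of_real (q x) * cnj (w x) * u0 x) - complex_of_real (LINT x|M. q x * (cmod (w x))\<^sup>2)"
      unfolding N1 by (simp add: algebra_simps)
    then have "N = Re (- (LINT x|M. of_real (q x) * cnj (w x) * u0 x) - complex_of_real (LINT x|M. q x * (cmod (w x))\<^sup>2))"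
      by (metis Re_complex_of_real)
    also have "\<dots> = - Re (LINT x|M. of_real (q x) * cnj (w x) * u0 x) - (LINT x|M. q x * (cmod (w x))\<^sup>2)" by simp
    also have "0 \<le> (LINT x|M. q x * (cmod (w x))\<^sup>2)"
      by (rule integral_nonneg_AE) (use q(2) in \<open>eventually_elim, simp\<close>)
    then have "- Re (LINT x|M. of_real (q x) * cnj (w x) * u0 x) - (LINT x|M. q x * (cmod (w x))\<^sup>2)
        \<le> cmod (LINT x|M. of_real (q x) * cnj (w x) * u0 x)"
      using abs_Re_le_cmod[of "LINT x|M. of_real (q x) * cnj (w x) * u0 x"] by linarith
    finally show ?thesis using b0 by linarith
  qed
  \<comment> \<open>Going once around the loop gives a bound linear in \<open>Y\<close>, so a factor
    \<open>Y\<close> cancels unless it is 0.\<close>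
  have "Y * Y \<le> (P * U * ?c * ?m) * Y"
  proof -
    have c0: "0 \<le> ?c" using R(1) \<delta> by simp
    have "Y * Y \<le> ?m * X" using YX by (simp add: power2_eq_square)
    also have "\<dots> \<le> ?m * (?c * (P * U * Y))"
      by (intro mult_left_mono order_trans[OF XN mult_left_mono[OF NY c0]]) auto
    finally show ?thesis by (simp add: mult_ac)
  qed
  then have Yle: "Y \<le> P * U * ?c * ?m"
  proof (cases "Y = 0")
    case True
    then show ?thesis using P U(1) R(1) \<delta> by simp
  next
    case False
    then show ?thesis using Y0 \<open>Y * Y \<le> (P * U * ?c * ?m) * Y\<close> by (simp add: mult_le_cancel_right)
  qed
  have mw: "w \<in> borel_measurable M" "v \<in> borel_measurable M" by (intro L2_measurable w v)+
  note fin = bd[OF mw(1) refl mw(2) U(3)]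
  show "integrable M (\<lambda>x. of_real (q x) * (u x - u0 x) * v x)" using fin(1) by (simp add: w_def)
  have "cmod (LINT x|M. of_real (q x) * w x * v x) \<le> P * U * (P * U * ?c * ?m)"
    using fin(2) mult_left_mono[OF Yle, of "P * U"] P U(1) by simp
  then show "cmod (LINT x|M. of_real (q x) * (u x - u0 x) * v x) \<le> (P * U)\<^sup>2 * ?c * ?m"
    by (simp add: w_def power2_eq_square mult_ac)
qed

end

section \<open>The asymptotic expansion\<close>

text \<open>The ball is compact and convex: the partial derivatives are bounded on it, and the sum
  of their bounds dominates the operator norm in the mean value inequality.\<close>

lemma C1_lipschitz_on_cball:
  fixes h :: "'a::euclidean_space \<Rightarrow> complex"
  assumes sub: "cball p \<eta> \<subseteq> \<Omega>" and h: "\<And>x. x \<in> \<Omega> \<Longrightarrow> h differentiable (at x)"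
    and c: "\<And>b. b \<in> Basis \<Longrightarrow> continuous_on \<Omega> (dderiv b h)"
  shows "\<exists>L\<ge>0. \<forall>y\<in>cball p \<eta>. cmod (h y - h p) \<le> L * dist y p"
proof -
  have "\<exists>C\<ge>0. \<forall>z\<in>cball p \<eta>. cmod (dderiv b h z) \<le> C" if b: "b \<in> Basis" for b
  proof -
    have "compact (dderiv b h ` cball p \<eta>)"
      by (intro compact_continuous_image continuous_on_subset[OF c[OF b] sub]) auto
    from compact_imp_bounded[OF this] show ?thesis
      unfolding bounded_pos by (metis image_eqI less_imp_le)
  qed
  then obtain C where C: "\<And>b. b \<in> Basis \<Longrightarrow> 0 \<le> C b" "\<And>b z. b \<in> Basis \<Longrightarrow> z \<in> cball p \<eta> \<Longrightarrow> cmod (dderiv b h z) \<le> C b"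
    by metis
  define L where "L = (\<Sum>b\<in>Basis. C b)"
  have "cmod (h y - h p) \<le> L * dist y p" if y: "y \<in> cball p \<eta>" for y
  proof -
    have "norm (h y - h p) \<le> L * norm (y - p)"
    proof (rule differentiable_bound[where S="cball p \<eta>" and f'="\<lambda>z v. dderiv v h z"])
      fix z assume z: "z \<in> cball p \<eta>"
      then have d: "h differentiable (at z)" using h sub by blast
      show "(h has_derivative (\<lambda>v. dderiv v h z)) (at z within cball p \<eta>)"
        by (rule has_derivative_at_withinI[OF differentiable_has_derivative[OF d]])
      show "onorm (\<lambda>v. dderiv v h z) \<le> L"
      proof (rule onorm_le)
        fix v
        have "cmod (dderiv v h z) \<le> (\<Sum>b\<in>Basis. cmod (of_real (v \<bullet> b) * dderiv b h z))"
          unfolding dderiv_sum_Basis[OF d, of v] by (rule norm_sum)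
        also have "\<dots> \<le> (\<Sum>b\<in>Basis. norm v * C b)"
          unfolding norm_mult norm_of_real using C z by (intro sum_mono mult_mono Basis_le_norm) auto
        finally show "cmod (dderiv v h z) \<le> L * norm v"
          by (simp add: L_def sum_distrib_left mult.commute)
      qed
    next
      show "p \<in> cball p \<eta>" using y by (simp add: order_trans[OF zero_le_dist])
    qed (use y in auto)
    then show ?thesis by (simp add: dist_norm)
  qed
  moreover have "0 \<le> L" unfolding L_def using C by (simp add: sum_nonneg)
  ultimately show ?thesis by blast
qed

lemma harmonic_on_C1:
  assumes "harmonic_on \<Omega> v"
  shows "\<And>x. x \<in> \<Omega> \<Longrightarrow> v differentiable (at x)" "continuous_on \<Omega> v"
    "\<And>b. b \<in> Basis \<Longrightarrow> continuous_on \<Omega> (dderiv b v)"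
proof -
  show d: "v differentiable (at x)" if "x \<in> \<Omega>" for x using assms that by (simp add: harmonic_on_def)
  then show "continuous_on \<Omega> v"
    by (meson differentiable_imp_continuous_within continuous_at_imp_continuous_on)
  show "continuous_on \<Omega> (dderiv b v)" if "b \<in> Basis" for b
    using assms that unfolding harmonic_on_def
    by (meson differentiable_imp_continuous_within continuous_at_imp_continuous_on)
qed

text \<open>The two bounds come from compactness of the ball, the third from treating the product of
  \<open>v\<close> and \<open>w\<close> as a single C1 function; \<open>U\<close> is the maximum of
  the constants.\<close>

lemma harmonic_local_bounds:
  fixes v w :: "'a::euclidean_space \<Rightarrow> complex"
  assumes v: "harmonic_on \<Omega> v" and w: "harmonic_on \<Omega> w" and sub: "cball p \<eta> \<subseteq> \<Omega>"
  shows "\<exists>U\<ge>0. \<forall>y\<in>cball p \<eta>. cmod (v y) \<le> U \<and> cmod (w y) \<le> U \<and>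
    cmod (v y * w y - v p * w p) \<le> U * dist y p"
proof -
  note V = harmonic_on_C1[OF v] and W = harmonic_on_C1[OF w]
  have "bounded (v ` cball p \<eta>)" "bounded (w ` cball p \<eta>)"
    by (intro compact_imp_bounded compact_continuous_image continuous_on_subset[OF V(2) sub]
        continuous_on_subset[OF W(2) sub] compact_cball)+
  then obtain A B where AB: "\<And>y. y \<in> cball p \<eta> \<Longrightarrow> cmod (v y) \<le> A" "\<And>y. y \<in> cball p \<eta> \<Longrightarrow> cmod (w y) \<le> B"
    unfolding bounded_iff by blast
  have "\<exists>L\<ge>0. \<forall>y\<in>cball p \<eta>. cmod ((\<lambda>x. v x * w x) y - (\<lambda>x. v x * w x) p) \<le> L * dist y p"
  proof (rule C1_lipschitz_on_cball[OF sub])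
    show "(\<lambda>x. v x * w x) differentiable (at x)" if "x \<in> \<Omega>" for x
      by (intro differentiable_mult V(1) W(1) that)
    fix b :: 'a assume b: "b \<in> Basis"
    have "continuous_on \<Omega> (\<lambda>x. v x * dderiv b w x + dderiv b v x * w x)"
      by (intro continuous_on_add continuous_on_mult V(2) W(2) V(3)[OF b] W(3)[OF b])
    moreover have "v x * dderiv b w x + dderiv b v x * w x = dderiv b (\<lambda>x. v x * w x) x" if "x \<in> \<Omega>" for x
      by (rule dderiv_mult[OF V(1) W(1), symmetric]) (rule that)+
    ultimately show "continuous_on \<Omega> (dderiv b (\<lambda>x. v x * w x))"
      by (subst (asm) continuous_on_cong[OF refl]) auto
  qed
  then obtain L where L: "0 \<le> L" "\<And>y. y \<in> cball p \<eta> \<Longrightarrow> cmod (v y * w y - v p * w p) \<le> L * dist y p" by blast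
  define U where "U = max A (max B L)"
  have U: "A \<le> U" "B \<le> U" "L \<le> U" by (auto simp: U_def)
  have "cmod (v y) \<le> U \<and> cmod (w y) \<le> U \<and> cmod (v y * w y - v p * w p) \<le> U * dist y p" if y: "y \<in> cball p \<eta>" for y
    using AB[OF y] U order_trans[OF L(2)[OF y] mult_right_mono[OF U(3) zero_le_dist]] by auto
  moreover have "0 \<le> U" using U(3) L(1) by linarith
  ultimately show ?thesis by blast
qed

section \<open>Geometry of the inclusions and the leading term\<close>

lemma inclusion_subset_cball:
  assumes "\<And>y. y \<in> B \<Longrightarrow> norm y \<le> r" "0 \<le> \<epsilon>"
  shows "inclusion z \<epsilon> B \<subseteq> cball z (\<epsilon> * r)"
  using assms by (auto simp: inclusion_def dist_norm mult_left_mono)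

lemma open_inclusion:
  fixes B :: "'a::euclidean_space set"
  assumes "open B" "0 < \<epsilon>"
  shows "open (inclusion z \<epsilon> B)"
proof -
  have "inclusion z \<epsilon> B = (+) z ` ((*\<^sub>R) \<epsilon> ` B)" by (auto simp: inclusion_def)
  then show ?thesis using assms by (simp add: open_translation open_scaling)
qed

lemma measure_inclusion:
  fixes B :: "'a::euclidean_space set"
  assumes "0 < \<epsilon>"
  shows "measure lebesgue (inclusion z \<epsilon> B) = \<epsilon> ^ DIM('a) * measure lebesgue B"
proof -
  have "inclusion z \<epsilon> B = (\<lambda>x. \<epsilon> *\<^sub>R x + z) ` B" by (auto simp: inclusion_def add.commute)
  then show ?thesis using measure_lebesgue_affine[of \<epsilon> z B] assms by simp
qed

lemma integral_lebesgue_on_subset: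
  fixes f :: "'a::euclidean_space \<Rightarrow> real"
  assumes "S \<in> sets lebesgue" "T \<in> sets lebesgue" "S \<subseteq> T"
  shows "(LINT y|lebesgue_on S. f y) = (LINT y|lebesgue_on T. indicator S y * f y)"
proof -
  have "(LINT y|lebesgue_on S. f y) = (LINT y|lebesgue. indicator S y *\<^sub>R f y)"
    using assms by (intro integral_restrict_space) simp
  also have "\<dots> = (LINT y|lebesgue. indicator T y *\<^sub>R (indicator S y * f y))"
    by (rule Bochner_Integration.integral_cong) (use assms(3) in \<open>auto simp: indicator_def\<close>)
  also have "\<dots> = (LINT y|lebesgue_on T. indicator S y * f y)"
    using assms by (intro integral_restrict_space[symmetric]) simp
  finally show ?thesis .
qed

context lipschitz_domain
begin

lemma indicator_integral:
  assumes "S \<in> sets borel" "S \<subseteq> \<Omega>"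
  shows "(LINT x|M. indicator S x) = measure lebesgue S" "integrable M (indicator S :: 'a \<Rightarrow> real)"
proof -
  have SM: "S \<in> sets M" using assms borel_in_lebesgue domain_sets by (simp add: sets_restrict_space_iff)
  show "(LINT x|M. indicator S x) = measure lebesgue S"
    using assms SM sets.sets_into_space[OF SM] domain_sets by (simp add: Int_absorb2 measure_restrict_space)
  show "integrable M (indicator S :: 'a \<Rightarrow> real)"
    using SM finite_measure.emeasure_finite[OF finite_M] by (intro integrable_real_indicator) (auto simp: less_top)
qed

text \<open>Split h = c + (h - c): the constant part yields the integral of the coefficient exactly,
  the rest is at most \<delta> on \<open>S\<close>. With \<delta> of order eps this is the price of
  evaluating at the point x_j.\<close>

lemma inclusion_expansion:
  fixes S :: "'a set" and \<rho> :: "'a \<Rightarrow> real" and h :: "'a \<Rightarrow> complex"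
  assumes S: "S \<in> sets borel" "S \<subseteq> \<Omega>" and \<rho>m: "(\<lambda>x. indicator S x * \<rho> x) \<in> borel_measurable M"
    and \<rho>b: "AE x in M. \<bar>indicator S x * \<rho> x\<bar> \<le> P * indicator S x" and P: "0 \<le> P"
    and hm: "h \<in> borel_measurable M" and h: "\<And>x. x \<in> S \<Longrightarrow> cmod (h x - c) \<le> \<delta>" and \<delta>: "0 \<le> \<delta>"
  shows "integrable M (\<lambda>x. of_real (indicator S x * \<rho> x) * h x)"
    "cmod ((LINT x|M. of_real (indicator S x * \<rho> x) * h x) - of_real (LINT x|lebesgue_on S. \<rho> x) * c)
      \<le> P * \<delta> * measure lebesgue S"
proof -
  let ?q = "\<lambda>x. complex_of_real (indicator S x * \<rho> x)"
  note I = indicator_integral[OF S]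
  have mq: "?q \<in> borel_measurable M"
    by (rule measurable_compose[OF \<rho>m]) (intro borel_measurable_continuous_onI continuous_intros)
  have iq: "integrable M (\<lambda>x. indicator S x * \<rho> x)"
    by (rule Bochner_Integration.integrable_bound[OF integrable_mult_right[OF I(2), of P] \<rho>m])
      (use \<rho>b in \<open>eventually_elim, simp add: abs_mult P\<close>)
  have i1: "integrable M (\<lambda>x. ?q x * c)"
    by (intro integrable_mult_left integrable_of_real iq)
  have m2: "(\<lambda>x. ?q x * (h x - c)) \<in> borel_measurable M"
    by (intro borel_measurable_times borel_measurable_diff borel_measurable_const mq hm)
  have le: "AE x in M. cmod (?q x * (h x - c)) \<le> P * \<delta> * indicator S x"
    using \<rho>b
  proof eventually_elim
    case (elim x)
    show ?case
    proof (cases "x \<in> S")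
      case True
      then show ?thesis
        unfolding norm_mult norm_of_real using elim h[OF True] P \<delta>
        by (simp add: mult_mono)
    qed simp
  qed
  have iP: "integrable M (\<lambda>x. P * \<delta> * indicator S x)" by (intro integrable_mult_right I(2))
  have i2: "integrable M (\<lambda>x. ?q x * (h x - c))"
    by (rule Bochner_Integration.integrable_bound[OF iP m2])
      (use le in \<open>eventually_elim, simp add: P \<delta> abs_mult\<close>)
  have split: "?q x * h x = ?q x * (h x - c) + ?q x * c" for x by (simp add: algebra_simps)
  show "integrable M (\<lambda>x. ?q x * h x)" unfolding split by (intro Bochner_Integration.integrable_add i1 i2)
  have "(LINT x|M. ?q x * c) = of_real (LINT x|M. indicator S x * \<rho> x) * c"
    by (simp only: integral_mult_left_zero integral_of_real[OF iq])
  also have "(LINT x|M. indicator S x * \<rho> x) = (LINT x|lebesgue_on S. \<rho> x)"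
    by (intro integral_lebesgue_on_subset[symmetric] borel_in_lebesgue S domain_sets)
  finally have "(LINT x|M. ?q x * h x) - of_real (LINT x|lebesgue_on S. \<rho> x) * c = (LINT x|M. ?q x * (h x - c))"
    unfolding split Bochner_Integration.integral_add[OF i2 i1] by simp
  also have "cmod \<dots> \<le> (LINT x|M. cmod (?q x * (h x - c)))" by (rule integral_norm_bound)
  also have "\<dots> \<le> (LINT x|M. P * \<delta> * indicator S x)" by (rule integral_mono_AE[OF integrable_norm[OF i2] iP le])
  also have "\<dots> = P * \<delta> * measure lebesgue S" using I(1) by simp
  finally show "cmod ((LINT x|M. ?q x * h x) - of_real (LINT x|lebesgue_on S. \<rho> x) * c) \<le> P * \<delta> * measure lebesgue S" .
qed

end

text \<open>The coefficient is controlled on \<open>D\<close> only; the factor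
  \<open>indicat_real D y\<close> makes it a bounded measurable function on \<Omega>, whatever its
  values elsewhere.\<close>

lemma restricted_coefficient:
  fixes \<rho> :: "'a::euclidean_space \<Rightarrow> real"
  assumes D: "D \<in> sets lebesgue" and \<Omega>: "\<Omega> \<in> sets lebesgue" "D \<subseteq> \<Omega>"
    and \<rho>: "\<rho> \<in> borel_measurable (lebesgue_on D)" "AE y in lebesgue_on D. 0 \<le> \<rho> y \<and> \<rho> y \<le> P"
  shows "(\<lambda>y. \<rho> y * indicat_real D y) \<in> borel_measurable (lebesgue_on \<Omega>)"
    "AE y in lebesgue_on \<Omega>. 0 \<le> \<rho> y * indicat_real D y \<and> \<rho> y * indicat_real D y \<le> P * indicat_real D y"
proof -
  have "(\<lambda>y. indicat_real D y *\<^sub>R \<rho> y) \<in> borel_measurable lebesgue"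
    using \<rho>(1) D by (subst (asm) borel_measurable_restrict_space_iff) auto
  then show "(\<lambda>y. \<rho> y * indicat_real D y) \<in> borel_measurable (lebesgue_on \<Omega>)"
    by (intro measurable_restrict_space1) (simp add: mult.commute)
  have "AE y in lebesgue. y \<in> D \<longrightarrow> 0 \<le> \<rho> y \<and> \<rho> y \<le> P"
    using \<rho>(2) D by (subst (asm) AE_restrict_space_iff) auto
  then have "AE y in lebesgue. y \<in> \<Omega> \<longrightarrow> 0 \<le> \<rho> y * indicat_real D y \<and> \<rho> y * indicat_real D y \<le> P * indicat_real D y"
    by eventually_elim (auto simp: indicator_def)
  then show "AE y in lebesgue_on \<Omega>. 0 \<le> \<rho> y * indicat_real D y \<and> \<rho> y * indicat_real D y \<le> P * indicat_real D y"
    using \<Omega> by (subst AE_restrict_space_iff) auto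
qed

text \<open>Serves to show that the denominator in \<open>Avg\<close> is nonzero.\<close>

lemma measure_open_pos:
  fixes S :: "'a::euclidean_space set"
  assumes "open S" "S \<noteq> {}" "bounded S"
  shows "0 < measure lebesgue S"
proof -
  have "S \<in> lmeasurable" using assms borel_in_lebesgue by (intro bounded_set_imp_lmeasurable) auto
  moreover have "\<not> negligible S" using assms open_not_negligible by blast
  ultimately have "measure lebesgue S \<noteq> 0" using negligible_iff_measure by blast
  then show ?thesis by (simp add: zero_less_measure_iff)
qed

theorem mainTheorem2:
  fixes \<Omega> :: "'a::euclidean_space set"
    and J :: nat
    and x :: "nat \<Rightarrow> 'a"
    and B :: "nat \<Rightarrow> 'a set"
    and c\<^sub>0 \<epsilon>\<^sub>0 \<rho>min \<rho>max :: real
    and D :: "real \<Rightarrow> 'a set"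
    and \<rho> :: "real \<Rightarrow> 'a \<Rightarrow> real"
    and f g u\<^sub>0f u\<^sub>0g :: "'a \<Rightarrow> complex"
    and u :: "real \<Rightarrow> 'a \<Rightarrow> complex"
  assumes dim: "DIM('a) \<in> {2, 3}"
    and Omega: "open \<Omega>" "bounded \<Omega>" "simply_connected \<Omega>" "lipschitz_boundary \<Omega>"
    and J: "1 \<le> J"
    and points: "\<And>i. i \<in> {1..J} \<Longrightarrow> x i \<in> \<Omega>"
    and c0: "0 < c\<^sub>0"
    and separated: "\<And>i j. i \<in> {1..J} \<Longrightarrow> j \<in> {1..J} \<Longrightarrow> i \<noteq> j \<Longrightarrow> c\<^sub>0 \<le> norm (x i - x j)"
    and shapes: "\<And>j. j \<in> {1..J} \<Longrightarrow>
          open (B j) \<and> connected (B j) \<and> B j \<noteq> {} \<and> bounded (B j) \<and>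
          lipschitz_boundary (B j) \<and> centered_at_origin (B j)"
    and D_def: "\<And>\<epsilon>. D \<epsilon> = (\<Union>j\<in>{1..J}. inclusion (x j) \<epsilon> (B j))"
    and eps0: "0 < \<epsilon>\<^sub>0"
    and disjoint: "\<And>\<epsilon>. 0 < \<epsilon> \<Longrightarrow> \<epsilon> < \<epsilon>\<^sub>0 \<Longrightarrow>
          disjoint_family_on (\<lambda>j. inclusion (x j) \<epsilon> (B j)) {1..J}"
    and inside: "\<And>\<epsilon>. 0 < \<epsilon> \<Longrightarrow> \<epsilon> < \<epsilon>\<^sub>0 \<Longrightarrow> D \<epsilon> \<subseteq> \<Omega> \<and> 0 < setdist (D \<epsilon>) (frontier \<Omega>)"
    and rho_bounds: "0 < \<rho>min"
    and rho: "\<And>\<epsilon>. 0 < \<epsilon> \<Longrightarrow> \<epsilon> < \<epsilon>\<^sub>0 \<Longrightarrow>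
          \<rho> \<epsilon> \<in> borel_measurable (lebesgue_on (D \<epsilon>)) \<and>
          (AE y in lebesgue_on (D \<epsilon>). \<rho>min \<le> \<rho> \<epsilon> y \<and> \<rho> \<epsilon> y \<le> \<rho>max)"
    and f: "f \<in> H_half \<Omega>"
    and g: "g \<in> H_half \<Omega>"
    and u: "\<And>\<epsilon>. 0 < \<epsilon> \<Longrightarrow> \<epsilon> < \<epsilon>\<^sub>0 \<Longrightarrow>
          dirichlet_solution \<Omega> (\<lambda>y. \<rho> \<epsilon> y * indicat_real (D \<epsilon>) y) f (u \<epsilon>)"
    and u0f: "harmonic_extension \<Omega> f u\<^sub>0f"
    and u0g: "harmonic_extension \<Omega> g u\<^sub>0g"
  shows "(\<lambda>\<epsilon>. reciprocity_gap \<Omega> (u \<epsilon>) u\<^sub>0g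
              - of_real (\<epsilon> ^ DIM('a)) *
                (\<Sum>j\<in>{1..J}. of_real (measure lebesgue (B j) * Avg (\<rho> \<epsilon>) (inclusion (x j) \<epsilon> (B j)))
                   * u\<^sub>0f (x j) * u\<^sub>0g (x j)))
         \<in> O[at_right 0](\<lambda>\<epsilon>. complex_of_real (\<epsilon> ^ (DIM('a) + 1)))"
proof -
  let ?d = "DIM('a)"
  let ?M = "lebesgue_on \<Omega>"
  have frontier: "frontier \<Omega> \<noteq> {}"
    using points[of 1] J Omega(2) by (auto simp: frontier_eq_empty)
  have d2: "2 \<le> ?d" using dim by auto
  interpret L: lipschitz_domain \<Omega>
    by unfold_locales (use Omega frontier d2 in auto)
  obtain R where R: "0 < R" "\<And>y. y \<in> \<Omega> \<Longrightarrow> norm y < R" using Omega(2) unfolding bounded_pos_less by blast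
  obtain b :: 'a where b: "b \<in> Basis" using nonempty_Basis by blast
  have "bounded (\<Union>j\<in>{1..J}. B j)" using shapes by (intro bounded_UN) auto
  then obtain r where r: "0 < r" "\<And>j y. j \<in> {1..J} \<Longrightarrow> y \<in> B j \<Longrightarrow> norm y \<le> r" unfolding bounded_pos by blast
  have har: "harmonic_on \<Omega> u\<^sub>0f" "harmonic_on \<Omega> u\<^sub>0g" using u0f u0g by (auto simp: harmonic_extension_def)
  have "\<exists>\<eta> U. 0 < \<eta> \<and> cball (x j) \<eta> \<subseteq> \<Omega> \<and> 0 \<le> U \<and> (\<forall>y\<in>cball (x j) \<eta>. cmod (u\<^sub>0f y) \<le> U \<and> cmod (u\<^sub>0g y) \<le> U \<and>
      cmod (u\<^sub>0f y * u\<^sub>0g y - u\<^sub>0f (x j) * u\<^sub>0g (x j)) \<le> U * dist y (x j))" if j: "j \<in> {1..J}" for j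
  proof -
    obtain \<eta> where \<eta>: "0 < \<eta>" "cball (x j) \<eta> \<subseteq> \<Omega>"
      using open_contains_cball_eq[OF Omega(1)] points[OF j] by blast
    from harmonic_local_bounds[OF har \<eta>(2)] show ?thesis using \<eta> by blast
  qed
  then obtain \<eta> U where \<eta>: "\<And>j. j \<in> {1..J} \<Longrightarrow> 0 < \<eta> j" "\<And>j. j \<in> {1..J} \<Longrightarrow> cball (x j) (\<eta> j) \<subseteq> \<Omega>"
    and U: "\<And>j. j \<in> {1..J} \<Longrightarrow> 0 \<le> U j"
    and bnd: "\<And>j y. j \<in> {1..J} \<Longrightarrow> y \<in> cball (x j) (\<eta> j) \<Longrightarrow> cmod (u\<^sub>0f y) \<le> U j \<and> cmod (u\<^sub>0g y) \<le> U j \<and>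
      cmod (u\<^sub>0f y * u\<^sub>0g y - u\<^sub>0f (x j) * u\<^sub>0g (x j)) \<le> U j * dist y (x j)"
    by metis
  define \<eta>0 where "\<eta>0 = Min (\<eta> ` {1..J})"
  have \<eta>0: "0 < \<eta>0" "\<And>j. j \<in> {1..J} \<Longrightarrow> \<eta>0 \<le> \<eta> j" unfolding \<eta>0_def using J \<eta>(1) by auto
  define W where "W = (\<Sum>j\<in>{1..J}. U j)"
  have W: "0 \<le> W" "\<And>j. j \<in> {1..J} \<Longrightarrow> U j \<le> W"
    unfolding W_def using U by (auto intro!: sum_nonneg member_le_sum)
  define P where "P = \<bar>\<rho>max\<bar>"
  define V where "V = (\<Sum>j\<in>{1..J}. measure lebesgue (B j))"
  \<comment> \<open>The first summand is the oscillation of the product of \<open>u\<^sub>0f\<close>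
    and \<open>u\<^sub>0g\<close> over inclusions of radius at most \<open>\<epsilon> * r\<close>;
    the second is the replacement of \<open>u \<epsilon>\<close> by \<open>u\<^sub>0f\<close>, with
    strips of half-width \<open>\<epsilon> * r\<close>. Each \<open>\<epsilon> * r\<close> supplies
    the extra power of \<epsilon>.\<close>
  define C where "C = P * (W * r) * V + (P * W)\<^sup>2 * (card {1..J} * (16 * R * r)) * V"
  \<comment> \<open>Ensures \<open>\<epsilon> * r < \<eta>0\<close>, so that every inclusion lies in
    the ball about its point on which the harmonic functions are controlled.\<close>
  define \<epsilon>\<^sub>1 where "\<epsilon>\<^sub>1 = min \<epsilon>\<^sub>0 (\<eta>0 / r)"
  have e1: "0 < \<epsilon>\<^sub>1" using eps0 \<eta>0 r by (simp add: \<epsilon>\<^sub>1_def)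
  have P: "0 \<le> P" by (simp add: P_def)
  have main: "cmod (reciprocity_gap \<Omega> (u \<epsilon>) u\<^sub>0g
              - of_real (\<epsilon> ^ ?d) *
                (\<Sum>j\<in>{1..J}. of_real (measure lebesgue (B j) * Avg (\<rho> \<epsilon>) (inclusion (x j) \<epsilon> (B j)))
                   * u\<^sub>0f (x j) * u\<^sub>0g (x j)))
      \<le> C * \<epsilon> ^ (?d + 1)" if e: "0 < \<epsilon>" "\<epsilon> < \<epsilon>\<^sub>1" for \<epsilon>
  proof -
    have e0: "\<epsilon> < \<epsilon>\<^sub>0" and er: "\<epsilon> * r < \<eta>0" using e r by (auto simp: \<epsilon>\<^sub>1_def field_simps)
    define S where "S = (\<lambda>j. inclusion (x j) \<epsilon> (B j))"
    define h where "h = (\<lambda>y. u\<^sub>0f y * u\<^sub>0g y)"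
    define q where "q = (\<lambda>y. \<rho> \<epsilon> y * indicat_real (D \<epsilon>) y)"
    have DS: "D \<epsilon> = (\<Union>j\<in>{1..J}. S j)" unfolding S_def by (rule D_def)
    have Scb: "S j \<subseteq> cball (x j) (\<epsilon> * r)" if "j \<in> {1..J}" for j
      unfolding S_def by (rule inclusion_subset_cball) (use r(2)[OF that] e in auto)
    have S\<eta>: "S j \<subseteq> cball (x j) (\<eta> j)" if "j \<in> {1..J}" for j
      using Scb[OF that] er \<eta>0(2)[OF that] by (auto intro: order_trans)
    have S\<Omega>: "S j \<subseteq> \<Omega>" if "j \<in> {1..J}" for j using S\<eta>[OF that] \<eta>(2)[OF that] by blast
    have Sop: "open (S j)" if "j \<in> {1..J}" for j
      unfolding S_def by (rule open_inclusion) (use shapes[OF that] e in auto)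
    have Sb: "S j \<in> sets borel" if "j \<in> {1..J}" for j using Sop[OF that] by simp
    have mS: "measure lebesgue (S j) = \<epsilon> ^ ?d * measure lebesgue (B j)" for j
      unfolding S_def by (rule measure_inclusion[OF e(1)])
    have Db: "D \<epsilon> \<in> sets borel" unfolding DS using Sop by (intro borel_open open_UN) auto
    have D\<Omega>: "D \<epsilon> \<subseteq> \<Omega>" unfolding DS using S\<Omega> by blast
    have \<rho>1: "\<rho> \<epsilon> \<in> borel_measurable (lebesgue_on (D \<epsilon>))" using rho[OF e(1) e0] by simp
    have "AE y in lebesgue_on (D \<epsilon>). \<rho>min \<le> \<rho> \<epsilon> y \<and> \<rho> \<epsilon> y \<le> \<rho>max" using rho[OF e(1) e0] by simp
    then have \<rho>2: "AE y in lebesgue_on (D \<epsilon>). 0 \<le> \<rho> \<epsilon> y \<and> \<rho> \<epsilon> y \<le> P"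
      by eventually_elim (use rho_bounds in \<open>auto simp: P_def\<close>)
    have q: "q \<in> borel_measurable ?M" "AE y in ?M. 0 \<le> q y \<and> q y \<le> P * indicat_real (D \<epsilon>) y"
      unfolding q_def
      by (rule restricted_coefficient[OF borel_in_lebesgue[OF Db] L.domain_sets(2) D\<Omega> \<rho>1 \<rho>2])+
    have sol: "dirichlet_solution \<Omega> q f (u \<epsilon>)" using u[OF e(1) e0] by (simp add: q_def)
    have uH: "u \<epsilon> \<in> H1 \<Omega>" and lap: "has_weak_laplacian \<Omega> (u \<epsilon>) (\<lambda>y. of_real (q y) * u \<epsilon> y)"
      and tru: "has_trace \<Omega> (u \<epsilon>) f" using sol by (auto simp: dirichlet_solution_def)
    have gH: "u\<^sub>0g \<in> H1 \<Omega>" and trg: "has_trace \<Omega> u\<^sub>0g g" and fH: "u\<^sub>0f \<in> H1 \<Omega>"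
      using u0g u0f by (auto simp: harmonic_extension_def)
    have k: "(\<lambda>y. of_real (q y) * u \<epsilon> y) \<in> L2 ?M"
    proof (rule L2_bound[OF L.H1_L2[OF uH]])
      show "(\<lambda>y. of_real (q y) * u \<epsilon> y) \<in> borel_measurable ?M"
        by (intro borel_measurable_times L2_measurable[OF L.H1_L2[OF uH]]
            measurable_compose[OF q(1)] borel_measurable_continuous_onI continuous_intros)
      show "AE y in ?M. cmod (of_real (q y) * u \<epsilon> y) \<le> P * cmod (u \<epsilon> y)"
        using q(2)
      proof eventually_elim
        case (elim y)
        have "P * indicat_real (D \<epsilon>) y \<le> P" using P by (auto simp: indicator_def)
        then show ?case unfolding norm_mult norm_of_real using elim by (intro mult_right_mono) auto
      qed
    qed
    have gap: "reciprocity_gap \<Omega> (u \<epsilon>) u\<^sub>0g = (LINT y|?M. of_real (q y) * u \<epsilon> y * u\<^sub>0g y)"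
      by (rule L.reciprocity_gap_eq[OF tru k lap trg L.harmonic_has_weak_laplacian[OF gH har(2)]])
    have strips: "D \<epsilon> \<subseteq> (\<Union>j\<in>{1..J}. L.strip b (x j) (\<epsilon> * r))"
    proof
      fix y assume "y \<in> D \<epsilon>"
      then obtain j where j: "j \<in> {1..J}" "y \<in> S j" unfolding DS by blast
      have "\<bar>(y - x j) \<bullet> b\<bar> \<le> norm (y - x j)" using Basis_le_norm[OF b] by blast
      also have "\<dots> \<le> \<epsilon> * r" using Scb[OF j(1)] j(2) by (auto simp: dist_norm norm_minus_commute)
      finally show "y \<in> (\<Union>j\<in>{1..J}. L.strip b (x j) (\<epsilon> * r))" using j(1) by (auto simp: L.strip_def)
    qed
    have UD: "cmod (u\<^sub>0f y) \<le> W" "cmod (u\<^sub>0g y) \<le> W" if y: "y \<in> D \<epsilon>" for y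
    proof -
      obtain j where j: "j \<in> {1..J}" "y \<in> S j" using y unfolding DS by blast
      then have "cmod (u\<^sub>0f y) \<le> U j" "cmod (u\<^sub>0g y) \<le> U j" using bnd[OF j(1)] S\<eta>[OF j(1)] by auto
      then show "cmod (u\<^sub>0f y) \<le> W" "cmod (u\<^sub>0g y) \<le> W" using W(2)[OF j(1)] by auto
    qed
    have er0: "0 \<le> \<epsilon> * r" using e r by simp
    note pert = L.potential_perturbation_bound[OF R sol u0f k q Db D\<Omega> strips _ b er0 P W(1) UD L.H1_L2[OF gH]]
    let ?T = "\<lambda>j y. of_real (indicat_real (S j) y * \<rho> \<epsilon> y) * h y"
    \<comment> \<open>Disjointness of the inclusions turns the indicator of their union into a
      sum.\<close>
    have qS: "q y = (\<Sum>j\<in>{1..J}. indicat_real (S j) y * \<rho> \<epsilon> y)" for y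
    proof -
      have "indicat_real (D \<epsilon>) y = (\<Sum>j\<in>{1..J}. indicat_real (S j) y)"
        unfolding DS by (rule indicator_UN_disjoint) (use disjoint[OF e(1) e0] in \<open>auto simp: S_def\<close>)
      then show ?thesis by (simp add: q_def sum_distrib_left mult.commute)
    qed
    have hm: "h \<in> borel_measurable ?M"
      unfolding h_def by (intro borel_measurable_times L2_measurable L.H1_L2 fH gH)
    have exp: "integrable ?M (?T j)"
      "cmod ((LINT y|?M. ?T j y) - of_real (LINT y|lebesgue_on (S j). \<rho> \<epsilon> y) * h (x j)) \<le> P * (W * (\<epsilon> * r)) * measure lebesgue (S j)"
      if j: "j \<in> {1..J}" for j
    proof -
      have sub: "S j \<subseteq> D \<epsilon>" unfolding DS using j by blast
      have eq: "indicat_real (S j) y * \<rho> \<epsilon> y = indicat_real (S j) y * q y" for y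
        using sub by (auto simp: q_def indicator_def)
      have m: "(\<lambda>y. indicat_real (S j) y * \<rho> \<epsilon> y) \<in> borel_measurable ?M"
        unfolding eq by (intro borel_measurable_times q(1) borel_measurable_lebesgue_on borel_measurable_indicator Sb j)
      have a: "AE y in ?M. \<bar>indicat_real (S j) y * \<rho> \<epsilon> y\<bar> \<le> P * indicat_real (S j) y"
        using q(2) unfolding eq by eventually_elim (use sub in \<open>auto simp: indicator_def\<close>)
      have hl: "cmod (h y - h (x j)) \<le> W * (\<epsilon> * r)" if y: "y \<in> S j" for y
      proof -
        have "cmod (h y - h (x j)) \<le> U j * dist y (x j)" using bnd[OF j] S\<eta>[OF j] y by (auto simp: h_def)
        also have "\<dots> \<le> W * (\<epsilon> * r)"
          using Scb[OF j] y by (intro mult_mono W j) (auto simp: dist_commute)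
        finally show ?thesis .
      qed
      have W0: "0 \<le> W * (\<epsilon> * r)" using W(1) er0 by simp
      show "integrable ?M (?T j)"
        "cmod ((LINT y|?M. ?T j y) - of_real (LINT y|lebesgue_on (S j). \<rho> \<epsilon> y) * h (x j)) \<le> P * (W * (\<epsilon> * r)) * measure lebesgue (S j)"
        by (rule L.inclusion_expansion[OF Sb[OF j] S\<Omega>[OF j] m a P hm hl W0]; assumption)+
    qed
    have qh: "of_real (q y) * h y = (\<Sum>j\<in>{1..J}. ?T j y)" for y
      unfolding qS of_real_sum sum_distrib_right ..
    have i2: "integrable ?M (\<lambda>y. of_real (q y) * h y)"
      unfolding qh by (intro Bochner_Integration.integrable_sum exp)
    \<comment> \<open>Writing \<open>u \<epsilon>\<close> as its difference from
      \<open>u\<^sub>0f\<close> plus \<open>u\<^sub>0f\<close> separates the perturbation error from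
      the explicit leading integrand.\<close>
    have "(LINT y|?M. of_real (q y) * u \<epsilon> y * u\<^sub>0g y)
        = (LINT y|?M. of_real (q y) * (u \<epsilon> y - u\<^sub>0f y) * u\<^sub>0g y + of_real (q y) * h y)"
      by (rule Bochner_Integration.integral_cong) (auto simp: h_def algebra_simps)
    also have "\<dots> = (LINT y|?M. of_real (q y) * (u \<epsilon> y - u\<^sub>0f y) * u\<^sub>0g y) + (LINT y|?M. of_real (q y) * h y)"
      by (rule Bochner_Integration.integral_add[OF pert(1) i2]) auto
    also have "(LINT y|?M. of_real (q y) * h y) = (\<Sum>j\<in>{1..J}. LINT y|?M. ?T j y)"
      unfolding qh by (rule Bochner_Integration.integral_sum) (rule exp)
    finally have gap2: "reciprocity_gap \<Omega> (u \<epsilon>) u\<^sub>0g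
        = (LINT y|?M. of_real (q y) * (u \<epsilon> y - u\<^sub>0f y) * u\<^sub>0g y) + (\<Sum>j\<in>{1..J}. LINT y|?M. ?T j y)"
      unfolding gap .
    have lead: "of_real (\<epsilon> ^ ?d) * (\<Sum>j\<in>{1..J}. of_real (measure lebesgue (B j) * Avg (\<rho> \<epsilon>) (inclusion (x j) \<epsilon> (B j)))
                   * u\<^sub>0f (x j) * u\<^sub>0g (x j))
        = (\<Sum>j\<in>{1..J}. of_real (LINT y|lebesgue_on (S j). \<rho> \<epsilon> y) * h (x j))"
      unfolding sum_distrib_left
    proof (rule sum.cong[OF refl])
      fix j assume j: "j \<in> {1..J}"
      have "0 < measure lebesgue (B j)" using shapes[OF j] by (intro measure_open_pos) auto
      \<comment> \<open>The volume of the inclusion is \<open>\<epsilon> ^ ?d\<close> times that of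
        \<open>B j\<close>, so it cancels against the denominator of the average and the plain
        integral of the coefficient remains.\<close>
      then have "\<epsilon> ^ ?d * (measure lebesgue (B j) * Avg (\<rho> \<epsilon>) (S j)) = (LINT y|lebesgue_on (S j). \<rho> \<epsilon> y)"
        using e(1) by (simp add: Avg_def mS)
      then have "of_real (LINT y|lebesgue_on (S j). \<rho> \<epsilon> y) * h (x j)
         = complex_of_real (\<epsilon> ^ ?d) * of_real (measure lebesgue (B j) * Avg (\<rho> \<epsilon>) (S j)) * h (x j)"
        by (metis of_real_mult)
      then show "of_real (\<epsilon> ^ ?d) * (of_real (measure lebesgue (B j) * Avg (\<rho> \<epsilon>) (inclusion (x j) \<epsilon> (B j)))
                   * u\<^sub>0f (x j) * u\<^sub>0g (x j)) = of_real (LINT y|lebesgue_on (S j). \<rho> \<epsilon> y) * h (x j)"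
        using fun_cong[OF S_def, of j] by (simp only: h_def mult.assoc)
    qed
    have VS: "(\<Sum>j\<in>{1..J}. measure lebesgue (S j)) = \<epsilon> ^ ?d * V" by (simp add: V_def mS sum_distrib_left)
    have mD: "measure lebesgue (D \<epsilon>) \<le> \<epsilon> ^ ?d * V"
      unfolding DS VS[symmetric] by (rule measure_UNION_le) (use Sb borel_in_lebesgue in auto)
    let ?A = "LINT y|?M. of_real (q y) * (u \<epsilon> y - u\<^sub>0f y) * u\<^sub>0g y"
    have "cmod (reciprocity_gap \<Omega> (u \<epsilon>) u\<^sub>0g - (\<Sum>j\<in>{1..J}. of_real (LINT y|lebesgue_on (S j). \<rho> \<epsilon> y) * h (x j)))
        = cmod (?A + (\<Sum>j\<in>{1..J}. (LINT y|?M. ?T j y) - of_real (LINT y|lebesgue_on (S j). \<rho> \<epsilon> y) * h (x j)))"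
      unfolding gap2 sum_subtractf by (simp add: algebra_simps)
    also have "\<dots> \<le> cmod ?A + (\<Sum>j\<in>{1..J}. cmod ((LINT y|?M. ?T j y) - of_real (LINT y|lebesgue_on (S j). \<rho> \<epsilon> y) * h (x j)))"
      by (intro norm_triangle_le add_left_mono norm_sum)
    also have "\<dots> \<le> (P * W)\<^sup>2 * (card {1..J} * (16 * R * (\<epsilon> * r))) * measure lebesgue (D \<epsilon>)
        + (\<Sum>j\<in>{1..J}. P * (W * (\<epsilon> * r)) * measure lebesgue (S j))"
      by (intro add_mono sum_mono exp pert(2)) auto
    also have "\<dots> \<le> (P * W)\<^sup>2 * (card {1..J} * (16 * R * (\<epsilon> * r))) * (\<epsilon> ^ ?d * V)
        + P * (W * (\<epsilon> * r)) * (\<epsilon> ^ ?d * V)"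
      unfolding sum_distrib_left[symmetric] VS
      using R(1) er0 by (intro add_right_mono mult_left_mono mD) auto
    also have "\<dots> = C * \<epsilon> ^ (?d + 1)"
      by (simp add: C_def algebra_simps)
    finally show ?thesis unfolding lead .
  qed
  have ev: "\<forall>\<^sub>F \<epsilon> in at_right 0. 0 < \<epsilon> \<and> \<epsilon> < \<epsilon>\<^sub>1"
    using eventually_at_right_real[OF e1] by eventually_elim auto
  show ?thesis
  proof (rule bigoI[where c=C])
    show "\<forall>\<^sub>F \<epsilon> in at_right 0. norm (reciprocity_gap \<Omega> (u \<epsilon>) u\<^sub>0g
              - of_real (\<epsilon> ^ DIM('a)) *
                (\<Sum>j\<in>{1..J}. of_real (measure lebesgue (B j) * Avg (\<rho> \<epsilon>) (inclusion (x j) \<epsilon> (B j)))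
                   * u\<^sub>0f (x j) * u\<^sub>0g (x j))) \<le> C * norm (complex_of_real (\<epsilon> ^ (DIM('a) + 1)))"
      using ev
    proof eventually_elim
      case (elim \<epsilon>)
      then have "norm (complex_of_real (\<epsilon> ^ (DIM('a) + 1))) = \<epsilon> ^ (DIM('a) + 1)"
        unfolding norm_of_real by (intro abs_of_nonneg zero_le_power) simp
      then show ?case using main[of \<epsilon>] elim by simp
    qed
  qed
qed

end
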